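(* Let $1\leq k\leq\infty$ and let $M^1=I$ or $M^1=\mathbb{S}^1$. A subset $A\subseteq\mathrm{Diff}_+^k(M^1)$ has the property (OB) relative to $\mathrm{Diff}_+^k(M^1)$ if and only if $$\sup_{f\in A}\sup_{x\in M^1}|\log f'(x)|<\infty\quad\text{and}\quad \sup_{f\in A}\sup_{x\in M^1}|f^{(j)}(x)|<\infty\ \text{ for every integer } j \text{ with } 2\leq j\leq k$$ (for $k=\infty$: for every integer $j\geq 2$).
   Context: $I=[0,1]$, and $\mathbb{S}^1$ is the circle, viewed as $[0,1]$ with $0$ and $1$ identified. For $1\leq k\leq\infty$, $\mathrm{Diff}_+^k(M^1)$ is the group (under composition) of orientation-preserving $C^k$-diffeomorphisms of $M^1$, with its usual $C^k$-topology: for $k<\infty$ this is induced by the metric $\rho_k(f,g)=\sup_{x\in M^1}d_{M^1}(f(x),g(x))+\sum_{j=1}^k\sup_{x\in M^1}|f^{(j)}(x)-g^{(j)}(x)|$, where $d_I$ is the usual distance and $d_{\mathbb{S}^1}([x],[y])=|e^{2\pi i x}-e^{2\pi i y}|$; for $k=\infty$ it is the topology generated by all the metrics $\rho_j$, $1\le j<\infty$. It is a connected Polish group. For an orientation-preserving homeomorphism $f$ of $\mathbb{S}^1$, let $\tilde f:\mathbb{R}\to\mathbb{R}$ be its unique lift with $\tilde f(0)\in[0,1)$, $\tilde f(x+1)=\tilde f(x)+1$ and $f(x \bmod 1)=\tilde f(x)\bmod 1$; $f$ is of class $C^k$ iff $\tilde f$ is, and derivatives on the circle are defined by $f^{(j)}(x)=\tilde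 f^{(j)}(x)$ for $j\ge 1$. A subset $\Sigma$ of a separable metrizable group $G$ has the property (OB) relative to $G$ if $\Sigma$ has finite diameter with respect to every right-invariant metric on $G$ that is compatible with the topology of $G$. (For a connected Polish group $G$ this is equivalent to: for every open neighborhood $U$ of the identity there is a positive integer $r$ with $\Sigma\subseteq U^r$.) *)

theory Defs
  imports "HOL-Analysis.Analysis" "HOL-Algebra.Group"
begin

section \<open>The compact connected one-manifolds\<close>

datatype one_manifold = Interval | Circle

text \<open>The circle is \<open>[0,1]\<close> with \<open>0\<close> and \<open>1\<close> identified; its points are represented by \<open>[0,1)\<close>,
  so that \<^const>\<open>frac\<close> is the quotient map from the reals. Its topology is the one of the metric
  below, in which points near \<open>1\<close> are close to \<open>0\<close>.\<close>

fun points :: "one_manifold \<Rightarrow> real set" where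
  "points Interval = {0..1}"
| "points Circle = {0..<1}"

fun mfd_dist :: "one_manifold \<Rightarrow> real \<Rightarrow> real \<Rightarrow> real" where
  "mfd_dist Interval x y = dist x y"
| "mfd_dist Circle x y = cmod (exp (2 * pi * \<i> * x) - exp (2 * pi * \<i> * y))"

lemma Metric_space_points: "Metric_space (points M) (mfd_dist M)"
proof (cases M)
  case Interval
  then show ?thesis
    by unfold_locales (auto simp: dist_commute dist_triangle)
next
  case Circle
  have *: "x = y" if "exp (2 * pi * \<i> * x) = exp (2 * pi * \<i> * y)"
      "x \<in> {0..<1}" "y \<in> {0..<1}" for x y :: real
  proof -
    from that(1) obtain n :: int
      where "2 * pi * \<i> * x = 2 * pi * \<i> * y + of_int (2 * n) * pi * \<i>"
      by (auto simp: exp_eq)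
    then have "complex_of_real x * (2 * pi * \<i>) = complex_of_real (y + n) * (2 * pi * \<i>)"
      by (simp add: algebra_simps)
    then have "complex_of_real x = complex_of_real (y + n)"
      by (simp only: mult_cancel_right) simp
    then have xy: "x = y + n" by (simp only: of_real_eq_iff)
    with that have "n < 1" "n > -1" by auto
    with xy show ?thesis by simp
  qed
  show ?thesis
    unfolding Circle
  proof
    show "mfd_dist Circle x z \<le> mfd_dist Circle x y + mfd_dist Circle y z" for x y z
      using norm_triangle_ineq[of "exp (2 * pi * \<i> * x) - exp (2 * pi * \<i> * y)"
          "exp (2 * pi * \<i> * y) - exp (2 * pi * \<i> * z)"] by simp
  qed (auto simp: norm_minus_commute intro: *)
qed

definition mfd_topology :: "one_manifold \<Rightarrow> real topology" where
  "mfd_topology M = Metric_space.mtopology (points M) (mfd_dist M)"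


section \<open>Lifts and derivatives\<close>

definition is_circle_lift :: "(real \<Rightarrow> real) \<Rightarrow> (real \<Rightarrow> real) \<Rightarrow> bool" where
  "is_circle_lift f F \<longleftrightarrow> continuous_on UNIV F \<and> F 0 \<in> {0..<1} \<and>
     (\<forall>x. F (x + 1) = F x + 1) \<and> (\<forall>x. f (frac x) = frac (F x))"

lemma is_circle_lift_unique:
  assumes F: "is_circle_lift f F" and G: "is_circle_lift f G"
  shows "F = G"
proof
  fix x
  have int: "F y - G y \<in> \<int>" for y
  proof -
    have "frac (F y) = frac (G y)"
      using F G unfolding is_circle_lift_def by simp
    then have "F y - G y = of_int (\<lfloor>F y\<rfloor> - \<lfloor>G y\<rfloor>)"
      by (simp add: frac_def)
    then show ?thesis by (simp only: Ints_of_int)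
  qed
  have "(\<lambda>y. F y - G y) constant_on UNIV"
  proof (rule continuous_discrete_range_constant)
    show "continuous_on UNIV (\<lambda>y. F y - G y)"
      using F G by (auto simp: is_circle_lift_def intro!: continuous_intros)
    fix y :: real
    show "\<exists>e>0. \<forall>z. z \<in> UNIV \<and> F z - G z \<noteq> F y - G y \<longrightarrow> e \<le> norm (F z - G z - (F y - G y))"
      using int by (intro exI[of _ 1]) (auto intro!: Ints_nonzero_abs_ge1 Ints_diff[OF int int])
  qed auto
  then have "F x - G x = F 0 - G 0"
    unfolding constant_on_def by auto
  moreover have "F 0 = G 0"
  proof -
    have "frac (F 0) = F 0" "frac (G 0) = G 0"
      using F G unfolding is_circle_lift_def frac_eq by auto
    moreover have "f (frac 0) = frac (F 0)" "f (frac 0) = frac (G 0)"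
      using F G unfolding is_circle_lift_def by blast+
    ultimately show ?thesis by simp
  qed
  ultimately show "F x = G x" by simp
qed

text \<open>For a map of the interval the lift is the map itself.\<close>

fun lift_dom :: "one_manifold \<Rightarrow> real set" where
  "lift_dom Interval = {0..1}"
| "lift_dom Circle = UNIV"

fun the_lift :: "one_manifold \<Rightarrow> (real \<Rightarrow> real) \<Rightarrow> real \<Rightarrow> real" where
  "the_lift Interval f = f"
| "the_lift Circle f = (THE F. is_circle_lift f F)"

text \<open>Derivatives are taken within the domain, hence one-sided at the endpoints of the interval.\<close>

fun nth_deriv_within :: "real set \<Rightarrow> nat \<Rightarrow> (real \<Rightarrow> real) \<Rightarrow> real \<Rightarrow> real" where
  "nth_deriv_within S 0 g = g"
| "nth_deriv_within S (Suc j) g = (\<lambda>x. vector_derivative (nth_deriv_within S j g) (at x within S))"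

definition C_class_on :: "enat \<Rightarrow> real set \<Rightarrow> (real \<Rightarrow> real) \<Rightarrow> bool" where
  "C_class_on k S g \<longleftrightarrow>
     (\<forall>j. enat j < k \<longrightarrow> nth_deriv_within S j g differentiable_on S) \<and>
     (\<forall>j. enat j \<le> k \<longrightarrow> continuous_on S (nth_deriv_within S j g))"

definition mfd_deriv :: "one_manifold \<Rightarrow> nat \<Rightarrow> (real \<Rightarrow> real) \<Rightarrow> real \<Rightarrow> real" where
  "mfd_deriv M j f = nth_deriv_within (lift_dom M) j (the_lift M f)"


section \<open>The group of orientation-preserving diffeomorphisms\<close>

fun orientation_preserving :: "one_manifold \<Rightarrow> (real \<Rightarrow> real) \<Rightarrow> bool" where
  "orientation_preserving Interval f \<longleftrightarrow> strict_mono_on {0..1} f"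
| "orientation_preserving Circle f \<longleftrightarrow> (\<exists>F. is_circle_lift f F \<and> strict_mono F)"

text \<open>Maps are extensional, so that distinct functions represent distinct maps of the manifold.\<close>

definition Diff_plus :: "one_manifold \<Rightarrow> enat \<Rightarrow> (real \<Rightarrow> real) set" where
  "Diff_plus M k = {f \<in> extensional (points M).
     homeomorphic_map (mfd_topology M) (mfd_topology M) f \<and>
     orientation_preserving M f \<and>
     C_class_on k (lift_dom M) (the_lift M f) \<and>
     C_class_on k (lift_dom M) (the_lift M (restrict (inv_into (points M) f) (points M)))}"

definition Diff_group :: "one_manifold \<Rightarrow> enat \<Rightarrow> (real \<Rightarrow> real) monoid" where
  "Diff_group M k = \<lparr>carrier = Diff_plus M k, mult = compose (points M),
     one = (\<lambda>x\<in>points M. x)\<rparr>"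

text \<open>The value outside \<open>Diff_plus M k\<close> is irrelevant; it is \<open>0\<close> because a
  \<^locale>\<open>Metric_space\<close> metric has to be nonnegative on the whole type.\<close>

definition Diff_metric :: "one_manifold \<Rightarrow> nat \<Rightarrow> (real \<Rightarrow> real) \<Rightarrow> (real \<Rightarrow> real) \<Rightarrow> real" where
  "Diff_metric M k f g = (if f \<in> Diff_plus M k \<and> g \<in> Diff_plus M k
     then (SUP x\<in>points M. mfd_dist M (f x) (g x)) +
          (\<Sum>j=1..k. SUP x\<in>points M. \<bar>mfd_deriv M j f x - mfd_deriv M j g x\<bar>)
     else 0)"

fun Diff_topology :: "one_manifold \<Rightarrow> enat \<Rightarrow> (real \<Rightarrow> real) topology" where
  "Diff_topology M (enat k) = Metric_space.mtopology (Diff_plus M k) (Diff_metric M k)"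
| "Diff_topology M \<infinity> = topology_generated_by
     (\<Union>j\<in>{1..}. {U. openin (Metric_space.mtopology (Diff_plus M \<infinity>) (Diff_metric M j)) U})"


section \<open>Property (OB)\<close>

definition property_OB_in :: "('a, 'b) monoid_scheme \<Rightarrow> 'a topology \<Rightarrow> 'a set \<Rightarrow> bool" where
  "property_OB_in G T \<Sigma> \<longleftrightarrow>
     (\<forall>d. Metric_space (carrier G) d \<and> Metric_space.mtopology (carrier G) d = T \<and>
          (\<forall>x\<in>carrier G. \<forall>y\<in>carrier G. \<forall>g\<in>carrier G. d (x \<otimes>\<^bsub>G\<^esub> g) (y \<otimes>\<^bsub>G\<^esub> g) = d x y)
        \<longrightarrow> (\<exists>B. \<forall>x\<in>\<Sigma>. \<forall>y\<in>\<Sigma>. d x y \<le> B))"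

end

theory Submission
  imports Defs
begin

text \<open>A diffeomorphism \<open>f\<close> is handled through its normalized lift \<open>F\<close> to the reals (for the interval
  \<open>F = f\<close>), and all bounds are bounds on \<open>F'\<close>, the first derivative, and its derivatives up to
  order \<open>n\<close>. Composition of diffeomorphisms is composition of lifts up to an integer translation,
  which no derivative sees, so that \<open>(f g)' = (f' \<circ> G) \<cdot> g'\<close> for the lift \<open>G\<close> of \<open>g\<close>.

  Bounds imply (OB). If \<open>f\<close> ranges over a set on which \<open>ln f'\<close> and the higher derivatives up to
  order \<open>n\<close> are bounded, then the same bounds hold, up to constants, for the convex combinations
  \<open>F\<^sub>t = (1 - t) id + t F\<close> and for their inverses. Hence
  \<open>F\<^sub>s \<circ> F\<^sub>t\<^sup>-\<^sup>1 - id = (s - t) (F - id) \<circ> F\<^sub>t\<^sup>-\<^sup>1\<close> is of size \<open>O(\<bar>s - t\<bar>)\<close> in the \<open>C\<^sup>n\<close> metric, uniformly in \<open>f\<close>. A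
  unit ball around the identity of a compatible right-invariant metric \<open>d\<close> contains a \<open>C\<^sup>n\<close> ball
  for some finite \<open>n \<le> k\<close>, so that a fixed number of steps of \<open>d\<close>-length less than one leads from
  the identity to any \<open>f\<close> in the set (\<open>OB_if_bounded\<close>).

  (OB) implies bounds. For every finite order \<open>j \<le> k\<close> there is a compatible right-invariant metric
  whose bounded sets have bounded derivatives up to order \<open>j\<close>. It is \<open>d(f,g) = N(f g\<^sup>-\<^sup>1)\<close>, where
  \<open>N(f)\<close> is the infimum of \<open>w(h\<^sub>1) + \<dots> + w(h\<^sub>r)\<close> over all factorizations \<open>f = h\<^sub>1 \<cdots> h\<^sub>r\<close>, for a weight
  \<open>w\<close> that dominates the \<open>C\<^sup>j\<close> distances of \<open>h\<close> and \<open>h\<^sup>-\<^sup>1\<close> to the identity. The point is that \<open>N\<close> does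
  not collapse: multiplication by \<open>h\<close> changes \<open>ln f'\<close> by at most \<open>w(h)\<close>, and, once the derivatives of
  lower order are under control, changes the next derivative by the factor \<open>1 + O(w(h))\<close> and the
  summand \<open>O(w(h))\<close>. So along a factorization of total weight \<open>s\<close> every derivative grows at most
  exponentially in \<open>s\<close> (\<open>word_cost_C_bounded\<close>), and the distance to the identity is \<open>O(s)\<close> for bounded
  \<open>s\<close> (\<open>word_cost_Diff_metric\<close>). The weight also contains a bounded term that sees all orders up to
  \<open>k\<close>; it makes the metric compatible with the topology, for \<open>k = \<infinity>\<close> too, without affecting large
  distances.\<close>

section \<open>Bounded derivatives up to a given order\<close>

definition C_bounded_on :: "real set \<Rightarrow> nat \<Rightarrow> real \<Rightarrow> (real \<Rightarrow> real) \<Rightarrow> bool" where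
  "C_bounded_on S n c g \<longleftrightarrow> C_class_on (enat n) S g \<and>
     (\<forall>i\<le>n. \<forall>x\<in>S. \<bar>nth_deriv_within S i g x\<bar> \<le> c)"

lemma nth_deriv_within_cong:
  assumes "\<And>x. x \<in> S \<Longrightarrow> g x = h x" and "x \<in> S"
  shows "nth_deriv_within S j g x = nth_deriv_within S j h x"
  using assms(2)
proof (induction j arbitrary: x)
  case (Suc j)
  have "(nth_deriv_within S j g has_vector_derivative y) (at x within S) \<longleftrightarrow>
        (nth_deriv_within S j h has_vector_derivative y) (at x within S)" for y
    using Suc has_vector_derivative_transform[of x S] by (metis (full_types))
  then show ?case
    by (simp add: vector_derivative_def)
qed (use assms in auto)

lemma C_class_on_cong:
  assumes "\<And>x. x \<in> S \<Longrightarrow> g x = h x"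
  shows "C_class_on k S g \<longleftrightarrow> C_class_on k S h"
proof -
  have eq: "nth_deriv_within S j g x = nth_deriv_within S j h x" if "x \<in> S" for x j
    using nth_deriv_within_cong[OF assms that] .
  have "nth_deriv_within S j g differentiable_on S \<longleftrightarrow>
      nth_deriv_within S j h differentiable_on S" for j
    unfolding differentiable_on_def using eq
    using differentiable_transform_within[where d=1 and s=S] by (metis (no_types, lifting) zero_less_one)
  moreover have "continuous_on S (nth_deriv_within S j g) \<longleftrightarrow>
      continuous_on S (nth_deriv_within S j h)" for j
    using eq by (intro continuous_on_cong) auto
  ultimately show ?thesis
    unfolding C_class_on_def by auto
qed

lemma C_bounded_on_cong:
  assumes "\<And>x. x \<in> S \<Longrightarrow> g x = h x"
  shows "C_bounded_on S n c g \<longleftrightarrow> C_bounded_on S n c h"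
  unfolding C_bounded_on_def
  using C_class_on_cong[of S g h] nth_deriv_within_cong[of S g h] assms by auto

lemma C_bounded_on_transform:
  "C_bounded_on S n c h \<Longrightarrow> (\<And>x. x \<in> S \<Longrightarrow> g x = h x) \<Longrightarrow> C_bounded_on S n c g"
  using C_bounded_on_cong[of S g h] by blast

lemma C_class_on_mono: "C_class_on k S g \<Longrightarrow> j \<le> k \<Longrightarrow> C_class_on j S g"
  unfolding C_class_on_def by (meson order_less_le_trans order_trans)

lemma C_class_on_0: "C_class_on (enat 0) S g \<longleftrightarrow> continuous_on S g"
  unfolding C_class_on_def by (auto simp: zero_enat_def)

lemma C_bounded_on_mono:
  "C_bounded_on S n c g \<Longrightarrow> m \<le> n \<Longrightarrow> c \<le> d \<Longrightarrow> C_bounded_on S m d g"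
  unfolding C_bounded_on_def by (meson C_class_on_mono enat_ord_simps(1) order_trans)

lemma C_bounded_on_boundD:
  "C_bounded_on S n c g \<Longrightarrow> i \<le> n \<Longrightarrow> x \<in> S \<Longrightarrow> \<bar>nth_deriv_within S i g x\<bar> \<le> c"
  unfolding C_bounded_on_def by blast

lemma C_bounded_on_abs_le: "C_bounded_on S n c g \<Longrightarrow> x \<in> S \<Longrightarrow> \<bar>g x\<bar> \<le> c"
  using C_bounded_on_boundD[of S n c g 0 x] by simp

text \<open>The three constants below only record that a bound on the result depends on the order and on
  bounds for the data, uniformly over all functions that satisfy the latter.\<close>

primrec compose_bound :: "nat \<Rightarrow> real \<Rightarrow> real" where
  "compose_bound 0 b = 1"
| "compose_bound (Suc n) b = 1 + 2 ^ n * (compose_bound n b * b)"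

lemma compose_bound_ge_1: "0 \<le> b \<Longrightarrow> 1 \<le> compose_bound n b"
  by (induction n) auto

primrec recip_bound :: "nat \<Rightarrow> real \<Rightarrow> real \<Rightarrow> real" where
  "recip_bound 0 m b = 1 / m"
| "recip_bound (Suc n) m b = 1 / m + 2 ^ n * (b * (2 ^ n * (recip_bound n m b * recip_bound n m b)))"

lemma recip_bound_ge: "0 < m \<Longrightarrow> 0 \<le> b \<Longrightarrow> 1 / m \<le> recip_bound n m b"
  by (induction n) auto

lemma recip_bound_nonneg: "0 < m \<Longrightarrow> 0 \<le> b \<Longrightarrow> 0 \<le> recip_bound n m b"
  using recip_bound_ge[of m b n] by (meson less_eq_real_def order_trans zero_less_divide_1_iff)

primrec inverse_bound :: "nat \<Rightarrow> real \<Rightarrow> real \<Rightarrow> real" where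
  "inverse_bound 0 m b = 1 / m"
| "inverse_bound (Suc n) m b = recip_bound (Suc n) m (b * compose_bound (Suc n) (inverse_bound n m b))"

lemma inverse_bound_nonneg: "0 < m \<Longrightarrow> 0 \<le> b \<Longrightarrow> 0 \<le> inverse_bound n m b"
proof (induction n)
  case (Suc n)
  then show ?case
    using compose_bound_ge_1[of "inverse_bound n m b" "Suc n"]
    unfolding inverse_bound.simps
    by (intro recip_bound_nonneg mult_nonneg_nonneg) auto
qed simp

locale real_domain =
  fixes S :: "real set"
  assumes not_isolated: "x \<in> S \<Longrightarrow> at x within S \<noteq> bot"
    and convex: "convex S"
begin

lemma nth_deriv_within_1:
  assumes "(g has_real_derivative y) (at x within S)" "x \<in> S"
  shows "nth_deriv_within S (Suc 0) g x = y"
  using vector_derivative_within[OF not_isolated[OF assms(2)], of g y] assms(1)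
  by (simp add: has_real_derivative_iff_has_vector_derivative)

text \<open>The derivatives of \<open>g\<close> are defined by differentiating last; the inductions on the order
  differentiate first.\<close>

lemma nth_deriv_within_Suc:
  assumes "\<And>x. x \<in> S \<Longrightarrow> (g has_real_derivative g' x) (at x within S)" and "x \<in> S"
  shows "nth_deriv_within S (Suc j) g x = nth_deriv_within S j g' x"
proof -
  have shift: "nth_deriv_within S (Suc j) g = nth_deriv_within S j (nth_deriv_within S (Suc 0) g)"
    by (induction j) auto
  show ?thesis
    unfolding shift
    by (rule nth_deriv_within_cong) (use assms nth_deriv_within_1 in auto)
qed

lemma C_class_on_Suc:
  "C_class_on (enat (Suc n)) S g \<longleftrightarrow>
   (\<exists>g'. (\<forall>x\<in>S. (g has_real_derivative g' x) (at x within S)) \<and> C_class_on (enat n) S g')"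
proof
  assume C: "C_class_on (enat (Suc n)) S g"
  let ?g' = "nth_deriv_within S (Suc 0) g"
  have "g differentiable_on S"
    using C unfolding C_class_on_def by (auto dest!: spec[of _ 0])
  then have g': "(g has_real_derivative ?g' x) (at x within S)" if "x \<in> S" for x
    using that vector_derivative_works[of g "at x within S"]
    unfolding differentiable_on_def by (simp add: has_real_derivative_iff_has_vector_derivative)
  have shift: "nth_deriv_within S j ?g' = nth_deriv_within S (Suc j) g" for j
    by (induction j) auto
  have "C_class_on (enat n) S ?g'"
    using C unfolding C_class_on_def shift by (auto simp del: nth_deriv_within.simps)
  with g' show "\<exists>g'. (\<forall>x\<in>S. (g has_real_derivative g' x) (at x within S)) \<and> C_class_on (enat n) S g'"
    by blast
next
  assume "\<exists>g'. (\<forall>x\<in>S. (g has_real_derivative g' x) (at x within S)) \<and> C_class_on (enat n) S g'"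
  then obtain g' where g': "\<And>x. x \<in> S \<Longrightarrow> (g has_real_derivative g' x) (at x within S)"
    and C: "C_class_on (enat n) S g'" by blast
  have eq: "nth_deriv_within S (Suc j) g x = nth_deriv_within S j g' x" if "x \<in> S" for x j
    using nth_deriv_within_Suc[OF g' that] .
  have diff: "nth_deriv_within S j g differentiable_on S" if "enat j < enat (Suc n)" for j
  proof (cases j)
    case 0
    then show ?thesis
      using g' by (auto simp: differentiable_on_def has_real_derivative_iff_has_vector_derivative
          intro: differentiableI_vector)
  next
    case (Suc i)
    then have "nth_deriv_within S i g' differentiable_on S"
      using C that unfolding C_class_on_def by auto
    then show ?thesis
      unfolding differentiable_on_def Suc using eq
      using differentiable_transform_within[where d=1 and s=S] by (metis (no_types, lifting) zero_less_one)
  qed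
  have "continuous_on S (nth_deriv_within S j g)" if "enat j \<le> enat (Suc n)" for j
  proof (cases j)
    case 0
    then show ?thesis
      using g' by (auto intro: DERIV_continuous_on)
  next
    case (Suc i)
    then have "continuous_on S (nth_deriv_within S i g')"
      using C that unfolding C_class_on_def by auto
    then show ?thesis
      unfolding Suc using eq continuous_on_cong[OF refl, of S] by metis
  qed
  with diff show "C_class_on (enat (Suc n)) S g"
    unfolding C_class_on_def by blast
qed

lemma C_bounded_on_0: "C_bounded_on S 0 c g \<longleftrightarrow> continuous_on S g \<and> (\<forall>x\<in>S. \<bar>g x\<bar> \<le> c)"
  unfolding C_bounded_on_def C_class_on_0 by auto

text \<open>The estimates for sums, products, composites, reciprocals and inverse functions are inductions
  on the order along this recursion. It yields regularity and bounds at the same time.\<close>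

lemma C_bounded_on_Suc:
  "C_bounded_on S (Suc n) c g \<longleftrightarrow> (\<forall>x\<in>S. \<bar>g x\<bar> \<le> c) \<and>
   (\<exists>g'. (\<forall>x\<in>S. (g has_real_derivative g' x) (at x within S)) \<and> C_bounded_on S n c g')"
proof -
  have "(\<forall>i\<le>Suc n. \<forall>x\<in>S. \<bar>nth_deriv_within S i g x\<bar> \<le> c) \<longleftrightarrow>
     (\<forall>x\<in>S. \<bar>g x\<bar> \<le> c) \<and> (\<forall>i\<le>n. \<forall>x\<in>S. \<bar>nth_deriv_within S i g' x\<bar> \<le> c)"
    if "\<forall>x\<in>S. (g has_real_derivative g' x) (at x within S)" for g'
  proof -
    have eq: "nth_deriv_within S (Suc j) g x = nth_deriv_within S j g' x" if "x \<in> S" for x j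
      using nth_deriv_within_Suc[of g g' x j] that \<open>\<forall>x\<in>S. _\<close> by blast
    have "(\<forall>i\<le>Suc n. P i) \<longleftrightarrow> P 0 \<and> (\<forall>i\<le>n. P (Suc i))" for P
      by (metis Suc_le_mono le0 not0_implies_Suc)
    from this[of "\<lambda>i. \<forall>x\<in>S. \<bar>nth_deriv_within S i g x\<bar> \<le> c"] show ?thesis
      using eq by (simp del: nth_deriv_within.simps(2))
  qed
  then show ?thesis
    unfolding C_bounded_on_def C_class_on_Suc by blast
qed

lemma C_bounded_on_SucI:
  assumes "\<And>x. x \<in> S \<Longrightarrow> \<bar>g x\<bar> \<le> c"
    and "\<And>x. x \<in> S \<Longrightarrow> (g has_real_derivative g' x) (at x within S)"
    and "C_bounded_on S n c g'"
  shows "C_bounded_on S (Suc n) c g"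
  using assms C_bounded_on_Suc by blast

lemma C_bounded_on_SucE:
  assumes "C_bounded_on S (Suc n) c g"
  obtains g' where "\<And>x. x \<in> S \<Longrightarrow> (g has_real_derivative g' x) (at x within S)"
    and "C_bounded_on S n c g'"
  using assms C_bounded_on_Suc by blast

lemma C_bounded_on_const: "\<bar>a\<bar> \<le> c \<Longrightarrow> C_bounded_on S n c (\<lambda>x. a)"
proof (induction n arbitrary: a)
  case 0
  then show ?case by (simp add: C_bounded_on_0)
next
  case (Suc n)
  show ?case
    by (rule C_bounded_on_SucI[where g' = "\<lambda>x. 0"]) (use Suc in auto)
qed

lemma C_bounded_onI:
  assumes "C_class_on (enat n) S g" "\<And>i x. i \<le> n \<Longrightarrow> x \<in> S \<Longrightarrow> \<bar>nth_deriv_within S i g x\<bar> \<le> c"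
  shows "C_bounded_on S n c g"
  using assms unfolding C_bounded_on_def by blast

lemma nth_deriv_within_add_cmult:
  assumes "C_class_on (enat n) S f" "C_class_on (enat n) S g" "x \<in> S"
  shows "nth_deriv_within S n (\<lambda>x. f x + r * g x) x =
    nth_deriv_within S n f x + r * nth_deriv_within S n g x"
  using assms
proof (induction n arbitrary: f g x)
  case (Suc n)
  obtain f' where f': "\<And>x. x \<in> S \<Longrightarrow> (f has_real_derivative f' x) (at x within S)" "C_class_on (enat n) S f'"
    using Suc.prems C_class_on_Suc by blast
  obtain g' where g': "\<And>x. x \<in> S \<Longrightarrow> (g has_real_derivative g' x) (at x within S)" "C_class_on (enat n) S g'"
    using Suc.prems C_class_on_Suc by blast
  have "nth_deriv_within S (Suc n) (\<lambda>x. f x + r * g x) x = nth_deriv_within S n (\<lambda>x. f' x + r * g' x) x"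
    by (rule nth_deriv_within_Suc) (use f' g' Suc.prems in \<open>auto intro!: derivative_eq_intros\<close>)
  also have "\<dots> = nth_deriv_within S (Suc n) f x + r * nth_deriv_within S (Suc n) g x"
    using nth_deriv_within_Suc[OF f'(1)] nth_deriv_within_Suc[OF g'(1)] Suc f' g' by metis
  finally show ?case .
qed simp

lemma C_bounded_on_add:
  assumes "C_bounded_on S n a f" "C_bounded_on S n b g"
  shows "C_bounded_on S n (a + b) (\<lambda>x. f x + g x)"
  using assms
proof (induction n arbitrary: f g)
  case 0
  then show ?case
    by (auto simp: C_bounded_on_0 intro!: continuous_intros order_trans[OF abs_triangle_ineq add_mono])
next
  case (Suc n)
  obtain f' g' where *: "\<And>x. x \<in> S \<Longrightarrow> (f has_real_derivative f' x) (at x within S)" "C_bounded_on S n a f'"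
    "\<And>x. x \<in> S \<Longrightarrow> (g has_real_derivative g' x) (at x within S)" "C_bounded_on S n b g'"
    using Suc.prems by (metis C_bounded_on_SucE)
  show ?case
  proof (rule C_bounded_on_SucI)
    show "\<bar>f x + g x\<bar> \<le> a + b" if "x \<in> S" for x
      using C_bounded_on_abs_le[OF Suc.prems(1) that] C_bounded_on_abs_le[OF Suc.prems(2) that] by linarith
    show "C_bounded_on S n (a + b) (\<lambda>x. f' x + g' x)"
      using Suc.IH * by blast
  qed (use * in \<open>auto intro!: derivative_eq_intros\<close>)
qed

lemma C_bounded_on_cmult:
  assumes "C_bounded_on S n a f"
  shows "C_bounded_on S n (\<bar>r\<bar> * a) (\<lambda>x. r * f x)"
  using assms
proof (induction n arbitrary: f)
  case 0
  then show ?case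
    by (auto simp: C_bounded_on_0 abs_mult intro!: continuous_intros mult_left_mono)
next
  case (Suc n)
  obtain f' where *: "\<And>x. x \<in> S \<Longrightarrow> (f has_real_derivative f' x) (at x within S)" "C_bounded_on S n a f'"
    using Suc.prems by (metis C_bounded_on_SucE)
  show ?case
  proof (rule C_bounded_on_SucI)
    show "\<bar>r * f x\<bar> \<le> \<bar>r\<bar> * a" if "x \<in> S" for x
      using C_bounded_on_abs_le[OF Suc.prems(1) that] by (simp add: abs_mult mult_left_mono)
    show "C_bounded_on S n (\<bar>r\<bar> * a) (\<lambda>x. r * f' x)"
      using Suc.IH * by blast
  qed (use * in \<open>auto intro!: derivative_eq_intros\<close>)
qed

lemma C_bounded_on_diff:
  assumes "C_bounded_on S n a f" "C_bounded_on S n b g"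
  shows "C_bounded_on S n (a + b) (\<lambda>x. f x - g x)"
  using C_bounded_on_add[OF assms(1) C_bounded_on_cmult[OF assms(2), of "-1"]] by simp

lemma C_bounded_on_mult:
  assumes "C_bounded_on S n a f" "C_bounded_on S n b g" "0 \<le> a" "0 \<le> b"
  shows "C_bounded_on S n (2 ^ n * (a * b)) (\<lambda>x. f x * g x)"
  using assms
proof (induction n arbitrary: f g)
  case 0
  then show ?case
    by (auto simp: C_bounded_on_0 abs_mult intro!: continuous_intros mult_mono)
next
  case (Suc n)
  obtain f' g' where *: "\<And>x. x \<in> S \<Longrightarrow> (f has_real_derivative f' x) (at x within S)" "C_bounded_on S n a f'"
    "\<And>x. x \<in> S \<Longrightarrow> (g has_real_derivative g' x) (at x within S)" "C_bounded_on S n b g'"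
    using Suc.prems by (metis C_bounded_on_SucE)
  have fg: "C_bounded_on S n a f" "C_bounded_on S n b g"
    using Suc.prems C_bounded_on_mono by (meson order_refl le_Suc_eq)+
  show ?case
  proof (rule C_bounded_on_SucI)
    show "\<bar>f x * g x\<bar> \<le> 2 ^ Suc n * (a * b)" if "x \<in> S" for x
    proof -
      have "\<bar>f x * g x\<bar> \<le> a * b"
        using C_bounded_on_abs_le[OF Suc.prems(1) that] C_bounded_on_abs_le[OF Suc.prems(2) that]
        by (auto simp: abs_mult intro: mult_mono)
      also have "\<dots> \<le> 2 ^ Suc n * (a * b)"
        using Suc.prems one_le_power[of "2::real" "Suc n"] mult_right_mono[of 1 "2 ^ Suc n" "a * b"] by simp
      finally show ?thesis .
    qed
    have "C_bounded_on S n (2 ^ n * (a * b) + 2 ^ n * (a * b)) (\<lambda>x. f' x * g x + f x * g' x)"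
      using * fg Suc by (intro C_bounded_on_add Suc.IH)
    then show "C_bounded_on S n (2 ^ Suc n * (a * b)) (\<lambda>x. f' x * g x + f x * g' x)"
      by (simp add: algebra_simps)
  qed (use * in \<open>auto intro!: derivative_eq_intros\<close>)
qed

text \<open>Only the factor of the top derivative of \<open>g\<close> in \<open>a + 2 ^ n * b\<close> has constant one: this is what
  makes repeated multiplication by factors \<open>1 + q\<close> with small \<open>q\<close> grow at most exponentially.\<close>

lemma nth_deriv_within_mult_bound:
  assumes "C_bounded_on S n c q" "C_class_on (enat n) S g"
    and "\<And>i x. i < n \<Longrightarrow> x \<in> S \<Longrightarrow> \<bar>nth_deriv_within S i g x\<bar> \<le> b"
    and "\<And>x. x \<in> S \<Longrightarrow> \<bar>nth_deriv_within S n g x\<bar> \<le> a"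
    and "0 \<le> c" "0 \<le> b" "x \<in> S"
  shows "\<bar>nth_deriv_within S n (\<lambda>x. q x * g x) x\<bar> \<le> c * (a + 2 ^ n * b)"
  using assms
proof (induction n arbitrary: q g x)
  case 0
  have "\<bar>q x * g x\<bar> \<le> c * a"
    using C_bounded_on_abs_le[OF 0(1,7)] 0(4)[OF 0(7)] 0(5)
    unfolding abs_mult by (intro mult_mono) auto
  then show ?case
    using mult_nonneg_nonneg[OF 0(5,6)] by (simp add: distrib_left)
next
  case (Suc n)
  obtain q' where q': "\<And>x. x \<in> S \<Longrightarrow> (q has_real_derivative q' x) (at x within S)" "C_bounded_on S n c q'"
    using Suc.prems by (metis C_bounded_on_SucE)
  obtain g' where g': "\<And>x. x \<in> S \<Longrightarrow> (g has_real_derivative g' x) (at x within S)" "C_class_on (enat n) S g'"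
    using Suc.prems C_class_on_Suc by blast
  have eq: "nth_deriv_within S i g' x = nth_deriv_within S (Suc i) g x" if "x \<in> S" for i x
    using nth_deriv_within_Suc[OF g'(1) that] by simp
  have qn: "C_bounded_on S n c q"
    using Suc.prems C_bounded_on_mono[of S "Suc n" c q n c] by simp
  have gb: "C_bounded_on S n b g"
    unfolding C_bounded_on_def
    using Suc.prems C_class_on_mono[of "enat (Suc n)" S g "enat n"] by simp
  have cl1: "C_bounded_on S n (2 ^ n * (c * b)) (\<lambda>x. q' x * g x)"
    using C_bounded_on_mult[OF q'(2) gb] Suc.prems by blast
  then have b1: "\<bar>nth_deriv_within S n (\<lambda>x. q' x * g x) x\<bar> \<le> 2 ^ n * (c * b)"
    using C_bounded_on_boundD Suc.prems by blast
  have "C_bounded_on S n (max a b) g'"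
  proof (rule C_bounded_onI[OF g'(2)])
    fix i x assume "i \<le> n" "x \<in> S"
    then show "\<bar>nth_deriv_within S i g' x\<bar> \<le> max a b"
      using Suc.prems(3)[of "Suc i" x] Suc.prems(4)[of x] eq[of x i]
      by (cases "i = n") (auto simp: le_max_iff_disj simp del: nth_deriv_within.simps(2))
  qed
  then have cl2: "C_bounded_on S n (2 ^ n * (c * max a b)) (\<lambda>x. q x * g' x)"
    using C_bounded_on_mult[OF qn] Suc.prems by (simp add: le_max_iff_disj)
  have b2: "\<bar>nth_deriv_within S n (\<lambda>x. q x * g' x) x\<bar> \<le> c * (a + 2 ^ n * b)"
    using Suc.prems eq by (intro Suc.IH qn g') (auto simp del: nth_deriv_within.simps(2))
  have sum: "nth_deriv_within S n (\<lambda>x. q' x * g x + q x * g' x) x =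
        nth_deriv_within S n (\<lambda>x. q' x * g x) x + nth_deriv_within S n (\<lambda>x. q x * g' x) x"
    using nth_deriv_within_add_cmult[of n "\<lambda>x. q' x * g x" "\<lambda>x. q x * g' x" x 1] cl1 cl2 Suc.prems
    unfolding C_bounded_on_def by simp
  have "nth_deriv_within S (Suc n) (\<lambda>x. q x * g x) x = nth_deriv_within S n (\<lambda>x. q' x * g x + q x * g' x) x"
    by (rule nth_deriv_within_Suc) (use q' g' Suc.prems in \<open>auto intro!: derivative_eq_intros\<close>)
  then have "\<bar>nth_deriv_within S (Suc n) (\<lambda>x. q x * g x) x\<bar> \<le> 2 ^ n * (c * b) + c * (a + 2 ^ n * b)"
    using sum b1 b2 by (simp del: nth_deriv_within.simps(2))
  then show ?case
    by (simp add: algebra_simps)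
qed

text \<open>By the chain rule \<open>(u \<circ> G)' = (u' \<circ> G) \<cdot> G'\<close>. The bound is linear in the bound for \<open>u\<close>, and at
  order \<open>n\<close> it involves the derivatives of \<open>G'\<close> of order less than \<open>n\<close> only. The first fact makes
  right multiplication Lipschitz, the second one lets the growth estimate for products of many
  diffeomorphisms proceed one order at a time.\<close>

lemma C_bounded_on_compose:
  assumes "C_bounded_on S n a u" "0 \<le> a" "0 \<le> b"
    and "\<And>x. x \<in> S \<Longrightarrow> G x \<in> S"
    and "\<And>x. x \<in> S \<Longrightarrow> (G has_real_derivative G' x) (at x within S)"
    and "\<And>m. n = Suc m \<Longrightarrow> C_bounded_on S m b G'"
  shows "C_bounded_on S n (a * compose_bound n b) (\<lambda>x. u (G x))"
  using assms
proof (induction n arbitrary: u)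
  case 0
  have "continuous_on S G"
    using 0 by (auto intro: DERIV_continuous_on)
  then show ?case
    using 0 by (auto simp: C_bounded_on_0 intro: continuous_on_compose2)
next
  case (Suc n)
  obtain u' where u': "\<And>x. x \<in> S \<Longrightarrow> (u has_real_derivative u' x) (at x within S)" "C_bounded_on S n a u'"
    using Suc.prems by (metis C_bounded_on_SucE)
  have G': "C_bounded_on S n b G'"
    using Suc.prems by blast
  show ?case
  proof (rule C_bounded_on_SucI)
    show "\<bar>u (G x)\<bar> \<le> a * compose_bound (Suc n) b" if "x \<in> S" for x
    proof -
      have "\<bar>u (G x)\<bar> \<le> a"
        using C_bounded_on_abs_le Suc.prems that by blast
      then show ?thesis
        using mult_left_mono[OF compose_bound_ge_1[OF Suc.prems(3), of "Suc n"] Suc.prems(2)] by linarith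
    qed
    show "((\<lambda>x. u (G x)) has_real_derivative u' (G x) * G' x) (at x within S)" if "x \<in> S" for x
      using DERIV_image_chain[of u "u' (G x)" G x S "G' x"] DERIV_subset[OF u'(1)[of "G x"], of "G ` S"] Suc.prems that
      by (auto simp: o_def)
    have "C_bounded_on S n (2 ^ n * (a * compose_bound n b * b)) (\<lambda>x. u' (G x) * G' x)"
    proof (rule C_bounded_on_mult[OF Suc.IH G'])
      show "C_bounded_on S m b G'" if "n = Suc m" for m
        using C_bounded_on_mono[OF G', of m b] that by simp
      show "0 \<le> a * compose_bound n b"
        using compose_bound_ge_1[OF Suc.prems(3), of n] Suc.prems(2) by simp
    qed (use u' Suc.prems in auto)
    then show "C_bounded_on S n (a * compose_bound (Suc n) b) (\<lambda>x. u' (G x) * G' x)"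
      by (rule C_bounded_on_mono) (use Suc.prems in \<open>simp_all add: algebra_simps\<close>)
  qed
qed

lemma C_bounded_on_recip:
  assumes "C_bounded_on S n b v" "0 < m" "0 \<le> b" "\<And>x. x \<in> S \<Longrightarrow> m \<le> v x"
  shows "C_bounded_on S n (recip_bound n m b) (\<lambda>x. 1 / v x)"
  using assms
proof (induction n)
  case 0
  have "v x \<noteq> 0" "\<bar>1 / v x\<bar> \<le> 1 / m" if "x \<in> S" for x
    using 0(2) 0(4)[OF that] by (auto simp: abs_if field_simps)
  then show ?case
    using 0 by (auto simp: C_bounded_on_0 intro!: continuous_intros)
next
  case (Suc n)
  obtain v' where v': "\<And>x. x \<in> S \<Longrightarrow> (v has_real_derivative v' x) (at x within S)" "C_bounded_on S n b v'"
    using Suc.prems by (metis C_bounded_on_SucE)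
  let ?R = "recip_bound n m b"
  have R: "C_bounded_on S n ?R (\<lambda>x. 1 / v x)"
    using Suc C_bounded_on_mono[of S "Suc n" b v n b] by simp
  have v0: "v x \<noteq> 0" "\<bar>1 / v x\<bar> \<le> 1 / m" if "x \<in> S" for x
    using Suc(3) Suc(5)[OF that] by (auto simp: abs_if field_simps)
  show ?case
  proof (rule C_bounded_on_SucI)
    show "\<bar>1 / v x\<bar> \<le> recip_bound (Suc n) m b" if "x \<in> S" for x
      using v0[OF that] recip_bound_ge[OF Suc.prems(2,3), of "Suc n"] by linarith
    show "((\<lambda>x. 1 / v x) has_real_derivative - 1 * (v' x * (1 / v x * (1 / v x)))) (at x within S)"
      if "x \<in> S" for x
      using v' v0 that by (auto intro!: derivative_eq_intros simp: field_simps)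
    have "C_bounded_on S n (2 ^ n * (b * (2 ^ n * (?R * ?R)))) (\<lambda>x. v' x * (1 / v x * (1 / v x)))"
      using v' R Suc.prems recip_bound_nonneg by (intro C_bounded_on_mult) auto
    from C_bounded_on_cmult[OF this, of "-1"]
    show "C_bounded_on S n (recip_bound (Suc n) m b) (\<lambda>x. - 1 * (v' x * (1 / v x * (1 / v x))))"
      by (rule C_bounded_on_mono) (use Suc.prems in \<open>simp_all\<close>)
  qed
qed

text \<open>The derivative of an inverse function satisfies \<open>G' = 1 / (F' \<circ> G)\<close>: a bound for \<open>G'\<close> at order
  \<open>n\<close> bounds \<open>F' \<circ> G\<close>, and hence \<open>G'\<close>, at order \<open>n + 1\<close>.\<close>

lemma C_bounded_on_inverse:
  assumes "C_bounded_on S n b F'" "0 < m" "0 \<le> b" "\<And>x. x \<in> S \<Longrightarrow> m \<le> F' x"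
    and "\<And>y. y \<in> S \<Longrightarrow> G y \<in> S"
    and "\<And>y. y \<in> S \<Longrightarrow> (G has_real_derivative 1 / F' (G y)) (at y within S)"
  shows "C_bounded_on S n (inverse_bound n m b) (\<lambda>y. 1 / F' (G y))"
  using assms
proof (induction n)
  case 0
  have "C_bounded_on S 0 (b * compose_bound 0 b) (\<lambda>y. F' (G y))"
    using 0 by (intro C_bounded_on_compose) auto
  then show ?case
    using C_bounded_on_recip[of 0 "b * compose_bound 0 b" "\<lambda>y. F' (G y)" m] 0 by simp
next
  case (Suc n)
  let ?I = "inverse_bound n m b"
  have IH: "C_bounded_on S n ?I (\<lambda>y. 1 / F' (G y))"
    using Suc C_bounded_on_mono[of S "Suc n" b F' n b] by simp
  have I0: "0 \<le> ?I"
    using Suc.prems inverse_bound_nonneg by blast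
  have c0: "0 \<le> b * compose_bound (Suc n) ?I"
    using compose_bound_ge_1[OF I0, of "Suc n"] Suc.prems by (intro mult_nonneg_nonneg) linarith+
  have "C_bounded_on S (Suc n) (b * compose_bound (Suc n) ?I) (\<lambda>y. F' (G y))"
    using Suc.prems IH I0 by (intro C_bounded_on_compose[where G' = "\<lambda>y. 1 / F' (G y)"]) auto
  then show ?case
    unfolding inverse_bound.simps
    using Suc.prems c0 by (intro C_bounded_on_recip) auto
qed

lemma mean_value:
  assumes "\<And>x. x \<in> S \<Longrightarrow> (F has_real_derivative F' x) (at x within S)" "x \<in> S" "y \<in> S"
  shows "\<exists>z\<in>S. F y - F x = F' z * (y - x)"
proof -
  have *: "\<exists>z\<in>S. F y - F x = F' z * (y - x)" if "x < y" "x \<in> S" "y \<in> S" for x y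
  proof -
    have sub: "{x..y} \<subseteq> S"
      using convex that unfolding convex_contains_segment
      by (metis closed_segment_eq_real_ivl1 less_imp_le)
    have "\<exists>z\<in>{x<..<y}. F y - F x = (*) (F' z) (y - x)"
    proof (rule mvt_simple[OF that(1)])
      fix z assume "x \<le> z" "z \<le> y"
      then show "(F has_derivative (*) (F' z)) (at z within {x..y})"
        using DERIV_subset[OF assms(1) sub, of z] sub by (auto simp: has_field_derivative_def)
    qed
    then show ?thesis
      using sub by (metis atLeastAtMost_iff greaterThanLessThan_iff less_imp_le subsetD)
  qed
  consider "x < y" | "y < x" | "x = y" by linarith
  then show ?thesis
  proof cases
    case 2
    then obtain z where "z \<in> S" "F x - F y = F' z * (x - y)"
      using *[of y x] assms by blast
    then show ?thesis
      by (intro bexI[of _ z]) (auto simp: algebra_simps)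
  qed (use * assms in auto)
qed

text \<open>The lower bound for \<open>F'\<close> makes \<open>G\<close> Lipschitz, so that the difference quotient of \<open>G\<close> is the
  reciprocal of a difference quotient of \<open>F\<close> whose increment tends to zero. This works at the
  endpoints of \<open>S\<close> as well.\<close>

lemma has_real_derivative_inverse:
  assumes F': "\<And>x. x \<in> S \<Longrightarrow> (F has_real_derivative F' x) (at x within S)" "0 < m" "\<And>x. x \<in> S \<Longrightarrow> m \<le> F' x"
    and G: "\<And>y. y \<in> S \<Longrightarrow> G y \<in> S" "\<And>y. y \<in> S \<Longrightarrow> F (G y) = y"
    and y: "y \<in> S"
  shows "(G has_real_derivative 1 / F' (G y)) (at y within S)"
proof -
  have lip: "\<bar>G z - G w\<bar> \<le> (1 / m) * \<bar>z - w\<bar>" if zw: "z \<in> S" "w \<in> S" for z w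
  proof -
    obtain \<xi> where \<xi>: "\<xi> \<in> S" "F (G z) - F (G w) = F' \<xi> * (G z - G w)"
      using mean_value[OF F'(1)] G(1) zw by metis
    then have "\<bar>z - w\<bar> = F' \<xi> * \<bar>G z - G w\<bar>"
      using G(2) zw F'(2) F'(3)[of \<xi>] by (simp add: abs_mult)
    also have "\<dots> \<ge> m * \<bar>G z - G w\<bar>"
      using F'(3)[OF \<xi>(1)] by (intro mult_right_mono) auto
    finally show ?thesis
      using F'(2) by (simp add: pos_le_divide_eq mult.commute)
  qed
  have lim0: "((\<lambda>z. (1 / m) * \<bar>z - y\<bar>) \<longlongrightarrow> 0) (at y within S)"
    using F'(2) by (auto intro!: tendsto_eq_intros)
  have "((\<lambda>z. G z - G y) \<longlongrightarrow> 0) (at y within S)"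
    by (rule Lim_null_comparison[OF _ lim0]) (use lip y in \<open>auto simp: eventually_at_filter\<close>)
  then have "(G \<longlongrightarrow> G y) (at y within S)"
    by (simp add: LIM_zero_iff)
  moreover have inj: "G z \<noteq> G y" if "z \<in> S" "z \<noteq> y" for z
    using G(2) that y by metis
  ultimately have fl: "filterlim G (at (G y) within S) (at y within S)"
    unfolding filterlim_at using G(1) by (auto simp: eventually_at_filter)
  have "((\<lambda>x. (F x - F (G y)) / (x - G y)) \<longlongrightarrow> F' (G y)) (at (G y) within S)"
    using F'(1)[OF G(1)[OF y]] by (simp add: has_field_derivative_iff)
  from filterlim_compose[OF this fl]
  have "((\<lambda>z. inverse ((F (G z) - F (G y)) / (G z - G y))) \<longlongrightarrow> inverse (F' (G y))) (at y within S)"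
  proof (rule tendsto_inverse)
    show "F' (G y) \<noteq> 0"
      using F'(2) F'(3)[OF G(1)[OF y]] by linarith
  qed
  then have "((\<lambda>z. (G z - G y) / (z - y)) \<longlongrightarrow> inverse (F' (G y))) (at y within S)"
    by (rule Lim_transform_eventually)
      (use G(2) y in \<open>auto simp: eventually_at_filter divide_simps\<close>)
  then show ?thesis
    by (simp add: has_field_derivative_iff inverse_eq_divide)
qed

end


section \<open>Lifts of diffeomorphisms\<close>

lemma real_domain_lift_dom: "real_domain (lift_dom M)"
proof
  fix x assume "x \<in> lift_dom M"
  then show "at x within lift_dom M \<noteq> bot"
    by (cases M) (auto simp: trivial_limit_within)
next
  show "convex (lift_dom M)"
    by (cases M) auto
qed

interpretation lift_dom: real_domain "lift_dom M" for M
  by (rule real_domain_lift_dom)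

fun proj :: "one_manifold \<Rightarrow> real \<Rightarrow> real" where
  "proj Interval x = x"
| "proj Circle x = frac x"

fun normalized_lift :: "one_manifold \<Rightarrow> (real \<Rightarrow> real) \<Rightarrow> bool" where
  "normalized_lift Interval F \<longleftrightarrow> F 0 = 0 \<and> F 1 = 1"
| "normalized_lift Circle F \<longleftrightarrow> F 0 \<in> {0..<1} \<and> (\<forall>x. F (x + 1) = F x + 1)"

text \<open>The translations of the covering; two representatives of a point differ by one of these.\<close>

definition translation :: "one_manifold \<Rightarrow> real \<Rightarrow> bool" where
  "translation M c \<longleftrightarrow> c \<in> \<int> \<and> (M = Interval \<longrightarrow> c = 0)"

lemma points_subset_lift_dom: "points M \<subseteq> lift_dom M"
  by (cases M) auto

lemma unit_subset_lift_dom: "{0..1} \<subseteq> lift_dom M"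
  by (cases M) auto

lemma points_subset_unit: "points M \<subseteq> {0..1}"
  by (cases M) auto

lemma proj_in_points: "x \<in> lift_dom M \<Longrightarrow> proj M x \<in> points M"
  by (cases M) (auto simp: frac_lt_1)

lemma proj_points: "x \<in> points M \<Longrightarrow> proj M x = x"
  by (cases M) (auto simp: frac_eq)

lemma translation_0: "translation M 0"
  by (simp add: translation_def)

lemma translation_uminus: "translation M c \<Longrightarrow> translation M (- c)"
  by (simp add: translation_def)

lemma translation_mem: "translation M c \<Longrightarrow> x \<in> lift_dom M \<Longrightarrow> x + c \<in> lift_dom M"
  by (cases M) (auto simp: translation_def)

lemma proj_translation: "translation M c \<Longrightarrow> proj M (x + c) = proj M x"
  by (cases M) (auto simp: translation_def frac_add_int_right)

lemma proj_eqE: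
  assumes "proj M x = proj M y"
  obtains c where "translation M c" "x = y + c"
proof (cases M)
  case Interval
  then show ?thesis using assms that[of 0] by (simp add: translation_0)
next
  case Circle
  then have "x = y + (of_int \<lfloor>x\<rfloor> - of_int \<lfloor>y\<rfloor>)"
    using assms by (simp add: frac_def)
  then show ?thesis
    using that Circle unfolding translation_def by (metis Ints_diff Ints_of_int one_manifold.distinct(1))
qed

lemma translation_equivariant_int:
  fixes F :: "real \<Rightarrow> real"
  assumes "\<And>x. F (x + 1) = F x + a"
  shows "F (x + of_int n) = F x + a * of_int n"
proof (induction n rule: int_induct[where k = 0])
  case (step1 i)
  then show ?case using assms[of "x + of_int i"] by (simp add: algebra_simps)
next
  case (step2 i)
  then show ?case using assms[of "x + of_int (i - 1)"] by (simp add: algebra_simps)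
qed simp

lemma normalized_lift_translation:
  assumes "normalized_lift M F" "translation M c"
  shows "F (x + c) = F x + c"
proof (cases M)
  case Circle
  then obtain n where "c = of_int n"
    using assms unfolding translation_def by (auto elim: Ints_cases)
  then show ?thesis
    using translation_equivariant_int[of F 1 x n] assms Circle by simp
qed (use assms in \<open>simp add: translation_def\<close>)

text \<open>A lift is onto by the intermediate value theorem: it fixes the endpoints of the interval, or
  takes arbitrarily large values of both signs.\<close>

lemma normalized_lift_bij:
  assumes F: "normalized_lift M F" "continuous_on (lift_dom M) F" "strict_mono_on (lift_dom M) F"
  shows "bij_betw F (lift_dom M) (lift_dom M)"
proof -
  have "F ` lift_dom M = lift_dom M"
  proof (cases M)
    case Interval
    have "y \<in> F ` {0..1}" if "y \<in> {0..1}" for y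
      using IVT'[of F 0 y 1] F Interval that by force
    moreover have "F x \<in> {0..1}" if "x \<in> {0..1}" for x
      using F Interval that strict_mono_on_leD[of "{0..1}" F 0 x] strict_mono_on_leD[of "{0..1}" F x 1]
      by auto
    ultimately show ?thesis
      using Interval by auto
  next
    case Circle
    have "y \<in> range F" for y
    proof -
      let ?n = "\<lfloor>y - F 0\<rfloor>"
      have "F (0 + of_int ?n) = F 0 + 1 * of_int ?n" "F (0 + of_int (?n + 1)) = F 0 + 1 * of_int (?n + 1)"
        using F Circle by (intro translation_equivariant_int; simp)+
      then have "F (of_int ?n) \<le> y" "y \<le> F (of_int (?n + 1))"
        by (simp_all) linarith+
      then show ?thesis
        using IVT'[of F "of_int ?n" y "of_int (?n + 1)"] F Circle continuous_on_subset[of UNIV F]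
        by auto
    qed
    then show ?thesis
      using Circle by auto
  qed
  then show ?thesis
    using F strict_mono_on_imp_inj_on by (auto simp: bij_betw_def)
qed

text \<open>The inverse \<open>F\<^sup>-\<^sup>1\<close> need not map \<open>0\<close> into \<open>[0,1)\<close>, so that the normalized lift \<open>G\<close> of the inverse
  map is \<open>F\<^sup>-\<^sup>1 + c\<close>.\<close>

lemma normalized_lift_inverse:
  assumes F: "normalized_lift M F" "continuous_on (lift_dom M) F" "strict_mono_on (lift_dom M) F"
  obtains G c where "translation M c" "normalized_lift M G"
    "\<And>x. x \<in> lift_dom M \<Longrightarrow> G x \<in> lift_dom M"
    "\<And>x. x \<in> lift_dom M \<Longrightarrow> G (F x) = x + c" "\<And>x. x \<in> lift_dom M \<Longrightarrow> F (G x) = x + c"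
    "strict_mono_on (lift_dom M) G" "continuous_on (lift_dom M) G"
proof -
  let ?S = "lift_dom M"
  note bij = normalized_lift_bij[OF F]
  define G0 where "G0 = inv_into ?S F"
  define c where "c = (if M = Interval then 0 else - real_of_int \<lfloor>G0 0\<rfloor>)"
  have c: "translation M c"
    by (simp add: translation_def c_def)
  have G0: "G0 x \<in> ?S" "F (G0 x) = x" "G0 (F x) = x" if "x \<in> ?S" for x
    using bij that unfolding G0_def
    by (auto simp: bij_betw_def inv_into_into f_inv_into_f)
  have FS: "F x \<in> ?S" if "x \<in> ?S" for x
    using bij that by (auto simp: bij_betw_def)
  have mono: "strict_mono_on ?S G0"
  proof (rule strict_mono_onI)
    fix x y assume "x \<in> ?S" "y \<in> ?S" "x < y"
    then show "G0 x < G0 y"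
      using G0 strict_mono_on_leD[OF F(3), of "G0 y" "G0 x"] by (metis leD not_le_imp_less)
  qed
  have cont: "continuous_on ?S G0"
  proof (cases M)
    case Interval
    then show ?thesis
      using continuous_on_inv[of ?S F G0] F(2) G0 bij by (auto simp: bij_betw_def)
  next
    case Circle
    have "G0 ` UNIV = UNIV"
      using G0(1,3) FS Circle by (auto simp: image_def) metis
    then show ?thesis
      using mono Circle continuous_onI_mono[of G0 UNIV] strict_mono_on_leD[of UNIV G0] by auto
  qed
  show thesis
  proof (rule that[of c "\<lambda>x. G0 x + c"])
    show "continuous_on ?S (\<lambda>x. G0 x + c)"
      using cont by (intro continuous_intros)
    show "normalized_lift M (\<lambda>x. G0 x + c)"
    proof (cases M)
      case Interval
      then show ?thesis
        using G0(3)[of 0] G0(3)[of 1] F(1) by (simp add: c_def)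
    next
      case Circle
      have "G0 (x + 1) = G0 x + 1" for x
      proof -
        have "F (G0 x + 1) = x + 1"
          using F(1) G0(2) Circle by simp
        then show ?thesis
          using G0(3)[of "G0 x + 1"] Circle by simp
      qed
      moreover have "0 \<le> G0 0 + c" "G0 0 + c < 1"
        using Circle by (simp_all add: c_def) linarith
      ultimately show ?thesis
        using Circle by simp
    qed
    show "strict_mono_on ?S (\<lambda>x. G0 x + c)"
      using mono by (auto simp: strict_mono_on_def)
    show "G0 x + c \<in> ?S" if "x \<in> ?S" for x
      using translation_mem[OF c] G0(1) that by blast
    show "F (G0 x + c) = x + c" if "x \<in> ?S" for x
      using normalized_lift_translation[OF F(1) c] G0(2)[OF that] by simp
  qed (use c G0 in auto)
qed


subsection \<open>The map below a lift\<close>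

definition descend :: "one_manifold \<Rightarrow> (real \<Rightarrow> real) \<Rightarrow> real \<Rightarrow> real" where
  "descend M F = (\<lambda>x\<in>points M. proj M (F x))"

lemma descend_proj:
  assumes "normalized_lift M F" "x \<in> lift_dom M"
  shows "descend M F (proj M x) = proj M (F x)"
proof -
  have "proj M (proj M x) = proj M x"
    using proj_points proj_in_points assms by blast
  then obtain c where c: "translation M c" "proj M x = x + c"
    using proj_eqE by metis
  then show ?thesis
    using proj_in_points[OF assms(2)] proj_translation[OF c(1)] normalized_lift_translation[OF assms(1) c(1)]
    by (simp add: descend_def)
qed

lemma is_circle_lift_iff:
  assumes "f \<in> extensional (points Circle)"
  shows "is_circle_lift f F \<longleftrightarrow> continuous_on UNIV F \<and> normalized_lift Circle F \<and> f = descend Circle F"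
proof -
  have "(\<forall>x. f (frac x) = frac (F x)) \<longleftrightarrow> f = descend Circle F" if nF: "normalized_lift Circle F"
  proof
    assume *: "\<forall>x. f (frac x) = frac (F x)"
    show "f = descend Circle F"
    proof
      fix x
      show "f x = descend Circle F x"
        using *[rule_format, of x] assms by (cases "x \<in> {0..<1}") (auto simp: descend_def extensional_def)
    qed
  next
    assume "f = descend Circle F"
    then show "\<forall>x. f (frac x) = frac (F x)"
      using descend_proj[OF nF] by simp
  qed
  then show ?thesis
    unfolding is_circle_lift_def by auto
qed

lemma descend_extensional: "descend M F \<in> extensional (points M)"
  by (simp add: descend_def)

lemma the_lift_circle_eqI: "is_circle_lift f F \<Longrightarrow> the_lift Circle f = F"
  using is_circle_lift_unique by (simp add: the_equality)

lemma the_lift_descend: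
  assumes "normalized_lift M F" "continuous_on (lift_dom M) F" "\<And>x. x \<in> lift_dom M \<Longrightarrow> F x \<in> lift_dom M"
    and "x \<in> lift_dom M"
  shows "the_lift M (descend M F) x = F x"
proof (cases M)
  case Interval
  then show ?thesis using assms by (simp add: descend_def)
next
  case Circle
  then show ?thesis
    using the_lift_circle_eqI[of "descend Circle F" F] is_circle_lift_iff[OF descend_extensional] assms
    by auto
qed

lemma descend_in_points: "(\<And>x. x \<in> lift_dom M \<Longrightarrow> F x \<in> lift_dom M) \<Longrightarrow> x \<in> points M \<Longrightarrow> descend M F x \<in> points M"
  using proj_in_points points_subset_lift_dom by (fastforce simp: descend_def)

text \<open>The normalized lift \<open>H\<close> of a composite may differ from \<open>F \<circ> G\<close> by a translation, which the
  projection forgets.\<close>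

lemma descend_descend:
  assumes "normalized_lift M F" "\<And>x. x \<in> lift_dom M \<Longrightarrow> G x \<in> lift_dom M"
    and "translation M c" "\<And>x. x \<in> lift_dom M \<Longrightarrow> H x = F (G x) + c" "x \<in> points M"
  shows "descend M F (descend M G x) = descend M H x"
proof -
  have x: "x \<in> lift_dom M"
    using assms points_subset_lift_dom by blast
  have "descend M F (proj M (G x)) = proj M (F (G x))"
    using descend_proj assms x by blast
  then show ?thesis
    using assms x proj_translation by (simp add: descend_def)
qed

lemma descend_id_translation:
  assumes "translation M c" "\<And>x. x \<in> lift_dom M \<Longrightarrow> H x = x + c" "x \<in> points M"
  shows "descend M H x = x"
  using assms proj_translation proj_points points_subset_lift_dom by (fastforce simp: descend_def)


lemma inv_into_descend:
  assumes F: "normalized_lift M F" "\<And>x. x \<in> lift_dom M \<Longrightarrow> F x \<in> lift_dom M"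
    and G: "normalized_lift M G" "\<And>x. x \<in> lift_dom M \<Longrightarrow> G x \<in> lift_dom M"
    and c: "translation M c" "\<And>x. x \<in> lift_dom M \<Longrightarrow> G (F x) = x + c"
      "\<And>x. x \<in> lift_dom M \<Longrightarrow> F (G x) = x + c"
  shows "bij_betw (descend M F) (points M) (points M)"
    and "restrict (inv_into (points M) (descend M F)) (points M) = descend M G"
proof -
  have FG: "descend M F (descend M G x) = x" "descend M G (descend M F x) = x" if "x \<in> points M" for x
  proof -
    have "descend M F (descend M G x) = descend M (\<lambda>x. F (G x)) x"
      by (rule descend_descend[OF F(1) G(2) translation_0]) (use that in auto)
    also have "\<dots> = x"
      by (rule descend_id_translation[OF c(1)]) (use c that in auto)
    finally show "descend M F (descend M G x) = x" .
    have "descend M G (descend M F x) = descend M (\<lambda>x. G (F x)) x"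
      by (rule descend_descend[OF G(1) F(2) translation_0]) (use that in auto)
    also have "\<dots> = x"
      by (rule descend_id_translation[OF c(1)]) (use c that in auto)
    finally show "descend M G (descend M F x) = x" .
  qed
  have mem: "descend M F x \<in> points M" "descend M G x \<in> points M" if "x \<in> points M" for x
    using descend_in_points[of M] F G that by auto
  show bij: "bij_betw (descend M F) (points M) (points M)"
    by (rule bij_betw_byWitness[where f' = "descend M G"]) (use FG mem in auto)
  have "inv_into (points M) (descend M F) x = descend M G x" if "x \<in> points M" for x
    using FG mem bij that by (intro inv_into_f_eq) (auto simp: bij_betw_def)
  then show "restrict (inv_into (points M) (descend M F)) (points M) = descend M G"
    by (auto simp: descend_def)
qed


subsection \<open>The metric of the circle in terms of representatives\<close>

lemma mfd_dist_Circle: "mfd_dist Circle x y = 2 * \<bar>sin (pi * (x - y))\<bar>"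
proof -
  have "exp (2 * pi * \<i> * x) - exp (2 * pi * \<i> * y) =
      exp (\<i> * of_real (2 * pi * y)) * (exp (\<i> * of_real (2 * pi * (x - y))) - 1)"
    by (simp add: algebra_simps exp_add[symmetric] exp_minus)
  then show ?thesis
    using dist_exp_i_1[of "2 * pi * (x - y)"] by (simp add: norm_mult)
qed

lemma mfd_dist_proj: "mfd_dist M (proj M x) (proj M y) = mfd_dist M x y"
proof (cases M)
  case Circle
  have "exp (2 * pi * \<i> * frac z) = exp (2 * pi * \<i> * z)" for z :: real
    unfolding exp_eq by (rule exI[of _ "- \<lfloor>z\<rfloor>"]) (simp add: frac_def algebra_simps)
  then show ?thesis
    using Circle by simp
qed simp

lemma mfd_dist_le: "mfd_dist M x y \<le> 2 * pi * \<bar>x - y\<bar>"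
proof (cases M)
  case Interval
  have "1 \<le> 2 * pi" using pi_ge_two by linarith
  then show ?thesis
    using Interval mult_right_mono[of 1 "2 * pi" "\<bar>x - y\<bar>"] by (simp add: dist_real_def)
next
  case Circle
  then show ?thesis
    using abs_sin_x_le_abs_x[of "pi * (x - y)"] by (simp only: mfd_dist_Circle) (simp add: abs_mult)
qed

text \<open>A lower bound for chords of the circle; the value of the constant does not matter.\<close>

lemma abs_sin_ge_half: "\<bar>u\<bar> / 2 \<le> \<bar>sin u\<bar>" if "\<bar>u\<bar> \<le> pi / 2" for u :: real
proof -
  have "\<bar>sin u - (\<Sum>m<3. sin_coeff m * u ^ m)\<bar> \<le> inverse (fact 3) * \<bar>u\<bar> ^ 3"
    by (rule Maclaurin_sin_bound)
  moreover have "(\<Sum>m<3. sin_coeff m * u ^ m) = u"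
    by (simp add: eval_nat_numeral sin_coeff_def)
  moreover have "inverse (fact 3) * \<bar>u\<bar> ^ 3 = \<bar>u\<bar> ^ 3 / 6"
    by (simp add: fact_numeral)
  ultimately have "\<bar>sin u - u\<bar> \<le> \<bar>u\<bar> ^ 3 / 6"
    by simp
  (* As \<bar>u\<bar> is at most 1.6, the error term is at most \<bar>u\<bar> / 2. *)
  moreover have "\<bar>u\<bar> ^ 3 \<le> 3 * \<bar>u\<bar>"
  proof -
    have "\<bar>u\<bar> \<le> 1.6" using that pi_approx by simp
    then have "\<bar>u\<bar> * \<bar>u\<bar> \<le> 1.6 * 1.6" by (intro mult_mono) auto
    then have "(\<bar>u\<bar> * \<bar>u\<bar>) * \<bar>u\<bar> \<le> 3 * \<bar>u\<bar>" by (intro mult_right_mono) auto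
    then show ?thesis by (simp add: power3_eq_cube)
  qed
  ultimately show ?thesis by linarith
qed

text \<open>The distance on the manifold dominates the distance of the nearest representatives.\<close>

lemma mfd_dist_ge:
  obtains c where "translation M c" "\<bar>x - (y + c)\<bar> \<le> mfd_dist M x y"
proof (cases M)
  case Interval
  then show ?thesis using that[of 0] by (simp add: translation_0 dist_real_def)
next
  case Circle
  define c where "c = real_of_int (round (x - y))"
  have c: "translation M c"
    using Circle by (simp add: translation_def c_def)
  have "\<bar>x - (y + c)\<bar> \<le> 1 / 2"
    using of_int_round_abs_le[of "x - y"] by (simp add: c_def abs_minus_commute algebra_simps)
  then have "\<bar>pi * (x - (y + c))\<bar> \<le> pi / 2"
    by (simp add: abs_mult)
  then have "\<bar>pi * (x - (y + c))\<bar> \<le> mfd_dist M x (y + c)"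
    using abs_sin_ge_half[of "pi * (x - (y + c))"] unfolding Circle mfd_dist_Circle by simp
  moreover have "1 * \<bar>x - (y + c)\<bar> \<le> \<bar>pi * (x - (y + c))\<bar>"
    unfolding abs_mult using pi_ge_two by (intro mult_right_mono) auto
  ultimately have "\<bar>x - (y + c)\<bar> \<le> mfd_dist M x (y + c)"
    by simp
  also have "\<dots> = mfd_dist M x y"
    using mfd_dist_proj[of M x y] mfd_dist_proj[of M x "y + c"] proj_translation[OF c, of y] by simp
  finally show ?thesis
    using that c by blast
qed

lemma topspace_mfd: "topspace (mfd_topology M) = points M"
  unfolding mfd_topology_def by (rule Metric_space.topspace_mtopology[OF Metric_space_points])

text \<open>A Lipschitz lift induces a Lipschitz map of the manifold, because the distance on the manifold
  is equivalent to the distance of nearest representatives.\<close>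

lemma continuous_map_descend:
  assumes F: "normalized_lift M F" "\<And>x. x \<in> lift_dom M \<Longrightarrow> F x \<in> lift_dom M"
    and lip: "\<And>x y. x \<in> lift_dom M \<Longrightarrow> y \<in> lift_dom M \<Longrightarrow> \<bar>F x - F y\<bar> \<le> K * \<bar>x - y\<bar>"
    and "0 < K"
  shows "continuous_map (mfd_topology M) (mfd_topology M) (descend M F)"
  unfolding mfd_topology_def Metric_space.metric_continuous_map[OF Metric_space_points Metric_space_points]
proof (intro conjI ballI allI impI)
  show "descend M F ` points M \<subseteq> points M"
    using descend_in_points F by blast
  fix x e :: real assume x: "x \<in> points M" and e: "0 < e"
  have "mfd_dist M (descend M F x) (descend M F y) < e"
    if y: "y \<in> points M" "mfd_dist M x y < e / (2 * pi * K)" for y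
  proof -
    obtain c where c: "translation M c" "\<bar>x - (y + c)\<bar> \<le> mfd_dist M x y"
      by (rule mfd_dist_ge)
    have xy: "x \<in> lift_dom M" "y + c \<in> lift_dom M" "y \<in> lift_dom M"
      using x y points_subset_lift_dom translation_mem[OF c(1)] by blast+
    have "descend M F x = proj M (F x)" "descend M F y = proj M (F (y + c))"
      using x y normalized_lift_translation[OF F(1) c(1)] proj_translation[OF c(1)]
      by (auto simp: descend_def)
    then have "mfd_dist M (descend M F x) (descend M F y) = mfd_dist M (F x) (F (y + c))"
      by (simp add: mfd_dist_proj)
    also have "\<dots> \<le> 2 * pi * \<bar>F x - F (y + c)\<bar>"
      by (rule mfd_dist_le)
    also have "\<dots> \<le> 2 * pi * (K * \<bar>x - (y + c)\<bar>)"
      using lip[OF xy(1,2)] by (intro mult_left_mono) auto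
    also have "\<dots> \<le> 2 * pi * (K * mfd_dist M x y)"
      using c \<open>0 < K\<close> by (intro mult_left_mono) auto
    also have "\<dots> < e"
      using y \<open>0 < K\<close> by (simp add: pos_less_divide_eq mult.commute mult.left_commute mult.assoc)
    finally show ?thesis .
  qed
  then show "\<exists>\<delta>>0. \<forall>y. y \<in> points M \<and> mfd_dist M x y < \<delta> \<longrightarrow>
      mfd_dist M (descend M F x) (descend M F y) < e"
    using e \<open>0 < K\<close> by (intro exI[of _ "e / (2 * pi * K)"]) auto
qed


subsection \<open>Smooth lifts\<close>

text \<open>The derivative \<open>p\<close> is carried along, and bounds replace continuity of the derivatives: they come
  for free by compactness, and the group operations are then covered by the estimates above.\<close>

definition diffeo_lift :: "one_manifold \<Rightarrow> enat \<Rightarrow> (real \<Rightarrow> real) \<Rightarrow> (real \<Rightarrow> real) \<Rightarrow> bool" where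
  "diffeo_lift M k F p \<longleftrightarrow> normalized_lift M F \<and>
     (\<forall>x\<in>lift_dom M. (F has_real_derivative p x) (at x within lift_dom M) \<and> 0 < p x) \<and>
     (\<forall>n. enat (Suc n) \<le> k \<longrightarrow> (\<exists>b. C_bounded_on (lift_dom M) n b p))"

lemma C_class_on_iff_finite: "C_class_on k S g \<longleftrightarrow> (\<forall>n. enat n \<le> k \<longrightarrow> C_class_on (enat n) S g)"
proof (intro iffI allI impI)
  assume *: "\<forall>n. enat n \<le> k \<longrightarrow> C_class_on (enat n) S g"
  have "nth_deriv_within S j g differentiable_on S" if "enat j < k" for j
  proof -
    have "enat (Suc j) \<le> k"
      using that ileI1[of "enat j" k] by (simp add: eSuc_enat)
    then show ?thesis
      using * unfolding C_class_on_def by (metis enat_ord_simps(2) lessI)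
  qed
  moreover have "continuous_on S (nth_deriv_within S j g)" if "enat j \<le> k" for j
    using * that unfolding C_class_on_def by blast
  ultimately show "C_class_on k S g"
    unfolding C_class_on_def by blast
qed (rule C_class_on_mono)

context real_domain
begin

lemma C_class_on_Suc_deriv:
  assumes "\<And>x. x \<in> S \<Longrightarrow> (F has_real_derivative p x) (at x within S)"
  shows "C_class_on (enat (Suc n)) S F \<longleftrightarrow> C_class_on (enat n) S p"
proof -
  have "C_class_on (enat n) S p" if "\<And>x. x \<in> S \<Longrightarrow> (F has_real_derivative q x) (at x within S)"
    "C_class_on (enat n) S q" for q
  proof -
    have "q x = p x" if "x \<in> S" for x
      using nth_deriv_within_1 assms \<open>\<And>x. x \<in> S \<Longrightarrow> (F has_real_derivative q x) (at x within S)\<close> that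
      by metis
    then show ?thesis
      using C_class_on_cong[of S q p] that by simp
  qed
  then show ?thesis
    using assms unfolding C_class_on_Suc by blast
qed

lemma C_class_on_iff_deriv:
  assumes "\<And>x. x \<in> S \<Longrightarrow> (F has_real_derivative p x) (at x within S)" "1 \<le> k"
  shows "C_class_on k S F \<longleftrightarrow> (\<forall>n. enat (Suc n) \<le> k \<longrightarrow> C_class_on (enat n) S p)"
proof -
  have "C_class_on (enat 0) S F"
    unfolding C_class_on_0 using assms DERIV_continuous_on by blast
  then have "C_class_on k S F \<longleftrightarrow> (\<forall>n. enat (Suc n) \<le> k \<longrightarrow> C_class_on (enat (Suc n)) S F)"
    using C_class_on_iff_finite[of k S F] by (metis not0_implies_Suc)
  then show ?thesis
    using C_class_on_Suc_deriv[OF assms(1)] by simp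
qed

end

lemma diffeo_lift_normalized: "diffeo_lift M k F p \<Longrightarrow> normalized_lift M F"
  by (simp add: diffeo_lift_def)

lemma diffeo_lift_deriv:
  "diffeo_lift M k F p \<Longrightarrow> x \<in> lift_dom M \<Longrightarrow> (F has_real_derivative p x) (at x within lift_dom M)"
  by (simp add: diffeo_lift_def)

lemma diffeo_lift_deriv_pos: "diffeo_lift M k F p \<Longrightarrow> x \<in> lift_dom M \<Longrightarrow> 0 < p x"
  by (simp add: diffeo_lift_def)

lemma diffeo_lift_C_bounded:
  assumes "diffeo_lift M k F p" "enat (Suc n) \<le> k"
  obtains b where "0 \<le> b" "C_bounded_on (lift_dom M) n b p"
proof -
  obtain b where "C_bounded_on (lift_dom M) n b p"
    using assms diffeo_lift_def by blast
  then have "C_bounded_on (lift_dom M) n \<bar>b\<bar> p"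
    by (rule C_bounded_on_mono) auto
  then show ?thesis
    using that abs_ge_zero by blast
qed

lemma one_le_enat_iff: "1 \<le> k \<longleftrightarrow> enat (Suc 0) \<le> k"
  by (simp add: one_enat_def)

lemma diffeo_lift_continuous: "diffeo_lift M k F p \<Longrightarrow> continuous_on (lift_dom M) F"
  using diffeo_lift_deriv DERIV_continuous_on by blast

lemma diffeo_lift_strict_mono: "diffeo_lift M k F p \<Longrightarrow> strict_mono_on (lift_dom M) F"
proof (rule strict_mono_onI)
  fix x y assume F: "diffeo_lift M k F p" and xy: "x \<in> lift_dom M" "y \<in> lift_dom M" "x < y"
  then obtain z where "z \<in> lift_dom M" "F y - F x = p z * (y - x)"
    using lift_dom.mean_value[of M F p x y] diffeo_lift_deriv by blast
  then have "0 < F y - F x"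
    using diffeo_lift_deriv_pos[OF F, of z] xy by simp
  then show "F x < F y"
    by simp
qed

lemma diffeo_lift_bij: "diffeo_lift M k F p \<Longrightarrow> bij_betw F (lift_dom M) (lift_dom M)"
  using normalized_lift_bij diffeo_lift_continuous diffeo_lift_strict_mono diffeo_lift_normalized by blast

lemma diffeo_lift_mem: "diffeo_lift M k F p \<Longrightarrow> x \<in> lift_dom M \<Longrightarrow> F x \<in> lift_dom M"
  using diffeo_lift_bij bij_betwE by blast

lemma has_real_derivative_shift:
  fixes F :: "real \<Rightarrow> real"
  assumes "M = Circle \<or> c = 0"
  shows "((\<lambda>x. F (x + c)) has_real_derivative y) (at x within lift_dom M) \<longleftrightarrow>
    (F has_real_derivative y) (at (x + c) within lift_dom M)"
  using assms DERIV_shift[of F y x c] by (cases M) auto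

text \<open>Translation-invariant functions on the line are functions on the circle. Hence suprema over the
  points of the manifold are suprema over the whole domain of the lift, and continuous derivatives
  are bounded.\<close>

lemma nth_deriv_within_shift:
  fixes g :: "real \<Rightarrow> real"
  assumes "\<And>x. x \<in> lift_dom M \<Longrightarrow> g (x + c) = g x" "translation M c" "x \<in> lift_dom M"
  shows "nth_deriv_within (lift_dom M) j g (x + c) = nth_deriv_within (lift_dom M) j g x"
proof (cases M)
  case Circle
  have "nth_deriv_within UNIV j g (x + c) = nth_deriv_within UNIV j g x" for x
  proof (induction j arbitrary: x)
    case (Suc j)
    have "(nth_deriv_within UNIV j g has_vector_derivative y) (at (x + c)) \<longleftrightarrow>
       (nth_deriv_within UNIV j g has_vector_derivative y) (at x)" for y
      using DERIV_shift[of "nth_deriv_within UNIV j g" y x c] Suc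
      by (simp add: has_real_derivative_iff_has_vector_derivative)
    then show ?case
      by (simp add: vector_derivative_def)
  qed (use assms Circle in auto)
  then show ?thesis
    using Circle by simp
qed (use assms in \<open>simp add: translation_def\<close>)

lemma diffeo_lift_deriv_translation:
  assumes "diffeo_lift M k F p" "translation M c" "x \<in> lift_dom M"
  shows "p (x + c) = p x"
proof -
  have "((\<lambda>x. F (x + c)) has_real_derivative p (x + c)) (at x within lift_dom M)"
    using assms diffeo_lift_deriv translation_mem
    by (subst has_real_derivative_shift) (auto simp: translation_def intro: one_manifold.exhaust)
  moreover have "((\<lambda>x. F (x + c)) has_real_derivative p x) (at x within lift_dom M)"
    using diffeo_lift_deriv[OF assms(1,3)] normalized_lift_translation[OF diffeo_lift_normalized[OF assms(1)] assms(2)]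
    by (auto intro!: derivative_eq_intros)
  ultimately show ?thesis
    using lift_dom.nth_deriv_within_1 assms(3) by metis
qed

lemma translation_invariant_proj:
  assumes "\<And>x c. x \<in> lift_dom M \<Longrightarrow> translation M c \<Longrightarrow> p (x + c) = p x" "x \<in> lift_dom M"
  shows "p (proj M x) = p x"
proof -
  have "proj M (proj M x) = proj M x"
    using proj_points proj_in_points assms by blast
  then show ?thesis
    using assms proj_eqE by metis
qed

lemma translation_invariant_bounded:
  assumes "\<And>x c. x \<in> lift_dom M \<Longrightarrow> translation M c \<Longrightarrow> p (x + c) = p x"
    and "continuous_on (lift_dom M) p"
  obtains b where "\<And>x. x \<in> lift_dom M \<Longrightarrow> \<bar>p x\<bar> \<le> (b :: real)"
proof -
  have "compact (p ` {0..1})"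
    using assms(2) unit_subset_lift_dom continuous_on_subset by (intro compact_continuous_image) blast+
  then obtain b where b: "\<And>x. x \<in> {0..1} \<Longrightarrow> \<bar>p x\<bar> \<le> b"
    using compact_imp_bounded bounded_iff by (metis imageI real_norm_def)
  have "\<bar>p x\<bar> \<le> b" if "x \<in> lift_dom M" for x
    using b[of "proj M x"] translation_invariant_proj[OF assms(1) that] proj_in_points[OF that]
      points_subset_unit[of M] by auto
  then show ?thesis
    using that by blast
qed

lemma translation_invariant_C_bounded:
  assumes inv: "\<And>x c. x \<in> lift_dom M \<Longrightarrow> translation M c \<Longrightarrow> p (x + c) = p x"
    and C: "C_class_on (enat n) (lift_dom M) p"
  obtains b where "C_bounded_on (lift_dom M) n b p"
proof -
  have "\<exists>b. \<forall>x\<in>lift_dom M. \<bar>nth_deriv_within (lift_dom M) i p x\<bar> \<le> b" if "i \<le> n" for i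
  proof -
    have "continuous_on (lift_dom M) (nth_deriv_within (lift_dom M) i p)"
      using C that unfolding C_class_on_def by simp
    then show ?thesis
      using translation_invariant_bounded[of M "nth_deriv_within (lift_dom M) i p"]
        nth_deriv_within_shift[of M p] inv by metis
  qed
  then obtain B where B: "\<And>i x. i \<le> n \<Longrightarrow> x \<in> lift_dom M \<Longrightarrow> \<bar>nth_deriv_within (lift_dom M) i p x\<bar> \<le> B i"
    by metis
  have "B i \<le> (\<Sum>i\<le>n. \<bar>B i\<bar>)" if "i \<le> n" for i
    using member_le_sum[of i "{..n}" "\<lambda>i. \<bar>B i\<bar>"] that by simp
  then have "C_bounded_on (lift_dom M) n (\<Sum>i\<le>n. \<bar>B i\<bar>) p"
    using B C unfolding C_bounded_on_def by (meson order_trans)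
  then show ?thesis
    using that by blast
qed

lemma diffeo_lift_deriv_lower:
  assumes F: "diffeo_lift M k F p" and "1 \<le> k"
  obtains m where "0 < m" "\<And>x. x \<in> lift_dom M \<Longrightarrow> m \<le> p x"
proof -
  obtain b where "C_bounded_on (lift_dom M) 0 b p"
    using diffeo_lift_C_bounded[OF F, of 0] assms one_le_enat_iff by metis
  then have cont: "continuous_on (lift_dom M) p"
    using lift_dom.C_bounded_on_0 by blast
  have pos: "0 < p x" if "x \<in> lift_dom M" for x
    using diffeo_lift_deriv_pos[OF F that] .
  obtain b where b: "\<And>x. x \<in> lift_dom M \<Longrightarrow> \<bar>1 / p x\<bar> \<le> b"
  proof (rule translation_invariant_bounded[of M "\<lambda>x. 1 / p x"])
    show "continuous_on (lift_dom M) (\<lambda>x. 1 / p x)"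
      using cont pos by (auto intro!: continuous_intros simp: less_le)
  qed (use diffeo_lift_deriv_translation[OF F] in auto)
  have b0: "0 < b"
    using b[of 0] pos[of 0] unit_subset_lift_dom[of M] by (smt (verit) atLeastAtMost_iff divide_pos_pos subsetD)
  have "1 / b \<le> p x" if "x \<in> lift_dom M" for x
    using b[OF that] pos[OF that] b0 by (simp add: field_simps)
  then show ?thesis
    using that[of "1 / b"] b0 by simp
qed

text \<open>The inverse function theorem is applied to the true inverse \<open>G - c\<close> of \<open>F\<close>; its derivative is
  that of \<open>G\<close> because \<open>p\<close> is translation-invariant.\<close>

lemma diffeo_lift_inverse:
  assumes F: "diffeo_lift M k F p" and k: "1 \<le> k"
  obtains G c where "translation M c" "diffeo_lift M k G (\<lambda>y. 1 / p (G y))"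
    "\<And>x. x \<in> lift_dom M \<Longrightarrow> G (F x) = x + c" "\<And>x. x \<in> lift_dom M \<Longrightarrow> F (G x) = x + c"
proof -
  let ?S = "lift_dom M"
  obtain G c where G: "translation M c" "normalized_lift M G" "\<And>x. x \<in> ?S \<Longrightarrow> G x \<in> ?S"
    "\<And>x. x \<in> ?S \<Longrightarrow> G (F x) = x + c" "\<And>x. x \<in> ?S \<Longrightarrow> F (G x) = x + c"
    using normalized_lift_inverse[OF diffeo_lift_normalized[OF F] diffeo_lift_continuous[OF F]
        diffeo_lift_strict_mono[OF F]] by metis
  obtain m where m: "0 < m" "\<And>x. x \<in> ?S \<Longrightarrow> m \<le> p x"
    using diffeo_lift_deriv_lower[OF F k] by metis
  let ?G1 = "\<lambda>y. G y + - c"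
  have G1: "?G1 y \<in> ?S" "F (?G1 y) = y" "p (?G1 y) = p (G y)" if "y \<in> ?S" for y
    using translation_mem[OF translation_uminus[OF G(1)] G(3)[OF that]] G(5)[OF that]
      diffeo_lift_deriv_translation[OF F translation_uminus[OF G(1)] G(3)[OF that]]
      normalized_lift_translation[OF diffeo_lift_normalized[OF F] translation_uminus[OF G(1)], of "G y"]
    by auto
  have der: "(G has_real_derivative 1 / p (G y)) (at y within ?S)" if "y \<in> ?S" for y
  proof -
    have "(?G1 has_real_derivative 1 / p (?G1 y)) (at y within ?S)"
      using lift_dom.has_real_derivative_inverse[of M F p m ?G1 y] diffeo_lift_deriv[OF F] m G1 that by blast
    from DERIV_add[OF this DERIV_const[of c]] show ?thesis
      using G1(3)[OF that] by simp
  qed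
  have "\<exists>b. C_bounded_on ?S n b (\<lambda>y. 1 / p (G y))" if n: "enat (Suc n) \<le> k" for n
  proof -
    obtain b where "0 \<le> b" "C_bounded_on ?S n b p"
      using diffeo_lift_C_bounded[OF F n] .
    then show ?thesis
      using lift_dom.C_bounded_on_inverse[of M n b p m G] m G(3) der by blast
  qed
  then have "diffeo_lift M k G (\<lambda>y. 1 / p (G y))"
    unfolding diffeo_lift_def using G der diffeo_lift_deriv_pos[OF F] by simp
  then show ?thesis
    using that G by blast
qed

lemma normalizeE:
  assumes "normalized_lift M F" "normalized_lift M G"
  obtains c where "translation M c" "normalized_lift M (\<lambda>x. F (G x) + c)"
proof (cases M)
  case Interval
  then show ?thesis using assms that[of 0] by (simp add: translation_0)
next
  case Circle
  have "0 \<le> F (G 0) - of_int \<lfloor>F (G 0)\<rfloor>" "F (G 0) - of_int \<lfloor>F (G 0)\<rfloor> < 1"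
    by linarith+
  then show ?thesis
    using assms Circle that[of "- of_int \<lfloor>F (G 0)\<rfloor>"] by (simp add: translation_def)
qed

lemma diffeo_lift_compose:
  assumes F: "diffeo_lift M k F p" and G: "diffeo_lift M k G q"
  obtains c where "translation M c" "diffeo_lift M k (\<lambda>x. F (G x) + c) (\<lambda>x. p (G x) * q x)"
proof -
  let ?S = "lift_dom M"
  obtain c where c: "translation M c" "normalized_lift M (\<lambda>x. F (G x) + c)"
    using normalizeE F G diffeo_lift_normalized by metis
  have "((\<lambda>x. F (G x) + c) has_real_derivative p (G x) * q x) (at x within ?S)" if "x \<in> ?S" for x
  proof -
    have "(F has_real_derivative p (G x)) (at (G x) within G ` ?S)"
      using diffeo_lift_deriv[OF F diffeo_lift_mem[OF G that]] by (rule DERIV_subset) (use diffeo_lift_mem[OF G] in auto)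
    from DERIV_image_chain[OF this diffeo_lift_deriv[OF G that]]
    have "((\<lambda>x. F (G x)) has_real_derivative p (G x) * q x) (at x within ?S)"
      by (simp add: o_def)
    then show ?thesis
      by (auto intro!: derivative_eq_intros)
  qed
  moreover have "\<exists>b. C_bounded_on ?S n b (\<lambda>x. p (G x) * q x)" if n: "enat (Suc n) \<le> k" for n
  proof -
    obtain a b where ab: "0 \<le> a" "0 \<le> b" "C_bounded_on ?S n a p" "C_bounded_on ?S n b q"
      using diffeo_lift_C_bounded[OF F n] diffeo_lift_C_bounded[OF G n] by metis
    have "C_bounded_on ?S n (a * compose_bound n b) (\<lambda>x. p (G x))"
      using ab diffeo_lift_mem[OF G] diffeo_lift_deriv[OF G] C_bounded_on_mono[OF ab(4)]
      by (intro lift_dom.C_bounded_on_compose[where G' = q]) auto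
    then show ?thesis
      using lift_dom.C_bounded_on_mult[OF _ ab(4)] ab compose_bound_ge_1[of b n]
      by (metis mult_nonneg_nonneg order_trans zero_le_one)
  qed
  ultimately have "diffeo_lift M k (\<lambda>x. F (G x) + c) (\<lambda>x. p (G x) * q x)"
    unfolding diffeo_lift_def using c diffeo_lift_deriv_pos[OF F] diffeo_lift_deriv_pos[OF G] diffeo_lift_mem[OF G]
    by simp
  then show ?thesis
    using that c by blast
qed

lemma diffeo_lift_id: "diffeo_lift M k (\<lambda>x. x) (\<lambda>x. 1)"
  unfolding diffeo_lift_def using lift_dom.C_bounded_on_const[of 1 1 M] by (cases M) auto

lemma diffeo_lift_C_class:
  assumes "diffeo_lift M k F p" "1 \<le> k"
  shows "C_class_on k (lift_dom M) F"
  using assms lift_dom.C_class_on_iff_deriv[of M F p k] unfolding diffeo_lift_def C_bounded_on_def by blast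

lemma diffeo_lift_lipschitz:
  assumes F: "diffeo_lift M k F p" and "1 \<le> k"
  obtains K where "0 < K" "\<And>x y. x \<in> lift_dom M \<Longrightarrow> y \<in> lift_dom M \<Longrightarrow> \<bar>F x - F y\<bar> \<le> K * \<bar>x - y\<bar>"
proof -
  obtain b where b: "0 \<le> b" "C_bounded_on (lift_dom M) 0 b p"
    using diffeo_lift_C_bounded[OF F, of 0] assms one_le_enat_iff by metis
  have "\<bar>F x - F y\<bar> \<le> (b + 1) * \<bar>x - y\<bar>" if xy: "x \<in> lift_dom M" "y \<in> lift_dom M" for x y
  proof -
    obtain z where z: "z \<in> lift_dom M" "F x - F y = p z * (x - y)"
      using lift_dom.mean_value[of M F p y x] diffeo_lift_deriv[OF F] xy by blast
    then show ?thesis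
      using C_bounded_on_abs_le[OF b(2) z(1)] by (simp add: abs_mult mult_right_mono)
  qed
  then show ?thesis
    using that[of "b + 1"] b by simp
qed


section \<open>The group of diffeomorphisms in terms of lifts\<close>

lemma the_lift_descend_diffeo:
  assumes "diffeo_lift M k F p" "x \<in> lift_dom M"
  shows "the_lift M (descend M F) x = F x"
  using the_lift_descend[OF diffeo_lift_normalized[OF assms(1)] diffeo_lift_continuous[OF assms(1)]]
    diffeo_lift_mem[OF assms(1)] assms(2) by blast

text \<open>Together with \<open>Diff_plus_lift\<close> below, this identifies diffeomorphisms with their lifts.\<close>

lemma descend_in_Diff_plus:
  assumes F: "diffeo_lift M k F p" and k: "1 \<le> k"
  shows "descend M F \<in> Diff_plus M k"
proof -
  obtain G c where G: "translation M c" "diffeo_lift M k G (\<lambda>y. 1 / p (G y))"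
    "\<And>x. x \<in> lift_dom M \<Longrightarrow> G (F x) = x + c" "\<And>x. x \<in> lift_dom M \<Longrightarrow> F (G x) = x + c"
    using diffeo_lift_inverse[OF F k] by metis
  have cont: "continuous_map (mfd_topology M) (mfd_topology M) (descend M H)" if "diffeo_lift M k H q" for H q
    using diffeo_lift_lipschitz[OF that k] continuous_map_descend[OF diffeo_lift_normalized[OF that] diffeo_lift_mem[OF that]]
    by metis
  note inv = inv_into_descend[OF diffeo_lift_normalized[OF F] diffeo_lift_mem[OF F]
      diffeo_lift_normalized[OF G(2)] diffeo_lift_mem[OF G(2)] G(1,3,4)]
  have "homeomorphic_maps (mfd_topology M) (mfd_topology M) (descend M F) (descend M G)"
    unfolding homeomorphic_maps_def topspace_mfd
  proof (intro conjI ballI cont[OF F] cont[OF G(2)])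
    fix x assume x: "x \<in> points M"
    have Gx: "descend M G y = inv_into (points M) (descend M F) y" if "y \<in> points M" for y
      using inv(2) that by (metis restrict_apply')
    show "descend M G (descend M F x) = x"
      using inv(1) x Gx by (simp add: bij_betw_inv_into_left bij_betw_apply)
    show "descend M F (descend M G x) = x"
      using inv(1) x Gx by (simp add: bij_betw_inv_into_right)
  qed
  then have "homeomorphic_map (mfd_topology M) (mfd_topology M) (descend M F)"
    using homeomorphic_map_maps by blast
  moreover have "orientation_preserving M (descend M F)"
  proof (cases M)
    case Interval
    then show ?thesis
      using diffeo_lift_strict_mono[OF F] by (simp add: descend_def strict_mono_on_def)
  next
    case Circle
    then have "is_circle_lift (descend M F) F"
      using is_circle_lift_iff[OF descend_extensional] diffeo_lift_continuous[OF F] diffeo_lift_normalized[OF F]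
      by simp
    then show ?thesis
      using Circle diffeo_lift_strict_mono[OF F] by auto
  qed
  moreover have "C_class_on k (lift_dom M) (the_lift M (descend M H))" if "diffeo_lift M k H q" for H q
    using C_class_on_cong[of "lift_dom M" "the_lift M (descend M H)" H k] the_lift_descend_diffeo[OF that]
      diffeo_lift_C_class[OF that k] by blast
  ultimately show ?thesis
    unfolding Diff_plus_def using F G inv(2) descend_extensional by auto
qed

lemma mfd_deriv_descend:
  assumes "diffeo_lift M k F p" "x \<in> lift_dom M"
  shows "mfd_deriv M (Suc 0) (descend M F) x = p x"
proof -
  have "mfd_deriv M (Suc 0) (descend M F) x = nth_deriv_within (lift_dom M) (Suc 0) F x"
    unfolding mfd_deriv_def
    by (rule nth_deriv_within_cong) (use the_lift_descend_diffeo assms in auto)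
  also have "\<dots> = p x"
    using assms diffeo_lift_deriv by (intro lift_dom.nth_deriv_within_1) auto
  finally show ?thesis .
qed

lemma mfd_deriv_Suc: "mfd_deriv M (Suc j) f = nth_deriv_within (lift_dom M) j (mfd_deriv M (Suc 0) f)"
  unfolding mfd_deriv_def by (induction j) auto

text \<open>A normalized lift \<open>G\<close> of the inverse map exists by topology alone, hence is the lift that the
  group of diffeomorphisms requires to be smooth. Differentiating \<open>G (F x) = x + c\<close> shows that the
  derivative of \<open>F\<close>, which is nonnegative by monotonicity, does not vanish.\<close>

lemma Diff_plus_lift:
  assumes f: "f \<in> Diff_plus M k" and k: "1 \<le> k"
  shows "diffeo_lift M k (the_lift M f) (mfd_deriv M (Suc 0) f)" and "descend M (the_lift M f) = f"
proof -
  let ?S = "lift_dom M" and ?F = "the_lift M f" and ?p = "mfd_deriv M (Suc 0) f"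
  have ext: "f \<in> extensional (points M)" and hom: "homeomorphic_map (mfd_topology M) (mfd_topology M) f"
    and ori: "orientation_preserving M f" and C: "C_class_on k ?S ?F"
    and Ci: "C_class_on k ?S (the_lift M (restrict (inv_into (points M) f) (points M)))"
    using f unfolding Diff_plus_def by auto
  have fim: "f ` points M = points M"
    using hom unfolding homeomorphic_eq_everything_map topspace_mfd by blast
  have cont: "continuous_on ?S ?F"
    using C unfolding C_class_on_def by (auto dest!: spec[of _ 0] simp: zero_enat_def[symmetric])
  have F: "normalized_lift M ?F \<and> strict_mono_on ?S ?F \<and> descend M ?F = f"
  proof (cases M)
    case Interval
    have mono: "strict_mono_on {0..1} f"
      using ori Interval by simp
    have im: "f ` {0..1} = {0..1}"
      using fim Interval by simp
    have "0 \<in> f ` {0..1}" "1 \<in> f ` {0..1}"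
      unfolding im by simp_all
    then obtain a b where ab: "a \<in> {0..1}" "f a = 0" "b \<in> {0..1}" "f b = 1"
      by force
    have "f 0 \<in> {0..1}" "f 1 \<in> {0..1}"
      using im by auto
    moreover have "f 0 \<le> f a" "f b \<le> f 1"
      using strict_mono_on_leD[OF mono, of 0 a] strict_mono_on_leD[OF mono, of b 1] ab by auto
    ultimately have "normalized_lift M f"
      using Interval ab by simp
    moreover have "descend M f = f"
      using Interval ext by (auto simp: descend_def extensional_def)
    ultimately show ?thesis
      using Interval mono by simp
  next
    case Circle
    then obtain F where F: "is_circle_lift f F" "strict_mono F"
      using ori by auto
    then have "?F = F"
      using the_lift_circle_eqI Circle by blast
    then show ?thesis
      using F is_circle_lift_iff[of f F] ext Circle by auto
  qed
  obtain G c where G: "translation M c" "normalized_lift M G" "\<And>x. x \<in> ?S \<Longrightarrow> G x \<in> ?S"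
    "\<And>x. x \<in> ?S \<Longrightarrow> G (?F x) = x + c" "\<And>x. x \<in> ?S \<Longrightarrow> ?F (G x) = x + c" "continuous_on ?S G"
    using normalized_lift_inverse[of M ?F] F cont by metis
  have Fmem: "?F x \<in> ?S" if "x \<in> ?S" for x
    using normalized_lift_bij[of M ?F] F cont that by (auto simp: bij_betw_def)
  have "restrict (inv_into (points M) f) (points M) = descend M G"
    using inv_into_descend(2)[of M ?F G c] F Fmem G by simp
  then have "C_class_on k ?S G"
    using Ci C_class_on_cong[of ?S "the_lift M (descend M G)" G] the_lift_descend[OF G(2,6,3)] by simp
  then have "C_class_on (enat (Suc 0)) ?S G" "C_class_on (enat (Suc 0)) ?S ?F"
    using k C C_class_on_mono one_le_enat_iff by blast+
  then obtain q p where q: "\<And>x. x \<in> ?S \<Longrightarrow> (G has_real_derivative q x) (at x within ?S)"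
    and p: "\<And>x. x \<in> ?S \<Longrightarrow> (?F has_real_derivative p x) (at x within ?S)"
    unfolding lift_dom.C_class_on_Suc by blast
  have der: "(?F has_real_derivative ?p x) (at x within ?S)" if "x \<in> ?S" for x
    using p[OF that] lift_dom.nth_deriv_within_1[OF p[OF that] that] by (simp add: mfd_deriv_def)
  have pos: "0 < ?p x" if x: "x \<in> ?S" for x
  proof -
    have "(G has_real_derivative q (?F x)) (at (?F x) within ?F ` ?S)"
      using q[OF Fmem[OF x]] by (rule DERIV_subset) (use Fmem in auto)
    from DERIV_image_chain[OF this der[OF x]]
    have 1: "((\<lambda>x. G (?F x)) has_real_derivative q (?F x) * ?p x) (at x within ?S)"
      by (simp add: o_def)
    have "((\<lambda>x. x + c) has_real_derivative q (?F x) * ?p x) (at x within ?S)"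
      by (rule has_field_derivative_transform_within[OF 1 zero_less_one x]) (use G in auto)
    moreover have "((\<lambda>x. x + c) has_real_derivative 1) (at x within ?S)"
      by (auto intro!: derivative_eq_intros)
    ultimately have "q (?F x) * ?p x = 1"
      using lift_dom.nth_deriv_within_1 x by metis
    then have "?p x \<noteq> 0" by auto
    moreover have "0 \<le> ?p x"
    proof (rule tendsto_lowerbound[OF _ _ lift_dom.not_isolated[OF x]])
      show "((\<lambda>y. (?F y - ?F x) / (y - x)) \<longlongrightarrow> ?p x) (at x within ?S)"
        using der[OF x] by (simp add: has_field_derivative_iff)
      have "0 \<le> (?F y - ?F x) / (y - x)" if "y \<in> ?S" for y
        using strict_mono_on_leD[of ?S ?F y x] strict_mono_on_leD[of ?S ?F x y] F x that
        by (cases "x \<le> y") (auto simp: divide_simps)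
      then show "\<forall>\<^sub>F y in at x within ?S. 0 \<le> (?F y - ?F x) / (y - x)"
        by (auto simp: eventually_at_filter)
    qed
    ultimately show ?thesis by simp
  qed
  have inv: "?p (x + c) = ?p x" if "x \<in> ?S" "translation M c" for x c
  proof -
    have "((\<lambda>x. ?F (x + c)) has_real_derivative ?p (x + c)) (at x within ?S)"
      using der that translation_mem
      by (subst has_real_derivative_shift) (auto simp: translation_def intro: one_manifold.exhaust)
    moreover have "((\<lambda>x. ?F (x + c)) has_real_derivative ?p x) (at x within ?S)"
      using der[OF that(1)] normalized_lift_translation[of M ?F c] F that
      by (auto intro!: derivative_eq_intros)
    ultimately show ?thesis
      using lift_dom.nth_deriv_within_1 that(1) by metis
  qed
  have "\<exists>b. C_bounded_on ?S n b ?p" if n: "enat (Suc n) \<le> k" for n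
  proof -
    have "C_class_on (enat n) ?S ?p"
      using C lift_dom.C_class_on_iff_deriv[OF der k] n by blast
    then show ?thesis
      using translation_invariant_C_bounded[of M ?p n] inv by metis
  qed
  then show "diffeo_lift M k ?F ?p"
    unfolding diffeo_lift_def using F der pos by blast
  show "descend M ?F = f"
    using F by blast
qed


lemma Diff_plus_antimono: "j \<le> k \<Longrightarrow> Diff_plus M k \<subseteq> Diff_plus M j"
  unfolding Diff_plus_def using C_class_on_mono by blast

lemma identity_eq_descend: "(\<lambda>x\<in>points M. x) = descend M (\<lambda>x. x)"
  using proj_points by (auto simp: descend_def)

lemma Diff_plus_extensional: "f \<in> Diff_plus M k \<Longrightarrow> f \<in> extensional (points M)"
  by (simp add: Diff_plus_def)

lemma Diff_plus_mem:
  assumes "f \<in> Diff_plus M k" "1 \<le> k"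
  shows "x \<in> points M \<Longrightarrow> f x \<in> points M"
  using descend_in_points[of M "the_lift M f"] Diff_plus_lift[OF assms] diffeo_lift_mem by metis

lemma Diff_plus_compose:
  assumes f: "f \<in> Diff_plus M k" and g: "g \<in> Diff_plus M k" and k: "1 \<le> k"
  shows "compose (points M) f g \<in> Diff_plus M k"
    and "x \<in> lift_dom M \<Longrightarrow> mfd_deriv M (Suc 0) (compose (points M) f g) x =
      mfd_deriv M (Suc 0) f (the_lift M g x) * mfd_deriv M (Suc 0) g x"
proof -
  note F = Diff_plus_lift[OF f k] and G = Diff_plus_lift[OF g k]
  obtain c where c: "translation M c"
    "diffeo_lift M k (\<lambda>x. the_lift M f (the_lift M g x) + c)
      (\<lambda>x. mfd_deriv M (Suc 0) f (the_lift M g x) * mfd_deriv M (Suc 0) g x)"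
    using diffeo_lift_compose[OF F(1) G(1)] by metis
  have "descend M (the_lift M f) (descend M (the_lift M g) x) =
      descend M (\<lambda>x. the_lift M f (the_lift M g x) + c) x" if "x \<in> points M" for x
    by (rule descend_descend[OF diffeo_lift_normalized[OF F(1)] diffeo_lift_mem[OF G(1)] c(1)]) (use that in auto)
  then have eq: "compose (points M) f g = descend M (\<lambda>x. the_lift M f (the_lift M g x) + c)"
    unfolding F(2) G(2) by (intro extensionalityI[of _ "points M"]) (auto simp: compose_def descend_extensional)
  show "compose (points M) f g \<in> Diff_plus M k"
    unfolding eq using descend_in_Diff_plus[OF c(2) k] .
  show "mfd_deriv M (Suc 0) (compose (points M) f g) x =
      mfd_deriv M (Suc 0) f (the_lift M g x) * mfd_deriv M (Suc 0) g x" if "x \<in> lift_dom M"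
    unfolding eq using mfd_deriv_descend[OF c(2) that] .
qed

lemma Diff_plus_left_inverse:
  assumes f: "f \<in> Diff_plus M k" and k: "1 \<le> k"
  shows "\<exists>g\<in>Diff_plus M k. compose (points M) g f = (\<lambda>x\<in>points M. x)"
proof -
  note F = Diff_plus_lift[OF f k]
  obtain G c where G: "translation M c" "diffeo_lift M k G (\<lambda>y. 1 / mfd_deriv M (Suc 0) f (G y))"
    "\<And>x. x \<in> lift_dom M \<Longrightarrow> G (the_lift M f x) = x + c"
    using diffeo_lift_inverse[OF F(1) k] by metis
  have "descend M G (descend M (the_lift M f) x) = x" if "x \<in> points M" for x
  proof -
    have "descend M G (descend M (the_lift M f) x) = descend M (\<lambda>x. G (the_lift M f x)) x"
      by (rule descend_descend[OF diffeo_lift_normalized[OF G(2)] diffeo_lift_mem[OF F(1)] translation_0])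
        (use that in auto)
    also have "\<dots> = x"
      by (rule descend_id_translation[OF G(1)]) (use G that in auto)
    finally show ?thesis .
  qed
  then have "compose (points M) (descend M G) f = (\<lambda>x\<in>points M. x)"
    using F(2) by (auto simp: compose_def)
  then show ?thesis
    using descend_in_Diff_plus[OF G(2) k] by blast
qed

lemma group_Diff_group:
  assumes k: "1 \<le> k"
  shows "group (Diff_group M k)"
proof (rule groupI)
  show "\<one>\<^bsub>Diff_group M k\<^esub> \<in> carrier (Diff_group M k)"
    using descend_in_Diff_plus[OF diffeo_lift_id k] by (simp add: Diff_group_def identity_eq_descend)
  show "x \<otimes>\<^bsub>Diff_group M k\<^esub> y \<otimes>\<^bsub>Diff_group M k\<^esub> z = x \<otimes>\<^bsub>Diff_group M k\<^esub> (y \<otimes>\<^bsub>Diff_group M k\<^esub> z)"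
    if "x \<in> carrier (Diff_group M k)" "y \<in> carrier (Diff_group M k)" "z \<in> carrier (Diff_group M k)" for x y z
    using compose_assoc[of z "points M" "points M" x y] Diff_plus_mem[of z M k] that k
    by (simp add: Diff_group_def)
  show "\<one>\<^bsub>Diff_group M k\<^esub> \<otimes>\<^bsub>Diff_group M k\<^esub> x = x" if "x \<in> carrier (Diff_group M k)" for x
    using that Diff_plus_mem[of x M k] Diff_plus_extensional[of x M k] k
    by (auto simp: Diff_group_def compose_def extensional_def)
qed (use Diff_plus_compose(1)[OF _ _ k] Diff_plus_left_inverse[OF _ k] in \<open>auto simp: Diff_group_def\<close>)


section \<open>The metrics of the \<open>C\<^sup>k\<close> topology\<close>

lemma zero_in_points: "0 \<in> points M"
  by (cases M) auto

lemma mfd_dist_nonneg: "0 \<le> mfd_dist M x y"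
  by (cases M) auto

lemma mfd_deriv_proj:
  assumes "f \<in> Diff_plus M k" "1 \<le> k" "x \<in> lift_dom M"
  shows "mfd_deriv M (Suc j) f (proj M x) = mfd_deriv M (Suc j) f x"
  unfolding mfd_deriv_Suc[of M j]
proof (rule translation_invariant_proj[OF _ assms(3)])
  fix x c assume "x \<in> lift_dom M" "translation M c"
  then show "nth_deriv_within (lift_dom M) j (mfd_deriv M (Suc 0) f) (x + c) =
      nth_deriv_within (lift_dom M) j (mfd_deriv M (Suc 0) f) x"
    using nth_deriv_within_shift diffeo_lift_deriv_translation[OF Diff_plus_lift(1)[OF assms(1,2)]] by blast
qed

lemma mfd_deriv_C_bounded:
  assumes "f \<in> Diff_plus M k" "1 \<le> k" "enat (Suc n) \<le> k"
  obtains b where "0 \<le> b" "C_bounded_on (lift_dom M) n b (mfd_deriv M (Suc 0) f)"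
  using diffeo_lift_C_bounded[OF Diff_plus_lift(1)[OF assms(1,2)] assms(3)] by metis

lemma one_le_enat_Suc: "1 \<le> enat (Suc n)"
  by (simp add: one_enat_def)

lemma bdd_above_mfd_dist:
  assumes "f \<in> Diff_plus M k" "g \<in> Diff_plus M k" "1 \<le> k"
  shows "bdd_above ((\<lambda>x. mfd_dist M (f x) (g x)) ` points M)"
proof (rule bdd_aboveI2[where M = "2 * pi"])
  fix x assume "x \<in> points M"
  then have "f x \<in> {0..1}" "g x \<in> {0..1}"
    using assms Diff_plus_mem points_subset_unit by blast+
  then have "2 * pi * \<bar>f x - g x\<bar> \<le> 2 * pi * 1"
    by (intro mult_left_mono) auto
  then show "mfd_dist M (f x) (g x) \<le> 2 * pi"
    using mfd_dist_le[of M "f x" "g x"] by (simp only: mult_1_right)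
qed

lemma bdd_above_mfd_deriv:
  assumes f: "f \<in> Diff_plus M k" and g: "g \<in> Diff_plus M k" and k: "enat (Suc n) \<le> k"
  shows "bdd_above ((\<lambda>x. \<bar>mfd_deriv M (Suc n) f x - mfd_deriv M (Suc n) g x\<bar>) ` points M)"
proof -
  have k1: "1 \<le> k"
    using k one_le_enat_Suc order_trans by blast
  obtain a b where ab: "C_bounded_on (lift_dom M) n a (mfd_deriv M (Suc 0) f)"
    "C_bounded_on (lift_dom M) n b (mfd_deriv M (Suc 0) g)"
    using mfd_deriv_C_bounded f g k k1 by metis
  show ?thesis
  proof (rule bdd_aboveI2[where M = "a + b"])
    fix x assume "x \<in> points M"
    then show "\<bar>mfd_deriv M (Suc n) f x - mfd_deriv M (Suc n) g x\<bar> \<le> a + b"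
      using C_bounded_on_boundD[OF ab(1) order_refl, of x] C_bounded_on_boundD[OF ab(2) order_refl, of x]
        points_subset_lift_dom unfolding mfd_deriv_Suc[of M n] by fastforce
  qed
qed

definition deriv_gap :: "one_manifold \<Rightarrow> nat \<Rightarrow> (real \<Rightarrow> real) \<Rightarrow> (real \<Rightarrow> real) \<Rightarrow> real" where
  "deriv_gap M j f g = (SUP x\<in>points M. \<bar>mfd_deriv M j f x - mfd_deriv M j g x\<bar>)"

lemma Diff_metric_eq:
  assumes "f \<in> Diff_plus M (enat n)" "g \<in> Diff_plus M (enat n)"
  shows "Diff_metric M n f g = (SUP x\<in>points M. mfd_dist M (f x) (g x)) + (\<Sum>j=1..n. deriv_gap M j f g)"
  using assms by (simp add: Diff_metric_def deriv_gap_def)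

lemma deriv_gap_nonneg:
  assumes "f \<in> Diff_plus M (enat n)" "g \<in> Diff_plus M (enat n)" "j \<in> {1..n}"
  shows "0 \<le> deriv_gap M j f g"
proof (cases j)
  case (Suc i)
  then show ?thesis
    unfolding deriv_gap_def
    using assms bdd_above_mfd_deriv[of f M "enat n" g i]
    by (intro cSUP_upper2[OF _ zero_in_points]) auto
qed (use assms in auto)

lemma mfd_dist_le_Diff_metric:
  assumes fg: "f \<in> Diff_plus M (enat n)" "g \<in> Diff_plus M (enat n)" and n: "1 \<le> n" and x: "x \<in> points M"
  shows "mfd_dist M (f x) (g x) \<le> Diff_metric M n f g"
proof -
  have "mfd_dist M (f x) (g x) \<le> (SUP x\<in>points M. mfd_dist M (f x) (g x))"
    using bdd_above_mfd_dist[OF fg] n x by (intro cSUP_upper) (auto simp: one_enat_def)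
  then show ?thesis
    using sum_nonneg[of "{1..n}" "\<lambda>j. deriv_gap M j f g"] deriv_gap_nonneg[OF fg]
    unfolding Diff_metric_eq[OF fg] by fastforce
qed

lemma Diff_metric_nonneg: "1 \<le> n \<Longrightarrow> 0 \<le> Diff_metric M n f g"
  using mfd_dist_le_Diff_metric[of f M n g 0] mfd_dist_nonneg[of M "f 0" "g 0"] zero_in_points
  by (cases "f \<in> Diff_plus M (enat n) \<and> g \<in> Diff_plus M (enat n)") (auto simp: Diff_metric_def)

lemma mfd_deriv_le_Diff_metric:
  assumes fg: "f \<in> Diff_plus M (enat n)" "g \<in> Diff_plus M (enat n)" and j: "Suc j \<le> n"
    and x: "x \<in> lift_dom M"
  shows "\<bar>mfd_deriv M (Suc j) f x - mfd_deriv M (Suc j) g x\<bar> \<le> Diff_metric M n f g"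
proof -
  have n: "1 \<le> enat n"
    using j by (simp add: one_enat_def)
  have "\<bar>mfd_deriv M (Suc j) f x - mfd_deriv M (Suc j) g x\<bar> =
      \<bar>mfd_deriv M (Suc j) f (proj M x) - mfd_deriv M (Suc j) g (proj M x)\<bar>"
    using mfd_deriv_proj fg n x by simp
  also have "\<dots> \<le> deriv_gap M (Suc j) f g"
    unfolding deriv_gap_def using bdd_above_mfd_deriv[OF fg, of j] j proj_in_points[OF x]
    by (intro cSUP_upper) auto
  also have "\<dots> \<le> (\<Sum>j=1..n. deriv_gap M j f g)"
    using j deriv_gap_nonneg[OF fg] by (intro member_le_sum) auto
  also have "\<dots> \<le> Diff_metric M n f g"
    unfolding Diff_metric_eq[OF fg]
    using cSUP_upper2[OF bdd_above_mfd_dist[OF fg n] zero_in_points mfd_dist_nonneg] by simp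
  finally show ?thesis .
qed

text \<open>This lemma and the next translate between the metric and the estimates for derivatives.\<close>

lemma mfd_deriv_diff_C_bounded:
  assumes fg: "f \<in> Diff_plus M (enat (Suc n))" "g \<in> Diff_plus M (enat (Suc n))"
  shows "C_bounded_on (lift_dom M) n (Diff_metric M (Suc n) f g)
    (\<lambda>x. mfd_deriv M (Suc 0) f x - mfd_deriv M (Suc 0) g x)"
proof -
  obtain a b where ab: "C_bounded_on (lift_dom M) n a (mfd_deriv M (Suc 0) f)"
    "C_bounded_on (lift_dom M) n b (mfd_deriv M (Suc 0) g)"
    using mfd_deriv_C_bounded[OF fg(1) one_le_enat_Suc] mfd_deriv_C_bounded[OF fg(2) one_le_enat_Suc]
    by (metis order_refl)
  have C: "C_class_on (enat n) (lift_dom M) (\<lambda>x. mfd_deriv M (Suc 0) f x - mfd_deriv M (Suc 0) g x)"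
    using lift_dom.C_bounded_on_diff[OF ab] by (simp add: C_bounded_on_def)
  show ?thesis
    unfolding C_bounded_on_def
  proof (intro conjI C allI impI ballI)
    fix i x assume i: "i \<le> n" and x: "x \<in> lift_dom M"
    have "C_class_on (enat i) (lift_dom M) (mfd_deriv M (Suc 0) f)"
      "C_class_on (enat i) (lift_dom M) (mfd_deriv M (Suc 0) g)"
      using ab i C_class_on_mono unfolding C_bounded_on_def by (meson enat_ord_simps(1))+
    from lift_dom.nth_deriv_within_add_cmult[OF this x, of "-1"]
    show "\<bar>nth_deriv_within (lift_dom M) i (\<lambda>x. mfd_deriv M (Suc 0) f x - mfd_deriv M (Suc 0) g x) x\<bar>
        \<le> Diff_metric M (Suc n) f g"
      using mfd_deriv_le_Diff_metric[OF fg, of i x] i x by (simp add: mfd_deriv_Suc[of M i])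
  qed
qed

lemma Diff_metric_leI:
  assumes fg: "f \<in> Diff_plus M (enat (Suc n))" "g \<in> Diff_plus M (enat (Suc n))"
    and d: "\<And>x. x \<in> points M \<Longrightarrow> mfd_dist M (f x) (g x) \<le> a"
    and C: "C_bounded_on (lift_dom M) n c (\<lambda>x. mfd_deriv M (Suc 0) f x - mfd_deriv M (Suc 0) g x)"
  shows "Diff_metric M (Suc n) f g \<le> a + real (Suc n) * c"
proof -
  obtain b b' where b: "C_bounded_on (lift_dom M) n b (mfd_deriv M (Suc 0) f)"
    "C_bounded_on (lift_dom M) n b' (mfd_deriv M (Suc 0) g)"
    using mfd_deriv_C_bounded[OF fg(1) one_le_enat_Suc] mfd_deriv_C_bounded[OF fg(2) one_le_enat_Suc]
    by (metis order_refl)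
  have "deriv_gap M j f g \<le> c" if j: "j \<in> {1..Suc n}" for j
  proof -
    obtain i where i: "j = Suc i" "i \<le> n"
      using j by (cases j) auto
    have "\<bar>mfd_deriv M j f x - mfd_deriv M j g x\<bar> \<le> c" if "x \<in> points M" for x
    proof -
      have x: "x \<in> lift_dom M"
        using that points_subset_lift_dom by blast
      have "C_class_on (enat i) (lift_dom M) (mfd_deriv M (Suc 0) f)"
        "C_class_on (enat i) (lift_dom M) (mfd_deriv M (Suc 0) g)"
        using b i C_class_on_mono unfolding C_bounded_on_def by (meson enat_ord_simps(1))+
      from lift_dom.nth_deriv_within_add_cmult[OF this x, of "-1"]
      show ?thesis
        using C_bounded_on_boundD[OF C i(2) x] i by (simp add: mfd_deriv_Suc[of M i])
    qed
    then show ?thesis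
      unfolding deriv_gap_def using zero_in_points by (intro cSUP_least) auto
  qed
  then have "(\<Sum>j=1..Suc n. deriv_gap M j f g) \<le> real (Suc n) * c"
    using sum_bounded_above[of "{1..Suc n}" "\<lambda>j. deriv_gap M j f g" c] by simp
  moreover have "(SUP x\<in>points M. mfd_dist M (f x) (g x)) \<le> a"
    using d zero_in_points by (intro cSUP_least) auto
  ultimately show ?thesis
    unfolding Diff_metric_eq[OF fg] by linarith
qed

lemma Diff_metric_mono:
  assumes fg: "f \<in> Diff_plus M (enat n)" "g \<in> Diff_plus M (enat n)" and mn: "m \<le> n"
  shows "Diff_metric M m f g \<le> Diff_metric M n f g"
proof -
  have fg': "f \<in> Diff_plus M (enat m)" "g \<in> Diff_plus M (enat m)"
    using fg Diff_plus_antimono[of "enat m" "enat n"] mn by auto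
  show ?thesis
    unfolding Diff_metric_eq[OF fg] Diff_metric_eq[OF fg']
    using mn deriv_gap_nonneg[OF fg] by (intro add_left_mono sum_mono2) auto
qed

lemma Metric_space_Diff_metric:
  assumes n: "1 \<le> n"
  shows "Metric_space (Diff_plus M (enat n)) (Diff_metric M n)"
proof
  show "0 \<le> Diff_metric M n f g" for f g
    using Diff_metric_nonneg n .
  show "Diff_metric M n f g = Diff_metric M n g f" for f g
    using Metric_space.commute[OF Metric_space_points]
    by (auto simp: Diff_metric_def abs_minus_commute cong: SUP_cong)
next
  have n1: "1 \<le> enat n"
    using n by (simp add: one_enat_def)
  fix f g assume f: "f \<in> Diff_plus M (enat n)" and g: "g \<in> Diff_plus M (enat n)"
  show "Diff_metric M n f g = 0 \<longleftrightarrow> f = g"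
  proof
    assume 0: "Diff_metric M n f g = 0"
    show "f = g"
    proof (rule extensionalityI[OF Diff_plus_extensional[OF f] Diff_plus_extensional[OF g]])
      fix x assume x: "x \<in> points M"
      have "mfd_dist M (f x) (g x) = 0"
        using mfd_dist_le_Diff_metric[OF f g n x] mfd_dist_nonneg[of M "f x" "g x"] 0 by linarith
      then show "f x = g x"
        using Metric_space.zero[OF Metric_space_points] Diff_plus_mem[OF _ n1 x] f g by metis
    qed
  next
    assume "f = g"
    moreover have "mfd_dist M x x = 0" for x
      by (cases M) auto
    moreover have "(SUP x\<in>points M. 0 :: real) = 0"
      using zero_in_points[of M] by (intro cSUP_const) auto
    ultimately show "Diff_metric M n f g = 0"
      by (simp add: Diff_metric_def)
  qed
  fix h assume h: "h \<in> Diff_plus M (enat n)"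
  have "(SUP x\<in>points M. mfd_dist M (f x) (h x)) \<le>
      (SUP x\<in>points M. mfd_dist M (f x) (g x)) + (SUP x\<in>points M. mfd_dist M (g x) (h x))"
  proof (rule cSUP_least)
    fix x assume x: "x \<in> points M"
    have "mfd_dist M (f x) (h x) \<le> mfd_dist M (f x) (g x) + mfd_dist M (g x) (h x)"
      using Metric_space.triangle[OF Metric_space_points] Diff_plus_mem[OF _ n1 x] f g h by metis
    also have "\<dots> \<le> (SUP x\<in>points M. mfd_dist M (f x) (g x)) + (SUP x\<in>points M. mfd_dist M (g x) (h x))"
      using x bdd_above_mfd_dist[OF f g n1] bdd_above_mfd_dist[OF g h n1] by (intro add_mono cSUP_upper)
    finally show "mfd_dist M (f x) (h x) \<le> \<dots>" .
  qed (use zero_in_points in blast)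
  moreover have "deriv_gap M j f h \<le> deriv_gap M j f g + deriv_gap M j g h" if j: "j \<in> {1..n}" for j
  proof -
    obtain i where i: "j = Suc i" "enat (Suc i) \<le> enat n"
      using j by (cases j) auto
    show ?thesis
      unfolding deriv_gap_def i(1)
    proof (rule cSUP_least)
      fix x assume x: "x \<in> points M"
      have "\<bar>mfd_deriv M (Suc i) f x - mfd_deriv M (Suc i) h x\<bar> \<le>
        \<bar>mfd_deriv M (Suc i) f x - mfd_deriv M (Suc i) g x\<bar> + \<bar>mfd_deriv M (Suc i) g x - mfd_deriv M (Suc i) h x\<bar>"
        by linarith
      also have "\<dots> \<le> (SUP x\<in>points M. \<bar>mfd_deriv M (Suc i) f x - mfd_deriv M (Suc i) g x\<bar>) +
        (SUP x\<in>points M. \<bar>mfd_deriv M (Suc i) g x - mfd_deriv M (Suc i) h x\<bar>)"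
        using x bdd_above_mfd_deriv[OF f g i(2)] bdd_above_mfd_deriv[OF g h i(2)] by (intro add_mono cSUP_upper)
      finally show "\<bar>mfd_deriv M (Suc i) f x - mfd_deriv M (Suc i) h x\<bar> \<le> \<dots>" .
    qed (use zero_in_points in blast)
  qed
  ultimately show "Diff_metric M n f h \<le> Diff_metric M n f g + Diff_metric M n g h"
    unfolding Diff_metric_eq[OF f g] Diff_metric_eq[OF f h] Diff_metric_eq[OF g h]
    using sum_mono[of "{1..n}" "\<lambda>j. deriv_gap M j f h" "\<lambda>j. deriv_gap M j f g + deriv_gap M j g h"]
    by (simp add: sum.distrib)
qed

lemma Metric_space_Diff_metric':
  "1 \<le> n \<Longrightarrow> enat n \<le> k \<Longrightarrow> Metric_space (Diff_plus M k) (Diff_metric M n)"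
  using Metric_space.subspace[OF Metric_space_Diff_metric Diff_plus_antimono] by blast

text \<open>The metrics increase with the order. Therefore those of order at most \<open>k\<close> describe the topology
  in the same way for finite and infinite \<open>k\<close>, and finitely many conditions combine into one.\<close>

lemma openin_Diff_topology:
  assumes k: "1 \<le> k"
  shows "openin (Diff_topology M k) U \<longleftrightarrow> U \<subseteq> Diff_plus M k \<and>
    (\<forall>f\<in>U. \<exists>n\<ge>1. enat n \<le> k \<and> (\<exists>e>0. \<forall>g\<in>Diff_plus M k. Diff_metric M n f g < e \<longrightarrow> g \<in> U))"
    (is "_ \<longleftrightarrow> ?R U")
proof -
  have metric_open: "openin (Metric_space.mtopology (Diff_plus M k) (Diff_metric M n)) U \<longleftrightarrow>
      U \<subseteq> Diff_plus M k \<and> (\<forall>f\<in>U. \<exists>e>0. \<forall>g\<in>Diff_plus M k. Diff_metric M n f g < e \<longrightarrow> g \<in> U)"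
    if "1 \<le> n" "enat n \<le> k" for n U
  proof -
    interpret Metric_space "Diff_plus M k" "Diff_metric M n"
      using Metric_space_Diff_metric' that by blast
    have "mball f e \<subseteq> U \<longleftrightarrow> (\<forall>g\<in>Diff_plus M k. Diff_metric M n f g < e \<longrightarrow> g \<in> U)"
      if "f \<in> Diff_plus M k" for f e
      using that by (auto simp: subset_iff)
    then show ?thesis
      unfolding openin_mtopology by (simp add: subset_iff Ball_def cong: conj_cong)
  qed
  show ?thesis
  proof (cases k)
    case (enat m)
    then have m: "1 \<le> m"
      using k by (simp add: one_enat_def)
    have "Diff_metric M n f g < e" if "Diff_metric M m f g < e" "n \<le> m"
      "f \<in> Diff_plus M k" "g \<in> Diff_plus M k" for n f g e
      using Diff_metric_mono[of f M m g n] that enat by auto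
    then show ?thesis
      using metric_open[of m U] m enat by (fastforce simp: subset_iff)
  next
    case infinity
    let ?B = "\<Union>j\<in>{1..}. {U. openin (Metric_space.mtopology (Diff_plus M \<infinity>) (Diff_metric M j)) U}"
    have "?R V" if "generate_topology_on ?B V" for V
      using that
    proof induction
      case (Int a b)
      have "\<exists>n\<ge>1. enat n \<le> k \<and> (\<exists>e>0. \<forall>g\<in>Diff_plus M k. Diff_metric M n f g < e \<longrightarrow> g \<in> a \<inter> b)"
        if f: "f \<in> a \<inter> b" for f
      proof -
        obtain n e n' e' where n: "n \<ge> 1" "0 < e" "\<And>g. g \<in> Diff_plus M k \<Longrightarrow> Diff_metric M n f g < e \<Longrightarrow> g \<in> a"
          "n' \<ge> 1" "0 < e'" "\<And>g. g \<in> Diff_plus M k \<Longrightarrow> Diff_metric M n' f g < e' \<Longrightarrow> g \<in> b"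
          using Int.IH f by blast
        have fN: "f \<in> Diff_plus M k"
          using Int.IH f by blast
        have "Diff_metric M n f g \<le> Diff_metric M (max n n') f g \<and> Diff_metric M n' f g \<le> Diff_metric M (max n n') f g"
          if "g \<in> Diff_plus M k" for g
          using fN that Diff_plus_antimono[of "enat (max n n')" k] infinity
          by (intro conjI Diff_metric_mono) auto
        then show ?thesis
          using n infinity by (intro exI[of _ "max n n'"] conjI exI[of _ "min e e'"])
            (auto intro: le_less_trans)
      qed
      then show ?case
        using Int.IH by blast
    next
      case (UN K)
      then show ?case by (blast intro: UnionI)
    next
      case (Basis s)
      then show ?case
        using metric_open infinity by auto
    qed auto
    moreover have "generate_topology_on ?B U" if R: "?R U"
    proof -
      define K where "K = {V. V \<subseteq> U \<and> V \<in> ?B}"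
      have "U \<subseteq> \<Union> K"
      proof
        fix f assume f: "f \<in> U"
        then obtain n e where n: "n \<ge> 1" "0 < e" "\<And>g. g \<in> Diff_plus M k \<Longrightarrow> Diff_metric M n f g < e \<Longrightarrow> g \<in> U"
          using R by blast
        interpret Metric_space "Diff_plus M k" "Diff_metric M n"
          using Metric_space_Diff_metric' n infinity by simp
        have "mball f e \<subseteq> U"
          using n by auto
        then have "mball f e \<in> K"
          using n(1) infinity openin_mball[of f e] unfolding K_def by auto
        moreover have "f \<in> mball f e"
          using R f n by auto
        ultimately show "f \<in> \<Union> K"
          by blast
      qed
      then have "U = \<Union> K"
        unfolding K_def by blast
      moreover have "generate_topology_on ?B V" if "V \<in> K" for V
        using that unfolding K_def by (blast intro: generate_topology_on.Basis)
      ultimately show ?thesis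
        using generate_topology_on.UN by metis
    qed
    ultimately have "generate_topology_on ?B U \<longleftrightarrow> ?R U"
      by (rule iffI)
    moreover have "Diff_topology M k = topology_generated_by ?B"
      unfolding infinity by simp
    ultimately show ?thesis
      by (simp only: openin_topology_generated_by_iff)
  qed
qed


section \<open>Length functions generated by a weight\<close>

context group
begin

text \<open>A product decomposition \<open>h\<^sub>1 \<cdots> h\<^sub>r\<close> costs \<open>w h\<^sub>1 + \<dots> + w h\<^sub>r\<close>. The infimum of the costs is the
  largest subadditive function below \<open>w\<close>. The inductive definition provides induction over the
  decompositions, by which properties of the weights pass to the infimum.\<close>

inductive word_cost :: "('a \<Rightarrow> real) \<Rightarrow> 'a \<Rightarrow> real \<Rightarrow> bool" for w where
  word_cost_one: "word_cost w \<one> 0"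
| word_cost_mult: "h \<in> carrier G \<Longrightarrow> word_cost w g s \<Longrightarrow> word_cost w (h \<otimes> g) (w h + s)"

definition word_norm :: "('a \<Rightarrow> real) \<Rightarrow> 'a \<Rightarrow> real" where
  "word_norm w g = Inf {s. word_cost w g s}"

lemma word_cost_carrier: "word_cost w g s \<Longrightarrow> g \<in> carrier G"
  by (induction rule: word_cost.induct) auto

lemma word_cost_self: "h \<in> carrier G \<Longrightarrow> word_cost w h (w h)"
  using word_cost_mult[OF _ word_cost_one, of h w] by simp

lemma word_cost_append:
  "word_cost w g s \<Longrightarrow> word_cost w h t \<Longrightarrow> word_cost w (g \<otimes> h) (s + t)"
proof (induction rule: word_cost.induct)
  case word_cost_one
  then show ?case using word_cost_carrier by simp
next
  case (word_cost_mult a g s)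
  then show ?case
    using word_cost.word_cost_mult[of a w "g \<otimes> h" "s + t"] word_cost_carrier
    by (simp add: m_assoc add.assoc)
qed

lemma word_cost_inv:
  assumes "\<And>h. h \<in> carrier G \<Longrightarrow> w (inv h) = w h"
  shows "word_cost w g s \<Longrightarrow> word_cost w (inv g) s"
proof (induction rule: word_cost.induct)
  case word_cost_one
  then show ?case using word_cost.word_cost_one by simp
next
  case (word_cost_mult a g s)
  then show ?case
    using word_cost_append[OF word_cost_mult.IH word_cost_self[of "inv a" w]] assms word_cost_carrier
    by (simp add: inv_mult_group add.commute)
qed

context
  fixes w :: "'a \<Rightarrow> real"
  assumes w_nonneg: "\<And>h. h \<in> carrier G \<Longrightarrow> 0 \<le> w h"
begin

lemma word_cost_nonneg: "word_cost w g s \<Longrightarrow> 0 \<le> s"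
  by (induction rule: word_cost.induct) (auto intro: w_nonneg add_nonneg_nonneg)

lemma word_norm_le: "word_cost w g s \<Longrightarrow> word_norm w g \<le> s"
  unfolding word_norm_def using word_cost_nonneg by (intro cInf_lower bdd_belowI[where m = 0]) auto

lemma word_norm_nonneg: "g \<in> carrier G \<Longrightarrow> 0 \<le> word_norm w g"
  unfolding word_norm_def using word_cost_nonneg word_cost_self[of g w] by (intro cInf_greatest) auto

lemma word_norm_lessE:
  assumes "g \<in> carrier G" "word_norm w g < r"
  obtains s where "word_cost w g s" "s < r"
  using assms cInf_lessD[of "{s. word_cost w g s}" r] word_cost_self[of g w]
  unfolding word_norm_def by blast

lemma word_norm_mult:
  assumes "g \<in> carrier G" "h \<in> carrier G"
  shows "word_norm w (g \<otimes> h) \<le> word_norm w g + word_norm w h"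
proof (rule field_le_epsilon)
  fix e :: real assume "0 < e"
  then obtain s t where s: "word_cost w g s" "s < word_norm w g + e / 2"
    and t: "word_cost w h t" "t < word_norm w h + e / 2"
    using word_norm_lessE[OF assms(1), of "word_norm w g + e / 2"]
      word_norm_lessE[OF assms(2), of "word_norm w h + e / 2"] by (metis half_gt_zero less_add_same_cancel1)
  show "word_norm w (g \<otimes> h) \<le> word_norm w g + word_norm w h + e"
    using word_norm_le[OF word_cost_append[OF s(1) t(1)]] s t by linarith
qed

lemma word_norm_inv:
  assumes sym: "\<And>h. h \<in> carrier G \<Longrightarrow> w (inv h) = w h" and g: "g \<in> carrier G"
  shows "word_norm w (inv g) = word_norm w g"
proof -
  have "word_cost w (inv g) s \<longleftrightarrow> word_cost w g s" for s
    using word_cost_inv[of w, OF sym] inv_inv[OF g] by metis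
  then show ?thesis
    by (simp add: word_norm_def)
qed

lemma word_norm_one: "word_norm w \<one> = 0"
  using word_norm_le[OF word_cost_one] word_norm_nonneg[OF one_closed] by simp

text \<open>Outside the carrier the value is zero because the metric must be nonnegative on the whole
  type.\<close>

definition word_dist :: "'a \<Rightarrow> 'a \<Rightarrow> real" where
  "word_dist f g = (if f \<in> carrier G \<and> g \<in> carrier G then word_norm w (f \<otimes> inv g) else 0)"

lemma word_dist_right_invariant:
  assumes "f \<in> carrier G" "g \<in> carrier G" "h \<in> carrier G"
  shows "word_dist (f \<otimes> h) (g \<otimes> h) = word_dist f g"
proof -
  have "h \<otimes> (inv h \<otimes> inv g) = inv g"
    using assms by (simp add: m_assoc[symmetric])
  then have "(f \<otimes> h) \<otimes> inv (g \<otimes> h) = f \<otimes> inv g"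
    using assms by (simp add: inv_mult_group m_assoc)
  then show ?thesis
    using assms by (simp add: word_dist_def)
qed

lemma Metric_space_word_dist:
  assumes sym: "\<And>h. h \<in> carrier G \<Longrightarrow> w (inv h) = w h"
    and sep: "\<And>g. g \<in> carrier G \<Longrightarrow> word_norm w g = 0 \<Longrightarrow> g = \<one>"
  shows "Metric_space (carrier G) word_dist"
proof
  show "0 \<le> word_dist f g" for f g
    using word_norm_nonneg by (simp add: word_dist_def)
  show "word_dist f g = word_dist g f" for f g
    using word_norm_inv[OF sym, of "f \<otimes> inv g"] by (auto simp: word_dist_def inv_mult_group)
next
  fix f g assume fg: "f \<in> carrier G" "g \<in> carrier G"
  show "word_dist f g = 0 \<longleftrightarrow> f = g"
    using fg sep[of "f \<otimes> inv g"] word_norm_one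
    by (auto simp: word_dist_def) (metis inv_closed inv_inv inv_equality)
  fix h assume h: "h \<in> carrier G"
  have "inv g \<otimes> (g \<otimes> inv h) = inv h"
    using fg h by (simp add: m_assoc[symmetric])
  then have "(f \<otimes> inv g) \<otimes> (g \<otimes> inv h) = f \<otimes> inv h"
    using fg h by (simp add: m_assoc)
  then show "word_dist f h \<le> word_dist f g + word_dist g h"
    using word_norm_mult[of "f \<otimes> inv g" "g \<otimes> inv h"] fg h by (simp add: word_dist_def)
qed

end

end


section \<open>Estimates for products and inverses of diffeomorphisms\<close>

definition mult_bound :: "nat \<Rightarrow> real \<Rightarrow> real" where
  "mult_bound n b = 1 + real (Suc n) * (2 ^ n * (compose_bound n b * b))"

lemma mult_bound_ge_1: "0 \<le> b \<Longrightarrow> 1 \<le> mult_bound n b"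
  unfolding mult_bound_def using compose_bound_ge_1[of b n] by simp

locale diffeo_group =
  fixes M :: one_manifold and k :: enat
  assumes one_le_k: "1 \<le> k"
begin

sublocale group "Diff_group M k"
  by (rule group_Diff_group[OF one_le_k])

abbreviation G where "G \<equiv> Diff_group M k"

abbreviation D where "D f \<equiv> mfd_deriv M (Suc 0) f"

lemma carrier_G: "carrier G = Diff_plus M k"
  by (simp add: Diff_group_def)

lemma in_Diff_plus: "f \<in> carrier G \<Longrightarrow> enat n \<le> k \<Longrightarrow> f \<in> Diff_plus M (enat n)"
  using Diff_plus_antimono carrier_G by blast

lemma the_lift_mem: "f \<in> carrier G \<Longrightarrow> x \<in> lift_dom M \<Longrightarrow> the_lift M f x \<in> lift_dom M"
  using Diff_plus_lift[OF _ one_le_k] diffeo_lift_mem carrier_G by blast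

lemma the_lift_deriv:
  "f \<in> carrier G \<Longrightarrow> x \<in> lift_dom M \<Longrightarrow> (the_lift M f has_real_derivative D f x) (at x within lift_dom M)"
  using Diff_plus_lift[OF _ one_le_k] diffeo_lift_deriv carrier_G by blast

lemma D_pos: "f \<in> carrier G \<Longrightarrow> x \<in> lift_dom M \<Longrightarrow> 0 < D f x"
  using Diff_plus_lift[OF _ one_le_k] diffeo_lift_deriv_pos carrier_G by blast

lemma D_lower:
  assumes "f \<in> carrier G"
  obtains m where "0 < m" "\<And>x. x \<in> lift_dom M \<Longrightarrow> m \<le> D f x"
  using Diff_plus_lift[OF _ one_le_k] diffeo_lift_deriv_lower[OF _ one_le_k] carrier_G assms by metis

lemma D_bounded:
  assumes "f \<in> carrier G" "enat (Suc n) \<le> k"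
  obtains b where "0 \<le> b" "C_bounded_on (lift_dom M) n b (D f)"
  using mfd_deriv_C_bounded[OF _ one_le_k] carrier_G assms by metis

lemma D_mult:
  assumes "f \<in> carrier G" "g \<in> carrier G" "x \<in> lift_dom M"
  shows "D (f \<otimes>\<^bsub>G\<^esub> g) x = D f (the_lift M g x) * D g x"
  using assms Diff_plus_compose(2)[OF _ _ one_le_k] by (simp add: Diff_group_def)

lemma D_one: "x \<in> lift_dom M \<Longrightarrow> D \<one>\<^bsub>G\<^esub> x = 1"
  using mfd_deriv_descend[OF diffeo_lift_id] by (simp add: Diff_group_def identity_eq_descend)

lemma D_inv:
  assumes "f \<in> carrier G" "x \<in> lift_dom M"
  shows "D (inv\<^bsub>G\<^esub> f) x = 1 / D f (the_lift M (inv\<^bsub>G\<^esub> f) x)"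
proof -
  have "D f (the_lift M (inv\<^bsub>G\<^esub> f) x) * D (inv\<^bsub>G\<^esub> f) x = 1"
    using D_mult[of f "inv\<^bsub>G\<^esub> f" x] assms D_one by simp
  then show ?thesis
    using D_pos[OF assms(1) the_lift_mem[OF inv_closed[OF assms(1)] assms(2)]]
    by (simp add: nonzero_eq_divide_eq mult.commute)
qed

lemma C_bounded_on_D_inv:
  assumes f: "f \<in> carrier G" and C: "C_bounded_on (lift_dom M) n b (D f)"
    and m: "0 < m" "0 \<le> b" "\<And>x. x \<in> lift_dom M \<Longrightarrow> m \<le> D f x"
  shows "C_bounded_on (lift_dom M) n (inverse_bound n m b) (D (inv\<^bsub>G\<^esub> f))"
proof -
  have "C_bounded_on (lift_dom M) n (inverse_bound n m b) (\<lambda>y. 1 / D f (the_lift M (inv\<^bsub>G\<^esub> f) y))"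
    using the_lift_mem[OF inv_closed[OF f]] the_lift_deriv[OF inv_closed[OF f]] D_inv[OF f]
    by (intro lift_dom.C_bounded_on_inverse[OF C m]) auto
  then show ?thesis
    by (rule C_bounded_on_transform) (rule D_inv[OF f])
qed

text \<open>The derivative of \<open>f h\<close> minus that of \<open>g h\<close> is \<open>((f' - g') \<circ> H) \<cdot> h'\<close> for the lift \<open>H\<close> of \<open>h\<close>, and
  uniform distances do not change under right multiplication.\<close>

lemma Diff_metric_right_mult:
  assumes fgh: "f \<in> carrier G" "g \<in> carrier G" "h \<in> carrier G" and n: "enat (Suc n) \<le> k"
    and h: "C_bounded_on (lift_dom M) n b (D h)" "0 \<le> b"
  shows "Diff_metric M (Suc n) (f \<otimes>\<^bsub>G\<^esub> h) (g \<otimes>\<^bsub>G\<^esub> h) \<le> mult_bound n b * Diff_metric M (Suc n) f g"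
proof -
  let ?S = "lift_dom M" and ?r = "Diff_metric M (Suc n) f g"
  have r: "0 \<le> ?r"
    by (rule Diff_metric_nonneg) simp
  have c: "0 \<le> ?r * compose_bound n b"
    using r compose_bound_ge_1[OF h(2), of n] by simp
  have "C_bounded_on ?S n (?r * compose_bound n b) (\<lambda>x. D f (the_lift M h x) - D g (the_lift M h x))"
    using mfd_deriv_diff_C_bounded[of f M n g] in_Diff_plus[OF _ n] fgh h r C_bounded_on_mono[OF h(1)]
      the_lift_mem the_lift_deriv
    by (intro lift_dom.C_bounded_on_compose[where G' = "D h" and u = "\<lambda>x. D f x - D g x"]) auto
  from lift_dom.C_bounded_on_mult[OF this h(1) c h(2)]
  have "C_bounded_on ?S n (2 ^ n * (?r * compose_bound n b * b))
      (\<lambda>x. D (f \<otimes>\<^bsub>G\<^esub> h) x - D (g \<otimes>\<^bsub>G\<^esub> h) x)"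
    by (rule C_bounded_on_transform) (use D_mult fgh in \<open>simp add: algebra_simps\<close>)
  then have "Diff_metric M (Suc n) (f \<otimes>\<^bsub>G\<^esub> h) (g \<otimes>\<^bsub>G\<^esub> h) \<le>
      ?r + real (Suc n) * (2 ^ n * (?r * compose_bound n b * b))"
  proof (rule Diff_metric_leI[rotated -1])
    fix x assume x: "x \<in> points M"
    then have "(f \<otimes>\<^bsub>G\<^esub> h) x = f (h x)" "(g \<otimes>\<^bsub>G\<^esub> h) x = g (h x)"
      by (simp_all add: Diff_group_def compose_def)
    then show "mfd_dist M ((f \<otimes>\<^bsub>G\<^esub> h) x) ((g \<otimes>\<^bsub>G\<^esub> h) x) \<le> ?r"
      using mfd_dist_le_Diff_metric[of f M "Suc n" g "h x"] in_Diff_plus[OF _ n] fgh x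
        Diff_plus_mem[of h M k x] one_le_k carrier_G by auto
  qed (use in_Diff_plus[OF _ n] fgh in auto)
  then show ?thesis
    by (simp add: mult_bound_def algebra_simps)
qed

text \<open>The size of \<open>h\<close>, made symmetric under inversion.\<close>

definition deviation :: "nat \<Rightarrow> (real \<Rightarrow> real) \<Rightarrow> real" where
  "deviation n h = Diff_metric M n h \<one>\<^bsub>G\<^esub> + Diff_metric M n (inv\<^bsub>G\<^esub> h) \<one>\<^bsub>G\<^esub>"

lemma deviation_nonneg: "1 \<le> n \<Longrightarrow> 0 \<le> deviation n h"
  unfolding deviation_def by (intro add_nonneg_nonneg Diff_metric_nonneg)

lemma deviation_inv: "h \<in> carrier G \<Longrightarrow> deviation n (inv\<^bsub>G\<^esub> h) = deviation n h"
  by (simp add: deviation_def)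

lemma deviation_mono:
  assumes "h \<in> carrier G" "enat n \<le> k" "m \<le> n"
  shows "deviation m h \<le> deviation n h"
  unfolding deviation_def using assms in_Diff_plus[OF _ assms(2)]
  by (intro add_mono Diff_metric_mono) auto

text \<open>The elements \<open>f g\<^sup>-\<^sup>1\<close> and \<open>1\<close> arise from \<open>f\<close> and \<open>g\<close> by right multiplication with \<open>g\<^sup>-\<^sup>1\<close>, which
  is Lipschitz with a constant that depends on the derivatives of \<open>g\<^sup>-\<^sup>1\<close>. These are uniformly bounded
  for \<open>g\<close> near \<open>f\<close>. The radius \<open>m / 2\<close> keeps \<open>g'\<close> above \<open>m / 2\<close>.\<close>

lemma deviation_quotient_le:
  assumes f: "f \<in> carrier G" and n: "enat (Suc n) \<le> k"
  obtains C r where "0 < r" "0 < C" "\<And>g. g \<in> carrier G \<Longrightarrow> Diff_metric M (Suc n) f g < r \<Longrightarrow>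
    deviation (Suc n) (f \<otimes>\<^bsub>G\<^esub> inv\<^bsub>G\<^esub> g) \<le> C * Diff_metric M (Suc n) f g"
proof -
  let ?S = "lift_dom M" and ?\<rho> = "Diff_metric M (Suc n)"
  obtain b where b: "0 \<le> b" "C_bounded_on ?S n b (D f)"
    using D_bounded[OF f n] .
  obtain m where m: "0 < m" "\<And>x. x \<in> ?S \<Longrightarrow> m \<le> D f x"
    using D_lower[OF f] by metis
  define K where "K = mult_bound n (inverse_bound n (m / 2) (b + m / 2))"
  have K: "1 \<le> K"
    unfolding K_def using m b by (intro mult_bound_ge_1 inverse_bound_nonneg) auto
  have *: "?\<rho> (u \<otimes>\<^bsub>G\<^esub> inv\<^bsub>G\<^esub> g) \<one>\<^bsub>G\<^esub> \<le> K * ?\<rho> u g"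
    if g: "g \<in> carrier G" and u: "u \<in> carrier G" and lt: "?\<rho> g f < m / 2" for g u
  proof -
    have gf: "C_bounded_on ?S n (?\<rho> g f) (\<lambda>x. D g x - D f x)"
      using mfd_deriv_diff_C_bounded in_Diff_plus[OF _ n] f g by blast
    have "C_bounded_on ?S n (b + m / 2) (D g)"
      using lift_dom.C_bounded_on_add[OF b(2) gf] lt
      by (auto intro: C_bounded_on_mono)
    moreover have "m / 2 \<le> D g x" if "x \<in> ?S" for x
      using m(2)[OF that] C_bounded_on_abs_le[OF gf that] lt by linarith
    ultimately have "C_bounded_on ?S n (inverse_bound n (m / 2) (b + m / 2)) (D (inv\<^bsub>G\<^esub> g))"
      using m b g by (intro C_bounded_on_D_inv) auto
    then have "?\<rho> (u \<otimes>\<^bsub>G\<^esub> inv\<^bsub>G\<^esub> g) (g \<otimes>\<^bsub>G\<^esub> inv\<^bsub>G\<^esub> g) \<le> K * ?\<rho> u g"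
      unfolding K_def using m b g u n by (intro Diff_metric_right_mult inverse_bound_nonneg) auto
    then show ?thesis
      using g by simp
  qed
  interpret Metric_space "carrier G" "?\<rho>"
    using Metric_space_Diff_metric' n carrier_G by simp
  have "deviation (Suc n) (f \<otimes>\<^bsub>G\<^esub> inv\<^bsub>G\<^esub> g) \<le> (2 * K) * ?\<rho> f g"
    if g: "g \<in> carrier G" and lt: "?\<rho> f g < m / 2" for g
    unfolding deviation_def using *[OF g f] *[OF f g] lt commute[of f g] m f g
    by (simp add: inv_mult_group)
  then show ?thesis
    using that[of "m / 2" "2 * K"] m K by simp
qed

end


section \<open>Bounded derivatives imply relative property (OB)\<close>

context diffeo_group
begin

text \<open>The straight path of lifts from the identity to \<open>f\<close>. It consists of diffeomorphisms because a
  convex combination of the derivatives \<open>1\<close> and \<open>f'\<close> is positive.\<close>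

definition interpolation :: "(real \<Rightarrow> real) \<Rightarrow> real \<Rightarrow> real \<Rightarrow> real" where
  "interpolation f t = descend M (\<lambda>x. (1 - t) * x + t * the_lift M f x)"

lemma diffeo_lift_interpolation:
  assumes f: "f \<in> carrier G" and t: "0 \<le> t" "t \<le> 1"
  shows "diffeo_lift M k (\<lambda>x. (1 - t) * x + t * the_lift M f x) (\<lambda>x. (1 - t) + t * D f x)"
proof -
  have F: "diffeo_lift M k (the_lift M f) (D f)"
    using Diff_plus_lift[OF _ one_le_k] f carrier_G by blast
  have "normalized_lift M (\<lambda>x. (1 - t) * x + t * the_lift M f x)"
  proof (cases M)
    case Interval
    then show ?thesis using diffeo_lift_normalized[OF F] by simp
  next
    case Circle
    then have "0 \<le> the_lift M f 0" "the_lift M f 0 < 1"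
      using diffeo_lift_normalized[OF F] by auto
    then have "0 \<le> t * the_lift M f 0" "t * the_lift M f 0 < 1"
      using t mult_left_le_one_le[of "the_lift M f 0" t] by simp_all
    then show ?thesis
      using Circle diffeo_lift_normalized[OF F] by (auto simp: algebra_simps)
  qed
  moreover have "((\<lambda>x. (1 - t) * x + t * the_lift M f x) has_real_derivative (1 - t) + t * D f x)
      (at x within lift_dom M) \<and> 0 < (1 - t) + t * D f x" if x: "x \<in> lift_dom M" for x
  proof
    show "((\<lambda>x. (1 - t) * x + t * the_lift M f x) has_real_derivative (1 - t) + t * D f x)
      (at x within lift_dom M)"
      using the_lift_deriv[OF f x] by (auto intro!: derivative_eq_intros)
    show "0 < (1 - t) + t * D f x"
      using D_pos[OF f x] t by (cases "t = 1") (auto intro: add_pos_nonneg)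
  qed
  moreover have "\<exists>b. C_bounded_on (lift_dom M) n b (\<lambda>x. (1 - t) + t * D f x)" if n: "enat (Suc n) \<le> k" for n
    using lift_dom.C_bounded_on_add[OF lift_dom.C_bounded_on_const[OF order_refl] lift_dom.C_bounded_on_cmult]
      D_bounded[OF f n] by metis
  ultimately show ?thesis
    unfolding diffeo_lift_def by blast
qed

lemma interpolation_carrier:
  "f \<in> carrier G \<Longrightarrow> 0 \<le> t \<Longrightarrow> t \<le> 1 \<Longrightarrow> interpolation f t \<in> carrier G"
  unfolding carrier_G interpolation_def
  using descend_in_Diff_plus[OF diffeo_lift_interpolation one_le_k] carrier_G by blast

lemma D_interpolation:
  "f \<in> carrier G \<Longrightarrow> 0 \<le> t \<Longrightarrow> t \<le> 1 \<Longrightarrow> x \<in> lift_dom M \<Longrightarrow> D (interpolation f t) x = (1 - t) + t * D f x"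
  unfolding interpolation_def using mfd_deriv_descend[OF diffeo_lift_interpolation] by blast

lemma interpolation_0: "interpolation f 0 = \<one>\<^bsub>G\<^esub>"
  by (simp add: interpolation_def Diff_group_def identity_eq_descend)

lemma interpolation_1: "f \<in> carrier G \<Longrightarrow> interpolation f 1 = f"
  using Diff_plus_lift(2)[OF _ one_le_k] carrier_G by (simp add: interpolation_def)

lemma the_lift_displacement:
  assumes f: "f \<in> carrier G" and x: "x \<in> points M"
  shows "\<bar>the_lift M f x - x\<bar> \<le> 2"
proof -
  have F: "diffeo_lift M k (the_lift M f) (D f)"
    using Diff_plus_lift[OF _ one_le_k] f carrier_G by blast
  have xS: "x \<in> lift_dom M" "0 \<in> lift_dom M" "1 \<in> lift_dom M"
    using x points_subset_lift_dom unit_subset_lift_dom[of M] by auto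
  have x01: "0 \<le> x" "x \<le> 1"
    using x points_subset_unit[of M] by auto
  have "the_lift M f 0 \<le> the_lift M f x" "the_lift M f x \<le> the_lift M f 1"
    using strict_mono_on_leD[OF diffeo_lift_strict_mono[OF F]] xS x01 by blast+
  moreover have "0 \<le> the_lift M f 0" "the_lift M f 1 \<le> 2"
  proof -
    show "0 \<le> the_lift M f 0"
      using diffeo_lift_normalized[OF F] by (cases M) auto
    show "the_lift M f 1 \<le> 2"
    proof (cases M)
      case Circle
      have "the_lift M f (0 + 1) = the_lift M f 0 + 1"
        using Circle by (intro normalized_lift_translation[OF diffeo_lift_normalized[OF F]]) (simp add: translation_def)
      moreover have "the_lift M f 0 < 1"
        using diffeo_lift_normalized[OF F] Circle by simp
      ultimately show ?thesis by simp
    qed (use diffeo_lift_normalized[OF F] in auto)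
  qed
  ultimately show ?thesis
    using x01 by linarith
qed

lemma Diff_metric_interpolation_le:
  assumes f: "f \<in> carrier G" and n: "enat (Suc n) \<le> k" and b: "C_bounded_on (lift_dom M) n b (D f)" "0 \<le> b"
    and s: "0 \<le> s" "s \<le> 1" and t: "0 \<le> t" "t \<le> 1"
  shows "Diff_metric M (Suc n) (interpolation f s) (interpolation f t) \<le>
    (4 * pi + real (Suc n) * (b + 1)) * \<bar>s - t\<bar>"
proof -
  let ?S = "lift_dom M"
  have "C_bounded_on ?S n (b + 1) (\<lambda>x. D f x - 1)"
    using lift_dom.C_bounded_on_diff[OF b(1) lift_dom.C_bounded_on_const[of 1 1]] by simp
  from lift_dom.C_bounded_on_cmult[OF this, of "s - t"]
  have C: "C_bounded_on ?S n (\<bar>s - t\<bar> * (b + 1)) (\<lambda>x. D (interpolation f s) x - D (interpolation f t) x)"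
    by (rule C_bounded_on_transform) (simp add: D_interpolation[OF f s] D_interpolation[OF f t] algebra_simps)
  have "mfd_dist M (interpolation f s x) (interpolation f t x) \<le> 4 * pi * \<bar>s - t\<bar>" if x: "x \<in> points M" for x
  proof -
    let ?F = "\<lambda>t. (1 - t) * x + t * the_lift M f x"
    have "mfd_dist M (interpolation f s x) (interpolation f t x) = mfd_dist M (?F s) (?F t)"
      using x by (simp add: interpolation_def descend_def mfd_dist_proj)
    also have "\<dots> \<le> 2 * pi * \<bar>?F s - ?F t\<bar>"
      by (rule mfd_dist_le)
    also have "?F s - ?F t = (s - t) * (the_lift M f x - x)"
      by (simp add: algebra_simps)
    also have "2 * pi * \<bar>(s - t) * (the_lift M f x - x)\<bar> \<le> 2 * pi * (\<bar>s - t\<bar> * 2)"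
      unfolding abs_mult using the_lift_displacement[OF f x] by (intro mult_left_mono) auto
    finally show ?thesis
      by (simp add: algebra_simps)
  qed
  from Diff_metric_leI[OF _ _ this C]
  have "Diff_metric M (Suc n) (interpolation f s) (interpolation f t) \<le>
      4 * pi * \<bar>s - t\<bar> + real (Suc n) * (\<bar>s - t\<bar> * (b + 1))"
    using in_Diff_plus[OF interpolation_carrier[OF f] n] s t by blast
  then show ?thesis
    by (simp add: algebra_simps)
qed

text \<open>On the path, the derivatives are at least \<open>min 1 m\<close> and are bounded by \<open>1 + b\<close> together with their
  derivatives, so that the inverses have bounded derivatives uniformly in \<open>f\<close> and \<open>t\<close>.\<close>

lemma interpolation_step_le:
  assumes n: "enat (Suc n) \<le> k" and b: "0 \<le> b" and m: "0 < m"
  obtains L where "0 < L" "\<And>f s t. f \<in> carrier G \<Longrightarrow> C_bounded_on (lift_dom M) n b (D f) \<Longrightarrow>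
      (\<And>x. x \<in> lift_dom M \<Longrightarrow> m \<le> D f x) \<Longrightarrow> 0 \<le> s \<Longrightarrow> s \<le> 1 \<Longrightarrow> 0 \<le> t \<Longrightarrow> t \<le> 1 \<Longrightarrow>
      Diff_metric M (Suc n) (interpolation f s \<otimes>\<^bsub>G\<^esub> inv\<^bsub>G\<^esub> interpolation f t) \<one>\<^bsub>G\<^esub> \<le> L * \<bar>s - t\<bar>"
proof -
  let ?S = "lift_dom M"
  define I where "I = inverse_bound n (min 1 m) (1 + b)"
  define L where "L = mult_bound n I * (4 * pi + real (Suc n) * (b + 1))"
  have I: "0 \<le> I"
    unfolding I_def using m b by (intro inverse_bound_nonneg) auto
  have "0 < L"
    unfolding L_def using b mult_bound_ge_1[OF I, of n] by (intro mult_pos_pos add_pos_nonneg) auto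
  moreover have "Diff_metric M (Suc n) (interpolation f s \<otimes>\<^bsub>G\<^esub> inv\<^bsub>G\<^esub> interpolation f t) \<one>\<^bsub>G\<^esub> \<le> L * \<bar>s - t\<bar>"
    if f: "f \<in> carrier G" and C: "C_bounded_on ?S n b (D f)" and lb: "\<And>x. x \<in> ?S \<Longrightarrow> m \<le> D f x"
      and s: "0 \<le> s" "s \<le> 1" and t: "0 \<le> t" "t \<le> 1" for f s t
  proof -
    let ?s = "interpolation f s" and ?t = "interpolation f t"
    note st = interpolation_carrier[OF f s] interpolation_carrier[OF f t]
    have "C_bounded_on ?S n (\<bar>1 - t\<bar> + \<bar>t\<bar> * b) (\<lambda>x. (1 - t) + t * D f x)"
      by (intro lift_dom.C_bounded_on_add lift_dom.C_bounded_on_const lift_dom.C_bounded_on_cmult C order_refl)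
    then have "C_bounded_on ?S n (1 + b) (\<lambda>x. (1 - t) + t * D f x)"
      by (rule C_bounded_on_mono) (use t b mult_left_le_one_le[of b t] in auto)
    then have Ct: "C_bounded_on ?S n (1 + b) (D ?t)"
      by (rule C_bounded_on_transform) (rule D_interpolation[OF f t])
    have lbt: "min 1 m \<le> D ?t x" if x: "x \<in> ?S" for x
    proof -
      have "min 1 m = (1 - t) * min 1 m + t * min 1 m"
        by (simp add: algebra_simps)
      also have "\<dots> \<le> (1 - t) * 1 + t * D f x"
        using t lb[OF x] by (intro add_mono mult_left_mono) auto
      finally show ?thesis
        by (simp add: D_interpolation[OF f t x])
    qed
    have "C_bounded_on ?S n I (D (inv\<^bsub>G\<^esub> ?t))"
      unfolding I_def using m b lbt by (intro C_bounded_on_D_inv[OF st(2) Ct]) auto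
    then have "Diff_metric M (Suc n) (?s \<otimes>\<^bsub>G\<^esub> inv\<^bsub>G\<^esub> ?t) (?t \<otimes>\<^bsub>G\<^esub> inv\<^bsub>G\<^esub> ?t) \<le>
        mult_bound n I * Diff_metric M (Suc n) ?s ?t"
      using st n I by (intro Diff_metric_right_mult) auto
    also have "\<dots> \<le> mult_bound n I * ((4 * pi + real (Suc n) * (b + 1)) * \<bar>s - t\<bar>)"
      using Diff_metric_interpolation_le[OF f n C b s t] mult_bound_ge_1[OF I, of n]
      by (intro mult_left_mono) auto
    finally show ?thesis
      using st by (simp add: L_def mult.assoc)
  qed
  ultimately show ?thesis
    using that by blast
qed

text \<open>A compatible metric \<open>d\<close> is less than one on a \<open>C\<^sup>n\<close> neighbourhood of the identity. If the path
  from the identity to \<open>f\<close> is divided into \<open>N\<close> equal parts, with \<open>N\<close> independent of \<open>f\<close>, then all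
  quotients of successive points lie in this neighbourhood, and by right invariance the steps are
  shorter than one.\<close>

lemma OB_if_bounded:
  assumes A: "A \<subseteq> carrier G" and m: "0 < m"
    and lb: "\<And>f x. f \<in> A \<Longrightarrow> x \<in> lift_dom M \<Longrightarrow> m \<le> D f x"
    and bd: "\<And>n. enat (Suc n) \<le> k \<Longrightarrow> \<exists>b\<ge>0. \<forall>f\<in>A. C_bounded_on (lift_dom M) n b (D f)"
  shows "property_OB_in G (Diff_topology M k) A"
  unfolding property_OB_in_def
proof (intro allI impI)
  fix d
  assume d: "Metric_space (carrier G) d \<and> Metric_space.mtopology (carrier G) d = Diff_topology M k \<and>
    (\<forall>x\<in>carrier G. \<forall>y\<in>carrier G. \<forall>g\<in>carrier G. d (x \<otimes>\<^bsub>G\<^esub> g) (y \<otimes>\<^bsub>G\<^esub> g) = d x y)"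
  interpret Metric_space "carrier G" d
    using d by blast
  have "openin (Diff_topology M k) (mball \<one>\<^bsub>G\<^esub> 1)"
    using d openin_mball by metis
  moreover have "\<one>\<^bsub>G\<^esub> \<in> mball \<one>\<^bsub>G\<^esub> 1"
    by simp
  ultimately have "\<exists>n\<ge>1. enat n \<le> k \<and> (\<exists>e>0. \<forall>g\<in>Diff_plus M k.
      Diff_metric M n \<one>\<^bsub>G\<^esub> g < e \<longrightarrow> g \<in> mball \<one>\<^bsub>G\<^esub> 1)"
    unfolding openin_Diff_topology[OF one_le_k] by blast
  then obtain n e where ne: "1 \<le> n" "enat n \<le> k" "0 < e"
    and ball: "\<And>g. g \<in> Diff_plus M k \<Longrightarrow> Diff_metric M n \<one>\<^bsub>G\<^esub> g < e \<Longrightarrow> g \<in> mball \<one>\<^bsub>G\<^esub> 1"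
    by blast
  obtain i where i: "n = Suc i"
    using ne by (cases n) auto
  obtain b where b: "0 \<le> b" "\<And>f. f \<in> A \<Longrightarrow> C_bounded_on (lift_dom M) i b (D f)"
    using bd ne i by metis
  obtain L where L: "0 < L" "\<And>f s t. f \<in> A \<Longrightarrow> 0 \<le> s \<Longrightarrow> s \<le> 1 \<Longrightarrow> 0 \<le> t \<Longrightarrow> t \<le> 1 \<Longrightarrow>
      Diff_metric M n (interpolation f s \<otimes>\<^bsub>G\<^esub> inv\<^bsub>G\<^esub> interpolation f t) \<one>\<^bsub>G\<^esub> \<le> L * \<bar>s - t\<bar>"
    using interpolation_step_le[of i b m] ne i b m lb A by (metis subsetD)
  obtain N where N: "0 < N" "L * (1 / real N) < e"
  proof -
    obtain N where "L / e < real N"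
      using reals_Archimedean2 by blast
    moreover from this have "0 < N"
      using L(1) ne(3) by (cases N) (auto simp: divide_less_0_iff)
    ultimately show ?thesis
      using that[of N] ne(3) by (simp add: field_simps)
  qed
  have step: "d (interpolation f t) (interpolation f s) < 1"
    if f: "f \<in> A" and s: "0 \<le> s" "s \<le> 1" and t: "0 \<le> t" "t \<le> 1" and st: "\<bar>s - t\<bar> \<le> 1 / real N" for f s t
  proof -
    let ?s = "interpolation f s" and ?t = "interpolation f t"
    have c: "?s \<in> carrier G" "?t \<in> carrier G"
      using interpolation_carrier s t f A by blast+
    have "L * \<bar>s - t\<bar> \<le> L * (1 / real N)"
      using st L(1) by (intro mult_left_mono) auto
    then have "Diff_metric M n (?s \<otimes>\<^bsub>G\<^esub> inv\<^bsub>G\<^esub> ?t) \<one>\<^bsub>G\<^esub> < e"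
      using L(2)[OF f s t] N(2) by linarith
    then have lt: "Diff_metric M n \<one>\<^bsub>G\<^esub> (?s \<otimes>\<^bsub>G\<^esub> inv\<^bsub>G\<^esub> ?t) < e"
      using Metric_space.commute[OF Metric_space_Diff_metric[OF ne(1)]] by metis
    have "?s \<otimes>\<^bsub>G\<^esub> inv\<^bsub>G\<^esub> ?t \<in> carrier G"
      using c by simp
    then have "?s \<otimes>\<^bsub>G\<^esub> inv\<^bsub>G\<^esub> ?t \<in> mball \<one>\<^bsub>G\<^esub> 1"
      using ball[OF _ lt] carrier_G by blast
    then have "d (?t \<otimes>\<^bsub>G\<^esub> inv\<^bsub>G\<^esub> ?t) (?s \<otimes>\<^bsub>G\<^esub> inv\<^bsub>G\<^esub> ?t) < 1"
      using c by simp
    then show ?thesis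
      using d c by (metis inv_closed)
  qed
  have "d \<one>\<^bsub>G\<^esub> f \<le> real N" if f: "f \<in> A" for f
  proof -
    have fG: "f \<in> carrier G"
      using f A by blast
    have "d \<one>\<^bsub>G\<^esub> (interpolation f (real j / real N)) \<le> real j" if "j \<le> N" for j
      using that
    proof (induction j)
      case 0
      then show ?case by (simp add: interpolation_0)
    next
      case (Suc j)
      let ?s = "real (Suc j) / real N" and ?t = "real j / real N"
      have st: "0 \<le> ?s" "?s \<le> 1" "0 \<le> ?t" "?t \<le> 1" "\<bar>?s - ?t\<bar> \<le> 1 / real N"
        using Suc.prems N(1) by (auto simp: field_simps)
      have "d \<one>\<^bsub>G\<^esub> (interpolation f ?s) \<le> d \<one>\<^bsub>G\<^esub> (interpolation f ?t) + d (interpolation f ?t) (interpolation f ?s)"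
        using st interpolation_carrier[OF fG] by (intro triangle) auto
      then show ?case
        using Suc step[OF f st] by simp
    qed
    from this[of N] show ?thesis
      using N(1) interpolation_1[OF fG] by simp
  qed
  moreover have "d x y \<le> d \<one>\<^bsub>G\<^esub> x + d \<one>\<^bsub>G\<^esub> y" if "x \<in> A" "y \<in> A" for x y
    using triangle[of x "\<one>\<^bsub>G\<^esub>" y] commute[of x "\<one>\<^bsub>G\<^esub>"] subsetD[OF A] that by simp
  ultimately have "d x y \<le> real N + real N" if "x \<in> A" "y \<in> A" for x y
    using that by (meson add_mono order_trans)
  then show "\<exists>B. \<forall>x\<in>A. \<forall>y\<in>A. d x y \<le> B"
    by blast
qed

end


section \<open>A right-invariant metric that controls the derivatives\<close>

context diffeo_group
begin

text \<open>Since \<open>ln y \<le> y - 1\<close>, the distance of \<open>h\<close> to the identity bounds \<open>ln h'\<close> from above. The bound from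
  below comes from \<open>h\<^sup>-\<^sup>1\<close>, whose derivative is the reciprocal.\<close>

lemma abs_ln_D_le:
  assumes h: "h \<in> carrier G" and x: "x \<in> lift_dom M" and n: "enat (Suc n) \<le> k"
  shows "\<bar>ln (D h x)\<bar> \<le> deviation (Suc n) h"
proof -
  have D_le: "D u y \<le> 1 + Diff_metric M (Suc n) u \<one>\<^bsub>G\<^esub>" if "u \<in> carrier G" "y \<in> lift_dom M" for u y
    using mfd_deriv_le_Diff_metric[of u M "Suc n" "\<one>\<^bsub>G\<^esub>" 0 y] in_Diff_plus[OF _ n] that D_one by fastforce
  have ln_le: "ln (D u y) \<le> Diff_metric M (Suc n) u \<one>\<^bsub>G\<^esub>" if "u \<in> carrier G" "y \<in> lift_dom M" for u y
    using D_le[OF that] D_pos[OF that] ln_le_minus_one[of "D u y"] by linarith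
  have "D (inv\<^bsub>G\<^esub> h) (the_lift M h x) * D h x = 1"
    using D_mult[of "inv\<^bsub>G\<^esub> h" h x] h x D_one by simp
  then have "ln (D (inv\<^bsub>G\<^esub> h) (the_lift M h x)) = - ln (D h x)"
    using D_pos[OF h x] by (simp add: nonzero_eq_divide_eq[symmetric] ln_div)
  then show ?thesis
    using ln_le[OF h x] ln_le[OF inv_closed[OF h] the_lift_mem[OF h x]]
      Diff_metric_nonneg[of "Suc n" M h "\<one>\<^bsub>G\<^esub>"] Diff_metric_nonneg[of "Suc n" M "inv\<^bsub>G\<^esub> h" "\<one>\<^bsub>G\<^esub>"]
    unfolding deviation_def by simp
qed

text \<open>Only factors of weight at most \<open>r\<close> occur in decompositions of cost at most \<open>r\<close>, so that it suffices
  to compare the weight with the size of such elements. The case of small \<open>r\<close> describes the topology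
  of the metric, the case of large \<open>r\<close> its bounded sets.\<close>

context
  fixes w :: "(real \<Rightarrow> real) \<Rightarrow> real" and n :: nat and c :: real and r :: real
  assumes w_nonneg: "\<And>h. h \<in> carrier G \<Longrightarrow> 0 \<le> w h"
    and n: "enat (Suc n) \<le> k"
    and c: "0 \<le> c"
    and deviation_le: "\<And>h. h \<in> carrier G \<Longrightarrow> w h \<le> r \<Longrightarrow> deviation (Suc n) h \<le> c * w h"
begin

lemma word_cost_abs_ln_D:
  "word_cost w h s \<Longrightarrow> s \<le> r \<Longrightarrow> x \<in> lift_dom M \<Longrightarrow> \<bar>ln (D h x)\<bar> \<le> c * s"
proof (induction arbitrary: x rule: word_cost.induct)
  case word_cost_one
  then show ?case by (simp add: D_one)
next
  case (word_cost_mult h g s)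
  note g = word_cost_carrier[OF word_cost_mult.hyps(2)] and h = word_cost_mult.hyps(1)
  have le: "w h \<le> r" "s \<le> r"
    using word_cost_mult.prems w_nonneg[OF h] word_cost_nonneg[OF w_nonneg word_cost_mult.hyps(2)] by auto
  let ?y = "the_lift M g x"
  have y: "?y \<in> lift_dom M"
    using the_lift_mem[OF g] word_cost_mult.prems by blast
  have "ln (D (h \<otimes>\<^bsub>G\<^esub> g) x) = ln (D h ?y) + ln (D g x)"
    using D_mult[OF h g word_cost_mult.prems(2)] D_pos[OF h y] D_pos[OF g word_cost_mult.prems(2)]
    by (simp add: ln_mult_pos)
  moreover have "\<bar>ln (D h ?y)\<bar> \<le> c * w h"
    using abs_ln_D_le[OF h y n] deviation_le[OF h le(1)] by linarith
  ultimately show ?case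
    using word_cost_mult.IH[OF le(2)] word_cost_mult.prems by (fastforce simp: distrib_left)
qed

text \<open>A discrete Gronwall argument. Write \<open>(h g)' = q g' + g'\<close> with \<open>q = h' \<circ> G - 1\<close>, where \<open>G\<close> is
  the lift of \<open>g\<close>. By the bounds of order \<open>m\<close> for \<open>g'\<close>, all derivatives of \<open>q\<close> up to order
  \<open>m + 1\<close> are at most \<open>K w h\<close>. If \<open>a\<close> bounds the derivative of \<open>g'\<close> of order \<open>m + 1\<close>, then
  \<open>nth_deriv_within_mult_bound\<close> shows that the quantity \<open>a + 2\<^sup>m\<^sup>+\<^sup>1 b\<close> grows by a factor of at most
  \<open>1 + K w h \<le> exp (K w h)\<close> when \<open>g\<close> is replaced by \<open>h g\<close>.\<close>

lemma word_cost_C_bounded_Suc: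
  assumes m: "Suc m \<le> n" and b: "0 \<le> b"
    and C: "\<And>h s. word_cost w h s \<Longrightarrow> s \<le> r \<Longrightarrow> C_bounded_on (lift_dom M) m b (D h)"
  shows "word_cost w h s \<Longrightarrow> s \<le> r \<Longrightarrow> x \<in> lift_dom M \<Longrightarrow>
    \<bar>nth_deriv_within (lift_dom M) (Suc m) (D h) x\<bar> + 2 ^ Suc m * b \<le>
      2 ^ Suc m * b * exp (c * compose_bound (Suc m) b * s)"
proof (induction arbitrary: x rule: word_cost.induct)
  case word_cost_one
  have "nth_deriv_within (lift_dom M) (Suc m) (D \<one>\<^bsub>G\<^esub>) x = nth_deriv_within (lift_dom M) (Suc m) (\<lambda>x. 1) x"
    by (rule nth_deriv_within_cong) (use D_one word_cost_one in auto)
  also have "\<dots> = nth_deriv_within (lift_dom M) m (\<lambda>x. 0) x"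
    by (rule lift_dom.nth_deriv_within_Suc) (use word_cost_one in auto)
  also have "\<dots> = 0"
    using C_bounded_on_boundD[OF lift_dom.C_bounded_on_const[of 0 0 M m] order_refl] word_cost_one by simp
  finally show ?case by simp
next
  case (word_cost_mult h g s)
  let ?S = "lift_dom M" and ?a0 = "2 ^ Suc m * b" and ?K = "c * compose_bound (Suc m) b"
  note g = word_cost_carrier[OF word_cost_mult.hyps(2)] and h = word_cost_mult.hyps(1)
  have le: "w h \<le> r" "s \<le> r"
    using word_cost_mult.prems w_nonneg[OF h] word_cost_nonneg[OF w_nonneg word_cost_mult.hyps(2)] by auto
  have x: "x \<in> ?S"
    using word_cost_mult.prems by blast
  define a where "a = ?a0 * exp (?K * s) - ?a0"
  have a: "\<bar>nth_deriv_within ?S (Suc m) (D g) y\<bar> \<le> a" if "y \<in> ?S" for y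
    using word_cost_mult.IH[OF le(2) that] by (simp add: a_def)
  have Cg: "C_bounded_on ?S m b (D g)"
    using C word_cost_mult.hyps le by blast
  have gn: "C_class_on (enat (Suc m)) ?S (D g)"
  proof -
    obtain b' where "C_bounded_on ?S n b' (D g)"
      using D_bounded[OF g n] by blast
    then show ?thesis
      unfolding C_bounded_on_def using C_class_on_mono m by (metis enat_ord_simps(1))
  qed
  let ?q = "\<lambda>x. D h (the_lift M g x) - 1"
  have w0: "0 \<le> c * w h"
    using c w_nonneg[OF h] by simp
  have "C_bounded_on ?S n (Diff_metric M (Suc n) h \<one>\<^bsub>G\<^esub>) (\<lambda>x. D h x - D \<one>\<^bsub>G\<^esub> x)"
    using mfd_deriv_diff_C_bounded[of h M n "\<one>\<^bsub>G\<^esub>"] in_Diff_plus[OF _ n] h by blast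
  then have "C_bounded_on ?S n (Diff_metric M (Suc n) h \<one>\<^bsub>G\<^esub>) (\<lambda>x. D h x - 1)"
    by (rule C_bounded_on_transform) (simp add: D_one)
  then have "C_bounded_on ?S (Suc m) (c * w h) (\<lambda>x. D h x - 1)"
    by (rule C_bounded_on_mono)
      (use m deviation_le[OF h le(1)] Diff_metric_nonneg[of "Suc n" M "inv\<^bsub>G\<^esub> h" "\<one>\<^bsub>G\<^esub>"] in \<open>auto simp: deviation_def\<close>)
  then have q: "C_bounded_on ?S (Suc m) (c * w h * compose_bound (Suc m) b) ?q"
    using Cg the_lift_mem[OF g] the_lift_deriv[OF g] w0 b
    by (intro lift_dom.C_bounded_on_compose[where u = "\<lambda>x. D h x - 1" and G' = "D g"]) auto
  then have q': "C_bounded_on ?S (Suc m) (?K * w h) ?q"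
    by (simp only: mult_ac)
  have Kw: "0 \<le> ?K * w h"
    using c w_nonneg[OF h] compose_bound_ge_1[OF b, of "Suc m"] by (intro mult_nonneg_nonneg) auto
  have prod: "\<bar>nth_deriv_within ?S (Suc m) (\<lambda>x. ?q x * D g x) x\<bar> \<le> ?K * w h * (a + ?a0)"
    using C_bounded_on_boundD[OF Cg] by (intro lift_dom.nth_deriv_within_mult_bound[OF q' gn _ a Kw b x]) auto
  have Cq: "C_class_on (enat (Suc m)) ?S (\<lambda>x. ?q x * D g x)"
  proof -
    have "C_bounded_on ?S (Suc m) (max a b) (D g)"
      unfolding C_bounded_on_def
    proof (intro conjI gn allI impI ballI)
      fix i y assume "i \<le> Suc m" "y \<in> ?S"
      then show "\<bar>nth_deriv_within ?S i (D g) y\<bar> \<le> max a b"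
        using a[of y] C_bounded_on_boundD[OF Cg, of i y] by (cases "i = Suc m") (auto simp del: nth_deriv_within.simps)
    qed
    from lift_dom.C_bounded_on_mult[OF q' this Kw] show ?thesis
      using b by (simp add: C_bounded_on_def max.coboundedI2)
  qed
  have "nth_deriv_within ?S (Suc m) (D (h \<otimes>\<^bsub>G\<^esub> g)) x =
      nth_deriv_within ?S (Suc m) (\<lambda>x. ?q x * D g x + 1 * D g x) x"
    by (rule nth_deriv_within_cong) (use D_mult[OF h g] x in \<open>auto simp: algebra_simps\<close>)
  also have "\<dots> = nth_deriv_within ?S (Suc m) (\<lambda>x. ?q x * D g x) x + 1 * nth_deriv_within ?S (Suc m) (D g) x"
    by (rule lift_dom.nth_deriv_within_add_cmult[OF Cq gn x])
  finally have "\<bar>nth_deriv_within ?S (Suc m) (D (h \<otimes>\<^bsub>G\<^esub> g)) x\<bar> + ?a0 \<le> (1 + ?K * w h) * (a + ?a0)"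
    using prod a[OF x] by (simp add: algebra_simps del: nth_deriv_within.simps)
  also have "\<dots> \<le> exp (?K * w h) * (a + ?a0)"
  proof (intro mult_right_mono)
    show "1 + ?K * w h \<le> exp (?K * w h)"
      by (rule exp_ge_add_one_self)
    show "0 \<le> a + ?a0"
      using b by (simp add: a_def)
  qed
  also have "\<dots> = ?a0 * exp (?K * (w h + s))"
    by (simp add: a_def distrib_left exp_add)
  finally show ?case .
qed

text \<open>By induction on the order: \<open>ln h'\<close> takes care of order zero and the Gronwall estimate of each
  further order.\<close>

lemma word_cost_C_bounded:
  "m \<le> n \<Longrightarrow> \<exists>b\<ge>0. \<forall>h s. word_cost w h s \<longrightarrow> s \<le> r \<longrightarrow> C_bounded_on (lift_dom M) m b (D h)"
proof (induction m)
  case 0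
  have "C_bounded_on (lift_dom M) 0 (exp (c * r)) (D h)" if h: "word_cost w h s" "s \<le> r" for h s
  proof -
    obtain b where "C_bounded_on (lift_dom M) n b (D h)"
      using D_bounded[OF word_cost_carrier[OF h(1)] n] by blast
    then have "continuous_on (lift_dom M) (D h)"
      using C_bounded_on_mono[of "lift_dom M" n b "D h" 0 b] lift_dom.C_bounded_on_0 by blast
    moreover have "\<bar>D h x\<bar> \<le> exp (c * r)" if x: "x \<in> lift_dom M" for x
    proof -
      have "ln (D h x) \<le> c * r"
        using word_cost_abs_ln_D[OF h x] mult_left_mono[OF h(2) c] by linarith
      then show ?thesis
        using D_pos[OF word_cost_carrier[OF h(1)] x] by (simp add: ln_le_cancel_iff[symmetric] del: ln_le_cancel_iff)
    qed
    ultimately show ?thesis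
      using lift_dom.C_bounded_on_0 by blast
  qed
  then show ?case
    by (meson exp_ge_zero)
next
  case (Suc m)
  then obtain b where b: "0 \<le> b" "\<And>h s. word_cost w h s \<Longrightarrow> s \<le> r \<Longrightarrow> C_bounded_on (lift_dom M) m b (D h)"
    by (meson Suc_leD)
  let ?a0 = "2 ^ Suc m * b" and ?K = "c * compose_bound (Suc m) b"
  define B where "B = b + ?a0 * exp (?K * r)"
  have B: "b \<le> B" "0 \<le> B"
    using b by (auto simp: B_def)
  have "C_bounded_on (lift_dom M) (Suc m) B (D h)" if h: "word_cost w h s" "s \<le> r" for h s
  proof -
    obtain b' where b': "C_bounded_on (lift_dom M) n b' (D h)"
      using D_bounded[OF word_cost_carrier[OF h(1)] n] by blast
    have "\<bar>nth_deriv_within (lift_dom M) i (D h) x\<bar> \<le> B" if i: "i \<le> Suc m" and x: "x \<in> lift_dom M" for i x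
    proof (cases "i = Suc m")
      case True
      have "0 \<le> ?K"
        using c compose_bound_ge_1[OF b(1), of "Suc m"] by (intro mult_nonneg_nonneg) auto
      from mult_left_mono[OF h(2) this] have "?a0 * exp (?K * s) \<le> ?a0 * exp (?K * r)"
        using b(1) by (intro mult_left_mono) (simp_all del: compose_bound.simps)
      moreover have "\<bar>nth_deriv_within (lift_dom M) (Suc m) (D h) x\<bar> + ?a0 \<le> ?a0 * exp (?K * s)"
        by (rule word_cost_C_bounded_Suc[OF Suc.prems b(1) _ h x]) (rule b(2))
      moreover have "0 \<le> ?a0"
        using b(1) by simp
      ultimately show ?thesis
        unfolding True B_def using b(1) by linarith
    next
      case False
      then show ?thesis
        using C_bounded_on_boundD[OF b(2)[OF h], of i x] i x B by linarith
    qed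
    moreover have "C_class_on (enat (Suc m)) (lift_dom M) (D h)"
      using b' C_class_on_mono Suc.prems unfolding C_bounded_on_def by (metis enat_ord_simps(1))
    ultimately show ?thesis
      unfolding C_bounded_on_def by blast
  qed
  then show ?case
    using B by blast
qed

text \<open>The partial products have bounded derivatives. Right multiplication by them is therefore
  uniformly Lipschitz, and each factor moves the product by a distance proportional to its weight.\<close>

lemma word_cost_Diff_metric:
  obtains C where "0 \<le> C" "\<And>h s. word_cost w h s \<Longrightarrow> s \<le> r \<Longrightarrow> Diff_metric M (Suc n) h \<one>\<^bsub>G\<^esub> \<le> C * s"
proof -
  let ?\<rho> = "Diff_metric M (Suc n)"
  interpret Metric_space "carrier G" "?\<rho>"
    using Metric_space_Diff_metric' n carrier_G by simp
  obtain b where b: "0 \<le> b" "\<And>h s. word_cost w h s \<Longrightarrow> s \<le> r \<Longrightarrow> C_bounded_on (lift_dom M) n b (D h)"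
    using word_cost_C_bounded[OF order_refl] by blast
  let ?C = "mult_bound n b * c"
  have "?\<rho> h \<one>\<^bsub>G\<^esub> \<le> ?C * s" if "word_cost w h s" "s \<le> r" for h s
    using that
  proof (induction rule: word_cost.induct)
    case word_cost_one
    then show ?case by simp
  next
    case (word_cost_mult h g s)
    note g = word_cost_carrier[OF word_cost_mult.hyps(2)] and h = word_cost_mult.hyps(1)
    have le: "w h \<le> r" "s \<le> r"
      using word_cost_mult.prems w_nonneg[OF h] word_cost_nonneg[OF w_nonneg word_cost_mult.hyps(2)] by auto
    have "?\<rho> (h \<otimes>\<^bsub>G\<^esub> g) (\<one>\<^bsub>G\<^esub> \<otimes>\<^bsub>G\<^esub> g) \<le> mult_bound n b * ?\<rho> h \<one>\<^bsub>G\<^esub>"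
      using b(2)[OF word_cost_mult.hyps(2) le(2)] g h n b(1) by (intro Diff_metric_right_mult) auto
    moreover have "?\<rho> h \<one>\<^bsub>G\<^esub> \<le> c * w h"
      using deviation_le[OF h le(1)] nonneg[of "inv\<^bsub>G\<^esub> h" "\<one>\<^bsub>G\<^esub>"]
      unfolding deviation_def by linarith
    then have "mult_bound n b * ?\<rho> h \<one>\<^bsub>G\<^esub> \<le> mult_bound n b * (c * w h)"
      using mult_bound_ge_1[OF b(1), of n] by (intro mult_left_mono) auto
    ultimately have "?\<rho> (h \<otimes>\<^bsub>G\<^esub> g) g \<le> ?C * w h"
      using g by (simp add: mult.assoc)
    moreover have "?\<rho> (h \<otimes>\<^bsub>G\<^esub> g) \<one>\<^bsub>G\<^esub> \<le> ?\<rho> (h \<otimes>\<^bsub>G\<^esub> g) g + ?\<rho> g \<one>\<^bsub>G\<^esub>"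
      using g h by (intro triangle) auto
    ultimately show ?case
      using word_cost_mult.IH[OF le(2)] by (simp add: algebra_simps)
  qed
  moreover have "0 \<le> ?C"
    using mult_bound_ge_1[OF b(1), of n] c by simp
  ultimately show ?thesis
    using that by blast
qed

end

end


context diffeo_group
begin

definition orders :: "nat set" where
  "orders = {n. 1 \<le> n \<and> enat n \<le> k}"

lemma one_in_orders: "1 \<in> orders"
  using one_le_k by (simp add: orders_def one_enat_def)

text \<open>The first summand controls order \<open>j\<close> at all scales. The supremum controls every order at small
  scales, which makes the metric compatible with the topology; since it is at most one, it leaves
  the large scales alone.\<close>

definition weight :: "nat \<Rightarrow> (real \<Rightarrow> real) \<Rightarrow> real" where
  "weight j h = deviation j h + (SUP n\<in>orders. min ((1 / 2) ^ n) (deviation n h))"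

lemma weight_bdd: "bdd_above ((\<lambda>n. min ((1 / 2) ^ n) (deviation n h)) ` orders)"
proof (rule bdd_aboveI2[where M = 1])
  fix n
  have "(1 / 2 :: real) ^ n \<le> 1"
    by (intro power_le_one) auto
  then show "min ((1 / 2) ^ n) (deviation n h) \<le> 1"
    by linarith
qed

lemma min_le_weight:
  assumes "j \<in> orders" "n \<in> orders"
  shows "deviation j h + min ((1 / 2) ^ n) (deviation n h) \<le> weight j h"
  unfolding weight_def using weight_bdd assms by (intro add_left_mono cSUP_upper) auto

lemma deviation_le_weight: "j \<in> orders \<Longrightarrow> deviation j h \<le> weight j h"
  using min_le_weight[of j j h] deviation_nonneg[of j h] orders_def
  by (smt (verit) mem_Collect_eq zero_le_divide_1_iff zero_le_numeral zero_le_power)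

lemma weight_nonneg: "j \<in> orders \<Longrightarrow> 0 \<le> weight j h"
  using deviation_le_weight[of j h] deviation_nonneg[of j h] by (auto simp: orders_def)

lemma weight_inv: "h \<in> carrier G \<Longrightarrow> weight j (inv\<^bsub>G\<^esub> h) = weight j h"
  by (simp add: weight_def deviation_inv)

text \<open>A weight below \<open>2\<^sup>-\<^sup>n\<close> means that the minimum in the supremum is not attained by the cap.\<close>

lemma deviation_le_small_weight:
  assumes j: "j \<in> orders" and n: "n \<in> orders" and "weight j h \<le> (1 / 2) ^ Suc n"
  shows "deviation n h \<le> weight j h"
proof -
  have "min ((1 / 2) ^ n) (deviation n h) \<le> weight j h"
    using min_le_weight[OF j n, of h] deviation_nonneg[of j h] j by (simp add: orders_def)
  moreover have "(1 / 2 :: real) ^ Suc n < (1 / 2) ^ n"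
    by simp
  ultimately show ?thesis
    using assms(3) by linarith
qed

text \<open>Beyond a certain order the terms of the supremum are below \<open>e\<close> whatever \<open>h\<close> is, and the others are
  dominated by the one of the largest order \<open>n\<close>. For finite \<open>k\<close> too small to reach that order, \<open>n\<close> is
  \<open>k\<close> itself.\<close>

lemma weight_le:
  assumes j: "j \<in> orders" and e: "0 < e"
  obtains n where "n \<in> orders" "\<And>h. h \<in> carrier G \<Longrightarrow> weight j h \<le> 2 * deviation n h + e"
proof -
  obtain N where N: "(1 / 2 :: real) ^ N < e"
    using real_arch_pow_inv[OF e, of "1 / 2"] by auto
  obtain n where n: "n \<in> orders" "j \<le> n" "\<And>i. i \<in> orders \<Longrightarrow> i \<le> n \<or> N \<le> i"
  proof (cases "enat (max N j) \<le> k")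
    case True
    then show ?thesis
      using j by (intro that[of "max N j"]) (auto simp: orders_def)
  next
    case False
    then obtain m where "k = enat m"
      by (cases k) auto
    then show ?thesis
      using j unfolding orders_def by (intro that[unfolded orders_def, of m]) auto
  qed
  have "weight j h \<le> 2 * deviation n h + e" if h: "h \<in> carrier G" for h
  proof -
    have n1: "1 \<le> n" "enat n \<le> k"
      using n(1) by (auto simp: orders_def)
    have "min ((1 / 2) ^ i) (deviation i h) \<le> deviation n h + e" if i: "i \<in> orders" for i
      using n(3)[OF i]
    proof
      assume "i \<le> n"
      then show ?thesis
        using deviation_mono[OF h n1(2)] e by (smt (verit))
    next
      assume "N \<le> i"
      then have "(1 / 2 :: real) ^ i \<le> (1 / 2) ^ N"
        by (intro power_decreasing) auto
      then show ?thesis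
        using N deviation_nonneg[OF n1(1), of h] by linarith
    qed
    then have "(SUP n\<in>orders. min ((1 / 2) ^ n) (deviation n h)) \<le> deviation n h + e"
      using one_in_orders by (intro cSUP_least) auto
    then show ?thesis
      unfolding weight_def using deviation_mono[OF h n1(2) n(2)] by linarith
  qed
  then show ?thesis
    using that n(1) by blast
qed

lemma word_cost_weight_small:
  assumes j: "j \<in> orders" and n: "n \<in> orders"
  obtains C where "0 \<le> C" "\<And>h s. word_cost (weight j) h s \<Longrightarrow> s \<le> (1 / 2) ^ Suc n \<Longrightarrow>
    Diff_metric M n h \<one>\<^bsub>G\<^esub> \<le> C * s"
proof -
  obtain i where i: "n = Suc i" "enat (Suc i) \<le> k"
    using n by (cases n) (auto simp: orders_def)
  note result = that
  show ?thesis
  proof (rule word_cost_Diff_metric[of "weight j" i 1 "(1 / 2) ^ Suc n"])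
    show "deviation (Suc i) h \<le> 1 * weight j h" if "weight j h \<le> (1 / 2) ^ Suc n" for h
      using deviation_le_small_weight[OF j n that] i by simp
    show thesis if "0 \<le> C" "\<And>h s. word_cost (weight j) h s \<Longrightarrow> s \<le> (1 / 2) ^ Suc n \<Longrightarrow>
        Diff_metric M (Suc i) h \<one>\<^bsub>G\<^esub> \<le> C * s" for C
      using that unfolding i(1)[symmetric] by (rule result)
  qed (use weight_nonneg[OF j] i(2) in auto)
qed

abbreviation weight_dist :: "nat \<Rightarrow> (real \<Rightarrow> real) \<Rightarrow> (real \<Rightarrow> real) \<Rightarrow> real" where
  "weight_dist j \<equiv> word_dist (weight j)"

lemma Metric_space_weight_dist:
  assumes j: "j \<in> orders"
  shows "Metric_space (carrier G) (weight_dist j)"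
proof (rule Metric_space_word_dist[of "weight j", OF weight_nonneg[OF j] weight_inv])
  fix g assume g: "g \<in> carrier G" and 0: "word_norm (weight j) g = 0"
  interpret Metric_space "carrier G" "Diff_metric M 1"
    using Metric_space_Diff_metric' one_in_orders carrier_G by (simp add: orders_def)
  obtain C where C: "0 \<le> C" "\<And>h s. word_cost (weight j) h s \<Longrightarrow> s \<le> (1 / 2) ^ Suc 1 \<Longrightarrow>
    Diff_metric M 1 h \<one>\<^bsub>G\<^esub> \<le> C * s"
    using word_cost_weight_small[OF j one_in_orders] by metis
  have "Diff_metric M 1 g \<one>\<^bsub>G\<^esub> \<le> 0 + e" if e: "0 < e" for e
  proof -
    define \<delta> where "\<delta> = min ((1 / 2) ^ Suc 1) (e / (C + 1))"
    have "0 < \<delta>"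
      using e C(1) by (simp add: \<delta>_def)
    then obtain s where s: "word_cost (weight j) g s" "s < \<delta>"
      using word_norm_lessE[of "weight j" g \<delta>] weight_nonneg[OF j] g 0 by metis
    have s0: "0 \<le> s"
      using word_cost_nonneg[OF weight_nonneg[OF j] s(1)] .
    have "Diff_metric M 1 g \<one>\<^bsub>G\<^esub> \<le> C * s"
      using C(2)[OF s(1)] s(2) by (simp add: \<delta>_def)
    also have "\<dots> \<le> (C + 1) * s"
      using s0 by (simp add: distrib_right)
    also have "\<dots> \<le> e"
      using s(2) C(1) by (simp add: \<delta>_def pos_less_divide_eq mult.commute)
    finally show ?thesis by simp
  qed
  then have "Diff_metric M 1 g \<one>\<^bsub>G\<^esub> \<le> 0"
    by (rule field_le_epsilon)
  then show "g = \<one>\<^bsub>G\<^esub>"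
    using zero[OF g one_closed] nonneg[of g "\<one>\<^bsub>G\<^esub>"] by linarith
qed

text \<open>This lemma and the next show that the metric is compatible with the topology. The first direction
  bounds the infimum by the trivial decomposition of \<open>f g\<^sup>-\<^sup>1\<close> into one factor.\<close>

lemma weight_dist_le:
  assumes j: "j \<in> orders" and f: "f \<in> carrier G" and e: "0 < e"
  obtains n \<delta> where "n \<in> orders" "0 < \<delta>"
    "\<And>g. g \<in> carrier G \<Longrightarrow> Diff_metric M n f g < \<delta> \<Longrightarrow> weight_dist j f g < e"
proof -
  obtain n where n: "n \<in> orders" "\<And>h. h \<in> carrier G \<Longrightarrow> weight j h \<le> 2 * deviation n h + e / 2"
    using weight_le[OF j half_gt_zero[OF e]] by metis
  obtain i where i: "n = Suc i" "enat (Suc i) \<le> k"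
    using n(1) by (cases n) (auto simp: orders_def)
  obtain C r where C: "0 < r" "0 < C" "\<And>g. g \<in> carrier G \<Longrightarrow> Diff_metric M n f g < r \<Longrightarrow>
      deviation n (f \<otimes>\<^bsub>G\<^esub> inv\<^bsub>G\<^esub> g) \<le> C * Diff_metric M n f g"
    using deviation_quotient_le[OF f i(2)] i(1) by metis
  have "weight_dist j f g < e" if g: "g \<in> carrier G" and lt: "Diff_metric M n f g < min r (e / (4 * C))" for g
  proof -
    let ?h = "f \<otimes>\<^bsub>G\<^esub> inv\<^bsub>G\<^esub> g"
    have h: "?h \<in> carrier G"
      using f g by simp
    have "weight_dist j f g \<le> weight j ?h"
      using word_norm_le[OF weight_nonneg[OF j] word_cost_self[OF h]] f g word_dist_def[OF weight_nonneg[OF j]] by simp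
    also have "\<dots> \<le> 2 * deviation n ?h + e / 2"
      by (rule n(2)[OF h])
    also have "\<dots> \<le> 2 * (C * Diff_metric M n f g) + e / 2"
      using C(3)[OF g] lt by simp
    also have "\<dots> < e"
      using lt C(2) by (simp add: pos_less_divide_eq field_simps)
    finally show ?thesis .
  qed
  then show ?thesis
    using that[of n "min r (e / (4 * C))"] n(1) C e by simp
qed

text \<open>Conversely, a cheap decomposition of \<open>h = g f\<^sup>-\<^sup>1\<close> places \<open>h\<close> near the identity, and right
  multiplication by the fixed \<open>f\<close> places \<open>g\<close> near \<open>f\<close>.\<close>

lemma Diff_metric_less_if_weight_dist_less:
  assumes j: "j \<in> orders" and n: "n \<in> orders" and f: "f \<in> carrier G" and e: "0 < e"
  obtains \<delta> where "0 < \<delta>" "\<And>g. g \<in> carrier G \<Longrightarrow> weight_dist j f g < \<delta> \<Longrightarrow> Diff_metric M n f g < e"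
proof -
  interpret W: Metric_space "carrier G" "weight_dist j"
    by (rule Metric_space_weight_dist[OF j])
  interpret Metric_space "carrier G" "Diff_metric M n"
    using Metric_space_Diff_metric' n carrier_G by (simp add: orders_def)
  obtain i where i: "n = Suc i" "enat (Suc i) \<le> k"
    using n by (cases n) (auto simp: orders_def)
  obtain b where b: "0 \<le> b" "C_bounded_on (lift_dom M) i b (D f)"
    using D_bounded[OF f i(2)] .
  define K where "K = mult_bound i b"
  have K: "1 \<le> K"
    unfolding K_def by (rule mult_bound_ge_1[OF b(1)])
  obtain C where C: "0 \<le> C" "\<And>h s. word_cost (weight j) h s \<Longrightarrow> s \<le> (1 / 2) ^ Suc n \<Longrightarrow>
    Diff_metric M n h \<one>\<^bsub>G\<^esub> \<le> C * s"
    using word_cost_weight_small[OF j n] by metis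
  define \<delta> where "\<delta> = min ((1 / 2) ^ Suc n) (e / (K * (C + 1)))"
  have "Diff_metric M n f g < e" if g: "g \<in> carrier G" and lt: "weight_dist j f g < \<delta>" for g
  proof -
    let ?h = "g \<otimes>\<^bsub>G\<^esub> inv\<^bsub>G\<^esub> f"
    have h: "?h \<in> carrier G" "?h \<otimes>\<^bsub>G\<^esub> f = g"
      using f g by (simp_all add: m_assoc)
    have "word_norm (weight j) ?h < \<delta>"
      using lt W.commute[of f g] f g word_dist_def[OF weight_nonneg[OF j]] by simp
    then obtain s where s: "word_cost (weight j) ?h s" "s < \<delta>"
      using word_norm_lessE[of "weight j" ?h \<delta>] weight_nonneg[OF j] h(1) by metis
    have s0: "0 \<le> s"
      using word_cost_nonneg[OF weight_nonneg[OF j] s(1)] .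
    have "Diff_metric M n (?h \<otimes>\<^bsub>G\<^esub> f) (\<one>\<^bsub>G\<^esub> \<otimes>\<^bsub>G\<^esub> f) \<le> K * Diff_metric M n ?h \<one>\<^bsub>G\<^esub>"
      unfolding K_def i(1) using h f b i by (intro Diff_metric_right_mult) auto
    also have "\<dots> \<le> K * (C * s)"
      using C(2)[OF s(1)] s(2) K by (intro mult_left_mono) (auto simp: \<delta>_def)
    also have "\<dots> \<le> (K * (C + 1)) * s"
      using K s0 by (simp add: distrib_left distrib_right)
    also have "\<dots> < e"
    proof -
      have "0 < K * (C + 1)"
        using K C(1) by simp
      then show ?thesis
        using s(2) by (simp add: \<delta>_def pos_less_divide_eq mult.commute)
    qed
    finally show ?thesis
      using h f commute[of f g] by simp
  qed
  moreover have "0 < \<delta>"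
    unfolding \<delta>_def using e K C(1) by simp
  ultimately show ?thesis
    using that by blast
qed

lemma weight_dist_topology:
  assumes j: "j \<in> orders"
  shows "Metric_space.mtopology (carrier G) (weight_dist j) = Diff_topology M k"
proof (rule topology_eq[THEN iffD2], intro allI)
  fix U
  interpret W: Metric_space "carrier G" "weight_dist j"
    by (rule Metric_space_weight_dist[OF j])
  have ball: "W.mball f e \<subseteq> U \<longleftrightarrow> (\<forall>g\<in>carrier G. weight_dist j f g < e \<longrightarrow> g \<in> U)"
    if "f \<in> carrier G" for f e
    using that by auto
  show "openin W.mtopology U \<longleftrightarrow> openin (Diff_topology M k) U"
    unfolding openin_Diff_topology[OF one_le_k] W.openin_mtopology carrier_G[symmetric]
  proof (intro conj_cong refl iffI ballI allI impI)
    fix f assume U: "U \<subseteq> carrier G" and *: "\<forall>f. f \<in> U \<longrightarrow> (\<exists>r>0. W.mball f r \<subseteq> U)" and f: "f \<in> U"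
    then obtain e where e: "0 < e" "\<forall>g\<in>carrier G. weight_dist j f g < e \<longrightarrow> g \<in> U"
      using ball by (meson subsetD)
    then obtain n \<delta> where "n \<in> orders" "0 < \<delta>"
      "\<And>g. g \<in> carrier G \<Longrightarrow> Diff_metric M n f g < \<delta> \<Longrightarrow> weight_dist j f g < e"
      using weight_dist_le[OF j subsetD[OF U f] e(1)] by metis
    then show "\<exists>n\<ge>1. enat n \<le> k \<and> (\<exists>e>0. \<forall>g\<in>carrier G. Diff_metric M n f g < e \<longrightarrow> g \<in> U)"
      using e(2) unfolding orders_def by blast
  next
    fix f assume U: "U \<subseteq> carrier G" and f: "f \<in> U"
      and *: "\<forall>f\<in>U. \<exists>n\<ge>1. enat n \<le> k \<and> (\<exists>e>0. \<forall>g\<in>carrier G. Diff_metric M n f g < e \<longrightarrow> g \<in> U)"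
    then obtain n e where n: "n \<in> orders" "0 < e" "\<forall>g\<in>carrier G. Diff_metric M n f g < e \<longrightarrow> g \<in> U"
      unfolding orders_def by blast
    then obtain \<delta> where "0 < \<delta>" "\<And>g. g \<in> carrier G \<Longrightarrow> weight_dist j f g < \<delta> \<Longrightarrow> Diff_metric M n f g < e"
      using Diff_metric_less_if_weight_dist_less[OF j n(1) subsetD[OF U f]] by metis
    then show "\<exists>r>0. W.mball f r \<subseteq> U"
      using n(3) ball[OF subsetD[OF U f]] by meson
  qed
qed

text \<open>For the metric of order \<open>n + 1\<close>, all elements of \<open>A\<close> have decompositions of cost at most \<open>r\<close>.\<close>

lemma bounded_if_OB:
  assumes OB: "property_OB_in G (Diff_topology M k) A" and A: "A \<subseteq> carrier G" and n: "enat (Suc n) \<le> k"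
  shows "\<exists>b. \<forall>f\<in>A. C_bounded_on (lift_dom M) n b (D f) \<and> (\<forall>x\<in>lift_dom M. \<bar>ln (D f x)\<bar> \<le> b)"
proof (cases "A = {}")
  case False
  define j where "j = Suc n"
  have j: "j \<in> orders"
    using n by (simp add: orders_def j_def)
  interpret W: Metric_space "carrier G" "weight_dist j"
    by (rule Metric_space_weight_dist[OF j])
  have "\<forall>x\<in>carrier G. \<forall>y\<in>carrier G. \<forall>g\<in>carrier G.
      weight_dist j (x \<otimes>\<^bsub>G\<^esub> g) (y \<otimes>\<^bsub>G\<^esub> g) = weight_dist j x y"
    by (intro ballI word_dist_right_invariant[of "weight j"] weight_nonneg[OF j])
  with OB[unfolded property_OB_in_def, rule_format, of "weight_dist j"] W.Metric_space_axioms
  obtain B where B: "\<And>f g. f \<in> A \<Longrightarrow> g \<in> A \<Longrightarrow> weight_dist j f g \<le> B"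
    unfolding weight_dist_topology[OF j] by blast
  obtain f0 where f0: "f0 \<in> A"
    using False by blast
  define r where "r = B + weight_dist j f0 \<one>\<^bsub>G\<^esub> + 1"
  have cost: "\<exists>s\<le>r. word_cost (weight j) f s" if f: "f \<in> A" for f
  proof -
    have fG: "f \<in> carrier G" "f0 \<in> carrier G"
      using f f0 A by blast+
    have "weight_dist j f \<one>\<^bsub>G\<^esub> \<le> B + weight_dist j f0 \<one>\<^bsub>G\<^esub>"
      using W.triangle[OF fG one_closed] B[OF f f0] by linarith
    then have "word_norm (weight j) f < r"
      using fG word_dist_def[OF weight_nonneg[OF j]] by (simp add: r_def)
    then show ?thesis
      using word_norm_lessE[of "weight j" f r] weight_nonneg[OF j] fG(1) by (metis less_imp_le)
  qed
  have dev: "deviation (Suc n) h \<le> 1 * weight j h" for h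
    using deviation_le_weight[OF j, of h] by (simp add: j_def)
  obtain b where b: "0 \<le> b"
    "\<And>h s. word_cost (weight j) h s \<Longrightarrow> s \<le> r \<Longrightarrow> C_bounded_on (lift_dom M) n b (D h)"
    using word_cost_C_bounded[of "weight j" n 1 r n] weight_nonneg[OF j] n dev by auto
  have "C_bounded_on (lift_dom M) n (max b r) (D f) \<and> (\<forall>x\<in>lift_dom M. \<bar>ln (D f x)\<bar> \<le> max b r)"
    if f: "f \<in> A" for f
  proof -
    obtain s where s: "s \<le> r" "word_cost (weight j) f s"
      using cost[OF f] by blast
    have "\<bar>ln (D f x)\<bar> \<le> max b r" if "x \<in> lift_dom M" for x
      using word_cost_abs_ln_D[of "weight j" n 1 r f s x] weight_nonneg[OF j] n dev s that by simp
    then show ?thesis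
      using C_bounded_on_mono[OF b(2)[OF s(2,1)] order_refl, of "max b r"] by simp
  qed
  then show ?thesis
    by blast
qed simp

end


section \<open>The characterization\<close>

lemma SUP_SUP_ereal_less_infinity_iff:
  "(SUP f\<in>A. SUP x\<in>P. ereal (u f x)) < \<infinity> \<longleftrightarrow> (\<exists>B. \<forall>f\<in>A. \<forall>x\<in>P. u f x \<le> B)"
proof
  assume "(SUP f\<in>A. SUP x\<in>P. ereal (u f x)) < \<infinity>"
  then obtain n :: nat where n: "(SUP f\<in>A. SUP x\<in>P. ereal (u f x)) < ereal (real n)"
    using less_PInf_Ex_of_nat by (metis less_irrefl)
  have "u f x \<le> real n" if "f \<in> A" "x \<in> P" for f x
  proof -
    have "ereal (u f x) \<le> (SUP f\<in>A. SUP x\<in>P. ereal (u f x))"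
      using that by (intro SUP_upper2[of f A] SUP_upper2[of x P]) auto
    then have "ereal (u f x) < ereal (real n)"
      using n by (rule le_less_trans)
    then show ?thesis
      by simp
  qed
  then show "\<exists>B. \<forall>f\<in>A. \<forall>x\<in>P. u f x \<le> B"
    by blast
next
  assume "\<exists>B. \<forall>f\<in>A. \<forall>x\<in>P. u f x \<le> B"
  then obtain B where "\<forall>f\<in>A. \<forall>x\<in>P. u f x \<le> B"
    by blast
  then have "(SUP f\<in>A. SUP x\<in>P. ereal (u f x)) \<le> ereal B"
    by (intro SUP_least) auto
  then show "(SUP f\<in>A. SUP x\<in>P. ereal (u f x)) < \<infinity>"
    by (rule le_less_trans) simp
qed

context diffeo_group
begin

text \<open>The bound on \<open>ln f'\<close> takes the place of the bound on the first derivative.\<close>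

lemma C_bounded_on_D_uniform:
  assumes A: "A \<subseteq> carrier G" and n: "enat (Suc n) \<le> k"
    and ln: "\<And>f x. f \<in> A \<Longrightarrow> x \<in> points M \<Longrightarrow> \<bar>ln (D f x)\<bar> \<le> B"
    and bd: "\<And>j. 2 \<le> j \<Longrightarrow> enat j \<le> k \<Longrightarrow> \<exists>B. \<forall>f\<in>A. \<forall>x\<in>points M. \<bar>mfd_deriv M j f x\<bar> \<le> B"
  shows "\<exists>b\<ge>0. \<forall>f\<in>A. C_bounded_on (lift_dom M) n b (D f)"
proof -
  have "\<exists>b. \<forall>f\<in>A. \<forall>x\<in>lift_dom M. \<bar>nth_deriv_within (lift_dom M) i (D f) x\<bar> \<le> b" if i: "i \<le> n" for i
  proof -
    have "\<exists>b. \<forall>f\<in>A. \<forall>x\<in>points M. \<bar>mfd_deriv M (Suc i) f x\<bar> \<le> b"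
    proof (cases i)
      case 0
      have "\<bar>D f x\<bar> \<le> exp B" if "f \<in> A" "x \<in> points M" for f x
      proof -
        have "0 < D f x"
          using D_pos A that points_subset_lift_dom by blast
        then show ?thesis
          using ln[OF that] exp_le_cancel_iff[of "ln (D f x)" B] by simp
      qed
      then show ?thesis
        using 0 by blast
    next
      case (Suc i')
      have "enat (Suc i) \<le> k"
        using i n by (meson Suc_le_mono enat_ord_simps(1) order_trans)
      then show ?thesis
        using bd[of "Suc i"] Suc by simp
    qed
    then obtain b where b: "\<forall>f\<in>A. \<forall>x\<in>points M. \<bar>mfd_deriv M (Suc i) f x\<bar> \<le> b"
      by blast
    have "\<bar>nth_deriv_within (lift_dom M) i (D f) x\<bar> \<le> b" if "f \<in> A" "x \<in> lift_dom M" for f x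
    proof -
      have "mfd_deriv M (Suc i) f (proj M x) = mfd_deriv M (Suc i) f x"
        using mfd_deriv_proj one_le_k A that carrier_G by blast
      then show ?thesis
        using b that proj_in_points[of x M] unfolding mfd_deriv_Suc[of M i] by metis
    qed
    then show ?thesis
      by blast
  qed
  then obtain b where b: "\<And>i f x. i \<le> n \<Longrightarrow> f \<in> A \<Longrightarrow> x \<in> lift_dom M \<Longrightarrow>
      \<bar>nth_deriv_within (lift_dom M) i (D f) x\<bar> \<le> b i"
    by metis
  define c where "c = (\<Sum>i\<le>n. \<bar>b i\<bar>)"
  have "b i \<le> c" if "i \<le> n" for i
    using member_le_sum[of i "{..n}" "\<lambda>i. \<bar>b i\<bar>"] that by (simp add: c_def)
  then have "C_bounded_on (lift_dom M) n c (D f)" if f: "f \<in> A" for f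
    unfolding C_bounded_on_def
  proof (intro conjI allI impI ballI)
    show "C_class_on (enat n) (lift_dom M) (D f)"
      using D_bounded[OF _ n, of f] f A unfolding C_bounded_on_def by blast
  qed (use b f order_trans in blast)
  moreover have "0 \<le> c"
    by (simp add: c_def sum_nonneg)
  ultimately show ?thesis
    by blast
qed

lemma OB_iff_bounded:
  assumes A: "A \<subseteq> carrier G"
  shows "property_OB_in G (Diff_topology M k) A \<longleftrightarrow>
    (\<exists>B. \<forall>f\<in>A. \<forall>x\<in>points M. \<bar>ln (D f x)\<bar> \<le> B) \<and>
    (\<forall>j. 2 \<le> j \<and> enat j \<le> k \<longrightarrow> (\<exists>B. \<forall>f\<in>A. \<forall>x\<in>points M. \<bar>mfd_deriv M j f x\<bar> \<le> B))"
proof (intro iffI conjI allI impI; (elim conjE)?)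
  assume OB: "property_OB_in G (Diff_topology M k) A"
  show "\<exists>B. \<forall>f\<in>A. \<forall>x\<in>points M. \<bar>ln (D f x)\<bar> \<le> B"
    using bounded_if_OB[OF OB A, of 0] one_le_k one_le_enat_iff points_subset_lift_dom by blast
  fix j :: nat assume j: "2 \<le> j" "enat j \<le> k"
  then obtain i where i: "j = Suc i"
    by (cases j) auto
  then obtain b where "\<forall>f\<in>A. C_bounded_on (lift_dom M) i b (D f)"
    using bounded_if_OB[OF OB A, of i] j by blast
  then have "\<forall>f\<in>A. \<forall>x\<in>points M. \<bar>mfd_deriv M j f x\<bar> \<le> b"
    unfolding i mfd_deriv_Suc[of M i] using C_bounded_on_boundD points_subset_lift_dom by blast
  then show "\<exists>B. \<forall>f\<in>A. \<forall>x\<in>points M. \<bar>mfd_deriv M j f x\<bar> \<le> B"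
    by blast
next
  assume "\<exists>B. \<forall>f\<in>A. \<forall>x\<in>points M. \<bar>ln (D f x)\<bar> \<le> B"
    and bd: "\<forall>j. 2 \<le> j \<and> enat j \<le> k \<longrightarrow> (\<exists>B. \<forall>f\<in>A. \<forall>x\<in>points M. \<bar>mfd_deriv M j f x\<bar> \<le> B)"
  then obtain B where B: "\<And>f x. f \<in> A \<Longrightarrow> x \<in> points M \<Longrightarrow> \<bar>ln (D f x)\<bar> \<le> B"
    by blast
  show "property_OB_in G (Diff_topology M k) A"
  proof (rule OB_if_bounded[OF A exp_gt_zero[of "- B"]])
    fix f x assume f: "f \<in> A" and x: "x \<in> lift_dom M"
    have "D f (proj M x) = D f x"
      using mfd_deriv_proj[of f M k x 0] one_le_k A f x carrier_G by blast
    then have "\<bar>ln (D f x)\<bar> \<le> B"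
      using B[OF f proj_in_points[OF x]] by simp
    then have "- B \<le> ln (D f x)"
      by linarith
    then show "exp (- B) \<le> D f x"
      using D_pos[of f x] f x A exp_le_cancel_iff[of "- B" "ln (D f x)"] by (simp add: subset_iff)
  next
    show "\<exists>b\<ge>0. \<forall>f\<in>A. C_bounded_on (lift_dom M) n b (D f)" if "enat (Suc n) \<le> k" for n
      using C_bounded_on_D_uniform[OF A that B] bd by blast
  qed
qed

end

theorem theorem1p1:
  fixes M :: one_manifold and k :: enat and A :: "(real \<Rightarrow> real) set"
  assumes "1 \<le> k"
    and "A \<subseteq> Diff_plus M k"
  shows "property_OB_in (Diff_group M k) (Diff_topology M k) A \<longleftrightarrow>
    (SUP f\<in>A. SUP x\<in>points M. ereal \<bar>ln (mfd_deriv M 1 f x)\<bar>) < \<infinity> \<and>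
    (\<forall>j::nat. 2 \<le> j \<and> enat j \<le> k \<longrightarrow>
       (SUP f\<in>A. SUP x\<in>points M. ereal \<bar>mfd_deriv M j f x\<bar>) < \<infinity>)"
proof -
  interpret diffeo_group M k
    by unfold_locales (rule assms(1))
  show ?thesis
    unfolding SUP_SUP_ereal_less_infinity_iff One_nat_def
    by (rule OB_iff_bounded) (use assms(2) carrier_G in blast)
qed

end
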